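(* Let $n\ge 1$, let $1<p<r<\infty$, and let $q$ be defined by $\frac1p+\frac1q=1+\frac1r$. Let $k\in\mathrm{Cnv}(p,r)$ be a tempered distribution on $\mathbb{R}^n$ with the following approximation property: for any $\varepsilon>0$ there exists a measurable function $k_\varepsilon$ on $\mathbb{R}^n$ such that (i) $k_\varepsilon$ has finite support (i.e. there is $R>0$ with $k_\varepsilon(x)=0$ for $|x|>R$); (ii) $k_\varepsilon\in L_\infty(\mathbb{R}^n)$; (iii) $\|K_{k-k_\varepsilon}\|_{L_p\to L_r}\le\varepsilon$. Then the operator $K_k: L_p(\mathbb{R}^n)\to L_r(\mathbb{R}^n)$ has a maximizer.
   Context: Write $\|f\|_p$ for $\|f\|_{L_p(\mathbb{R}^n)}$. Let $\mathcal{S}(\mathbb{R}^n)$ be the Schwartz space and $\mathcal{S}'(\mathbb{R}^n)$ the space of tempered distributions. A distribution $k\in\mathcal{S}'(\mathbb{R}^n)$ belongs to $\mathrm{Cnv}(p,r)$ if there is a constant $C$ with $\|k*f\|_r\le C\|f\|_p$ for all $f\in\mathcal{S}(\mathbb{R}^n)$. In this case $K_k: L_p(\mathbb{R}^n)\to L_r(\mathbb{R}^n)$ denotes the unique continuous extension of $f\mapsto k*f$, and $\|K_k\|=\|K_k\|_{L_p\to L_r}$ denotes its operator norm. A maximizer for $K_k$ is a function $f\in L_p(\mathbb{R}^n)$ with $\|f\|_p=1$ and $\|K_kf\|_r=\|K_k\|$. Since (i) and (ii) imply $k_\varepsilon\in L_q$, Young's inequality gives $k_\varepsilon\in\mathrm{Cnv}(p,r)$,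 so $k-k_\varepsilon\in \mathrm{Cnv}(p,r)$ and (iii) is meaningful. *)

theory Defs
  imports "HOL-Analysis.Analysis"
begin

definition partial_deriv ::
    "'n::finite \<Rightarrow> (real^'n \<Rightarrow> complex) \<Rightarrow> real^'n \<Rightarrow> complex" where
  "partial_deriv i f = (\<lambda>x. frechet_derivative f (at x) (axis i 1))"

text \<open>Higher partial derivatives are indexed by finite sequences of coordinate directions.
  For smooth functions the order is irrelevant, so this is the family of all
  derivatives given by multi-indices.\<close>

fun iter_deriv ::
    "'n::finite list \<Rightarrow> (real^'n \<Rightarrow> complex) \<Rightarrow> real^'n \<Rightarrow> complex" where
  "iter_deriv [] f = f"
| "iter_deriv (i # is) f = partial_deriv i (iter_deriv is f)"

definition smooth :: "(real^'n::finite \<Rightarrow> complex) \<Rightarrow> bool" where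
  "smooth f \<longleftrightarrow> (\<forall>is x. iter_deriv is f differentiable (at x))"

definition schwartz_weight ::
    "nat \<Rightarrow> 'n::finite list \<Rightarrow> (real^'n \<Rightarrow> complex) \<Rightarrow> real^'n \<Rightarrow> real" where
  "schwartz_weight m is f x = (1 + norm x) ^ m * cmod (iter_deriv is f x)"

definition schwartz :: "(real^'n::finite \<Rightarrow> complex) set" where
  "schwartz = {f. smooth f \<and> (\<forall>m is. bdd_above (range (schwartz_weight m is f)))}"

definition schwartz_seminorm ::
    "nat \<Rightarrow> 'n::finite list \<Rightarrow> (real^'n \<Rightarrow> complex) \<Rightarrow> real" where
  "schwartz_seminorm m is f = (SUP x. schwartz_weight m is f x)"

definition schwartz_tendsto ::
    "(nat \<Rightarrow> real^'n::finite \<Rightarrow> complex) \<Rightarrow> (real^'n \<Rightarrow> complex) \<Rightarrow> bool" where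
  "schwartz_tendsto u f \<longleftrightarrow>
     (\<forall>m is. (\<lambda>j. schwartz_seminorm m is (\<lambda>x. u j x - f x)) \<longlonglongrightarrow> 0)"

text \<open>The topology of the Schwartz space is given by countably many seminorms, hence is
  metrizable, and continuity is sequential continuity. A tempered distribution is
  represented by a function on all of \<open>real^'n \<Rightarrow> complex\<close>; only its values
  on Schwartz functions carry meaning.\<close>

definition tempered_distribution ::
    "((real^'n::finite \<Rightarrow> complex) \<Rightarrow> complex) \<Rightarrow> bool" where
  "tempered_distribution T \<longleftrightarrow>
     (\<forall>f\<in>schwartz. \<forall>g\<in>schwartz. T (\<lambda>x. f x + g x) = T f + T g) \<and>
     (\<forall>c. \<forall>f\<in>schwartz. T (\<lambda>x. c * f x) = c * T f) \<and>
     (\<forall>u. \<forall>f\<in>schwartz. (\<forall>j. u j \<in> schwartz) \<longrightarrow> schwartz_tendsto u f \<longrightarrow>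
        (\<lambda>j. T (u j)) \<longlonglongrightarrow> T f)"

definition dist_of_fun ::
    "(real^'n::finite \<Rightarrow> complex) \<Rightarrow> (real^'n \<Rightarrow> complex) \<Rightarrow> complex" where
  "dist_of_fun h = (\<lambda>\<phi>. \<integral>y. h y * \<phi> y \<partial>lebesgue)"

definition dist_conv ::
    "((real^'n::finite \<Rightarrow> complex) \<Rightarrow> complex) \<Rightarrow> (real^'n \<Rightarrow> complex) \<Rightarrow> real^'n \<Rightarrow> complex" where
  "dist_conv k f = (\<lambda>x. k (\<lambda>y. f (x - y)))"

text \<open>Elements of the Lebesgue spaces are represented by functions; equality in these
  spaces is equality almost everywhere.\<close>

definition Lp :: "real \<Rightarrow> (real^'n::finite \<Rightarrow> complex) set" where
  "Lp p = {f. f \<in> borel_measurable lebesgue \<and>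
              integrable lebesgue (\<lambda>x. cmod (f x) powr p)}"

definition Lp_norm :: "real \<Rightarrow> (real^'n::finite \<Rightarrow> complex) \<Rightarrow> real" where
  "Lp_norm p f = (\<integral>x. cmod (f x) powr p \<partial>lebesgue) powr (1 / p)"

definition Linf :: "(real^'n::finite \<Rightarrow> complex) set" where
  "Linf = {f. f \<in> borel_measurable lebesgue \<and>
              (\<exists>M. AE x in lebesgue. cmod (f x) \<le> M)}"

definition Cnv :: "real \<Rightarrow> real \<Rightarrow> ((real^'n::finite \<Rightarrow> complex) \<Rightarrow> complex) set" where
  "Cnv p r = {k. tempered_distribution k \<and>
     (\<exists>C. \<forall>f\<in>schwartz. dist_conv k f \<in> Lp r \<and>
            Lp_norm r (dist_conv k f) \<le> C * Lp_norm p f)}"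

definition continuous_Lp ::
    "real \<Rightarrow> real \<Rightarrow> ((real^'n::finite \<Rightarrow> complex) \<Rightarrow> real^'n \<Rightarrow> complex) \<Rightarrow> bool" where
  "continuous_Lp p r K \<longleftrightarrow>
     (\<forall>f\<in>Lp p. K f \<in> Lp r) \<and>
     (\<forall>u. \<forall>f\<in>Lp p. (\<forall>j. u j \<in> Lp p) \<longrightarrow>
        (\<lambda>j. Lp_norm p (\<lambda>x. u j x - f x)) \<longlonglongrightarrow> 0 \<longrightarrow>
        (\<lambda>j. Lp_norm r (\<lambda>x. K (u j) x - K f x)) \<longlonglongrightarrow> 0)"

text \<open>The continuous extension of convolution with \<open>k\<close> is unique only up to
  modification of its values on null sets, hence the choice operator rather than a definite
  description. Continuity along constant sequences makes it compatible with equality almost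
  everywhere.\<close>

definition conv_op ::
    "real \<Rightarrow> real \<Rightarrow> ((real^'n::finite \<Rightarrow> complex) \<Rightarrow> complex) \<Rightarrow>
     (real^'n \<Rightarrow> complex) \<Rightarrow> real^'n \<Rightarrow> complex" where
  "conv_op p r k = (SOME K. continuous_Lp p r K \<and>
     (\<forall>f\<in>schwartz. AE x in lebesgue. K f x = dist_conv k f x))"

definition op_norm ::
    "real \<Rightarrow> real \<Rightarrow> ((real^'n::finite \<Rightarrow> complex) \<Rightarrow> real^'n \<Rightarrow> complex) \<Rightarrow> ennreal" where
  "op_norm p r K = (SUP f\<in>{f \<in> Lp p. Lp_norm p f \<le> 1}. ennreal (Lp_norm r (K f)))"

definition maximizer ::
    "real \<Rightarrow> real \<Rightarrow> ((real^'n::finite \<Rightarrow> complex) \<Rightarrow> real^'n \<Rightarrow> complex) \<Rightarrow>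
     (real^'n \<Rightarrow> complex) \<Rightarrow> bool" where
  "maximizer p r K f \<longleftrightarrow>
     f \<in> Lp p \<and> Lp_norm p f = 1 \<and> ennreal (Lp_norm r (K f)) = op_norm p r K"

end

theory Submission
  imports Defs "HOL-Probability.Distribution_Functions" "HOL-Probability.Sinc_Integral"
    "HOL-Complex_Analysis.Great_Picard"
begin

text \<open>Write \<open>N\<close> for the norm of the operator \<open>K\<close> of convolution with \<open>k\<close>, and assume \<open>N > 0\<close>; if
  \<open>N = 0\<close>, every function of norm one is a maximizer. A maximizing sequence can fail to converge in
  three ways: it can drift to infinity, it can split into pieces that move apart, and it can
  oscillate or concentrate. Translation invariance excludes the first, the inequality \<open>p < r\<close> the
  second, and the approximation by bounded kernels \<open>h\<close> of bounded support the third.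

  No splitting (\<open>separated_pieces\<close>, \<open>near_maximizers_tight\<close>). Let \<open>h\<close> vanish outside the ball of
  radius \<open>R\<close> and let convolution with \<open>h\<close> be close to \<open>K\<close>. If \<open>f\<close> consists of two pieces that lie on
  the two sides of a strip of width \<open>2 R\<close>, then the images of the pieces under convolution with \<open>h\<close>
  have disjoint supports, so the \<open>r\<close>-th powers of their norms add up. With \<open>a\<close> and \<open>b\<close> the \<open>L\<^sub>p\<close> masses
  of the pieces, the sum is at most about \<open>N powr r * (a powr (r / p) + b powr (r / p))\<close>, which for
  \<open>a + b \<le> 1\<close> stays away from \<open>N powr r\<close> unless \<open>a\<close> or \<open>b\<close> is small. A strip of small mass exists,
  because among many parallel strips one is light, and cutting it out changes little. Hence, on either
  side of a median hyperplane, a near-maximizer has little mass at a distance that depends only on the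
  tolerance.

  No drifting. Translate each function of a maximizing sequence so that 0 becomes a median of its mass
  in every coordinate (\<open>exists_centering\<close>). The functions then share one cube for each tolerance
  (\<open>centered_near_maximizers_tight\<close>).

  No loss of compactness. A subsequence converges weakly to some \<open>v\<close> with norm at most one
  (\<open>Lp_weakly_sequentially_compact\<close>). On a fixed cube, convolution with \<open>h\<close> turns weak convergence into
  norm convergence (\<open>kernel_conv_compact\<close>). The errors caused by cutting to the cube and by
  replacing \<open>K\<close> by convolution with \<open>h\<close> are uniformly small, so the norm of \<open>K v\<close> is at least \<open>N\<close>,
  and \<open>v\<close> is a maximizer (\<open>maximizer_exists\<close>).

  Since the extended operator is specified only as some continuous extension from the Schwartz space,
  its existence and its properties rest on the density of Schwartz functions (\<open>schwartz_dense_in_Lp\<close>)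
  and on the completeness of Lebesgue spaces (\<open>Lp_complete\<close>): two continuous operators that agree on
  Schwartz functions agree almost everywhere (\<open>continuous_Lp_unique\<close>). This gives homogeneity,
  translation invariance, and the identification of the operator of \<open>k - h\<close> with the difference of the
  two operators (\<open>conv_op_diff_kernel\<close>).\<close>

section \<open>Lebesgue spaces\<close>

lemma powr_convex_combination:
  fixes x y t p :: real
  assumes "1 \<le> p" "0 \<le> x" "0 \<le> y" "0 \<le> t" "t \<le> 1"
  shows "(t * x + (1 - t) * y) powr p \<le> t * x powr p + (1 - t) * y powr p"
proof -
  have le: "s powr p \<le> s" if "0 \<le> s" "s \<le> 1" for s :: real
    using that assms(1) powr_mono'[of 1 p s] by (cases "s = 0") auto
  have sc: "(s * z) powr p \<le> s * z powr p" if "0 \<le> s" "s \<le> 1" "0 \<le> z" for s z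
    using that le[of s] by (simp add: powr_mult mult_right_mono)
  consider "x = 0" | "y = 0" | "0 < x" "0 < y" using assms by linarith
  then show ?thesis
  proof cases
    case 1 then show ?thesis using sc[of "1 - t" y] assms by simp
  next
    case 2 then show ?thesis using sc[of t x] assms by simp
  next
    case 3
    show ?thesis
      using convex_onD[OF powr_convex[OF assms(1)], of t y x] assms 3
      by (simp add: algebra_simps)
  qed
qed

lemma LpD:
  assumes "f \<in> Lp p"
  shows "f \<in> borel_measurable lebesgue" "integrable lebesgue (\<lambda>x. cmod (f x) powr p)"
  using assms by (auto simp: Lp_def)

lemma Lp_norm_nonneg [simp]: "0 \<le> Lp_norm p f"
  by (simp add: Lp_norm_def)

lemma Lp_norm_powr:
  assumes "0 < p"
  shows "Lp_norm p f powr p = (\<integral>x. cmod (f x) powr p \<partial>lebesgue)"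
  using assms by (simp add: Lp_norm_def powr_powr)

lemma Lp_norm_le_iff:
  assumes "0 < p" "0 \<le> C"
  shows "Lp_norm p f \<le> C \<longleftrightarrow> (\<integral>x. cmod (f x) powr p \<partial>lebesgue) \<le> C powr p"
  unfolding Lp_norm_powr[OF assms(1), symmetric]
  using assms powr_mono2[of p "Lp_norm p f" C] powr_less_mono2[of p C "Lp_norm p f"]
  by (auto simp: not_le[symmetric])

lemma Lp_norm_cong_AE:
  assumes "f \<in> borel_measurable lebesgue" "g \<in> borel_measurable lebesgue" "AE x in lebesgue. f x = g x"
  shows "Lp_norm p f = Lp_norm p g"
  unfolding Lp_norm_def using assms
  by (intro arg_cong[where f = "\<lambda>z. z powr (1/p)"] integral_cong_AE) auto

lemma Lp_cong_AE:
  assumes "f \<in> Lp p" "g \<in> borel_measurable lebesgue" "AE x in lebesgue. f x = g x"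
  shows "g \<in> Lp p" "Lp_norm p g = Lp_norm p f"
proof -
  note [measurable] = LpD(1)[OF assms(1)] assms(2)
  have "integrable lebesgue (\<lambda>x. cmod (g x) powr p)"
    using LpD(2)[OF assms(1)] by (rule integrable_cong_AE_imp) (use assms(3) in auto)
  then show "g \<in> Lp p" using assms(2) by (simp add: Lp_def)
  show "Lp_norm p g = Lp_norm p f"
    by (rule Lp_norm_cong_AE[OF assms(2) LpD(1)[OF assms(1)]]) (use assms(3) in auto)
qed

lemma Lp_mono:
  assumes "0 < p" "g \<in> Lp p" "f \<in> borel_measurable lebesgue" "AE x in lebesgue. cmod (f x) \<le> cmod (g x)"
  shows "f \<in> Lp p" "Lp_norm p f \<le> Lp_norm p g"
proof -
  note [measurable] = LpD(1)[OF assms(2)] assms(3)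
  have le: "AE x in lebesgue. cmod (f x) powr p \<le> cmod (g x) powr p"
    using assms(4) by eventually_elim (auto intro!: powr_mono2 simp: less_imp_le assms(1))
  have "integrable lebesgue (\<lambda>x. cmod (f x) powr p)"
    using LpD(2)[OF assms(2)] by (rule Bochner_Integration.integrable_bound) (use le in auto)
  then show 1: "f \<in> Lp p" using assms(3) by (simp add: Lp_def)
  show "Lp_norm p f \<le> Lp_norm p g"
    unfolding Lp_norm_def using LpD(2)[OF 1] LpD(2)[OF assms(2)] le
    by (intro powr_mono2 integral_mono_AE) (auto simp: assms(1) less_imp_le)
qed

lemma Lp_zero [simp]: "(\<lambda>x. 0) \<in> Lp p" "Lp_norm p (\<lambda>x. 0) = 0"
  by (auto simp: Lp_def Lp_norm_def)

lemma Lp_scale: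
  assumes "0 < p" "f \<in> Lp p"
  shows "(\<lambda>x. c * f x) \<in> Lp p" "Lp_norm p (\<lambda>x. c * f x) = cmod c * Lp_norm p f"
  using assms by (auto simp: Lp_def Lp_norm_def norm_mult powr_mult powr_powr)

lemma Lp_norm_scale:
  assumes "0 < p"
  shows "Lp_norm p (\<lambda>x. c * f x) = cmod c * Lp_norm p f"
  using assms by (auto simp: Lp_norm_def norm_mult powr_mult powr_powr)

lemma Lp_indicator:
  assumes "0 < p" "f \<in> Lp p" "A \<in> sets lebesgue"
  shows "(\<lambda>x. indicator A x * f x) \<in> Lp p" "Lp_norm p (\<lambda>x. indicator A x * f x) \<le> Lp_norm p f"
proof -
  note [measurable] = LpD(1)[OF assms(2)] assms(3)
  have m: "(\<lambda>x. indicator A x * f x) \<in> borel_measurable lebesgue" by measurable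
  have "AE x in lebesgue. cmod (indicator A x * f x) \<le> cmod (f x)"
    by (auto simp: indicator_def)
  from Lp_mono[OF assms(1,2) m this]
  show "(\<lambda>x. indicator A x * f x) \<in> Lp p" "Lp_norm p (\<lambda>x. indicator A x * f x) \<le> Lp_norm p f" by auto
qed

text \<open>The triangle inequality is the convexity of the power function, applied at each point to the
  normalized functions. Normalizing by positive upper bounds of the norms, instead of the norms
  themselves, avoids a separate treatment of functions of norm zero.\<close>

lemma Lp_add_aux:
  assumes p: "1 \<le> p" and f: "f \<in> Lp p" and g: "g \<in> Lp p"
    and a: "Lp_norm p f \<le> \<alpha>" "0 < \<alpha>" and b: "Lp_norm p g \<le> \<beta>" "0 < \<beta>"
  shows "(\<lambda>x. f x + g x) \<in> Lp p" "Lp_norm p (\<lambda>x. f x + g x) \<le> \<alpha> + \<beta>"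
proof -
  note [measurable] = LpD(1)[OF f] LpD(1)[OF g]
  define t where "t = \<alpha> / (\<alpha> + \<beta>)"
  have t: "0 \<le> t" "t \<le> 1" using a b by (auto simp: t_def field_simps)
  have t1: "1 - t = \<beta> / (\<alpha> + \<beta>)" using a b by (simp add: t_def field_simps)
  define G where "G x = (\<alpha> + \<beta>) powr p *
      (t * (cmod (f x) powr p / \<alpha> powr p) + (1 - t) * (cmod (g x) powr p / \<beta> powr p))" for x
  have le: "cmod (f x + g x) powr p \<le> G x" for x
  proof -
    have "cmod (f x + g x) \<le> cmod (f x) + cmod (g x)" by (rule norm_triangle_ineq)
    also have "\<dots> = (\<alpha> + \<beta>) * (t * (cmod (f x) / \<alpha>) + (1 - t) * (cmod (g x) / \<beta>))"
    proof -
      have "(\<alpha> + \<beta>) * (t * (cmod (f x) / \<alpha>)) = cmod (f x)" using a b by (simp add: t_def)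
      moreover have "(\<alpha> + \<beta>) * ((1 - t) * (cmod (g x) / \<beta>)) = cmod (g x)"
        unfolding t1 using a b by simp
      ultimately show ?thesis by (simp add: distrib_left)
    qed
    finally have "cmod (f x + g x) powr p \<le> ((\<alpha> + \<beta>) * (t * (cmod (f x) / \<alpha>) + (1 - t) * (cmod (g x) / \<beta>))) powr p"
      using p by (intro powr_mono2) auto
    also have "\<dots> = (\<alpha> + \<beta>) powr p * (t * (cmod (f x) / \<alpha>) + (1 - t) * (cmod (g x) / \<beta>)) powr p"
      using a b t by (intro powr_mult)
    also have "\<dots> \<le> (\<alpha> + \<beta>) powr p * (t * (cmod (f x) / \<alpha>) powr p + (1 - t) * (cmod (g x) / \<beta>) powr p)"
      using a b t p by (intro mult_left_mono powr_convex_combination) auto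
    finally show ?thesis using a b by (simp add: G_def powr_divide)
  qed
  have Gi: "integrable lebesgue G"
    unfolding G_def using LpD(2)[OF f] LpD(2)[OF g]
    by (intro integrable_mult_right Bochner_Integration.integrable_add) auto
  have i: "integrable lebesgue (\<lambda>x. cmod (f x + g x) powr p)"
    by (rule Bochner_Integration.integrable_bound[OF Gi]) (auto intro!: order_trans[OF le])
  then show "(\<lambda>x. f x + g x) \<in> Lp p" by (simp add: Lp_def)
  have "(\<integral>x. cmod (f x + g x) powr p \<partial>lebesgue) \<le> (\<integral>x. G x \<partial>lebesgue)"
    by (rule integral_mono[OF i Gi le])
  also have "\<dots> = (\<alpha> + \<beta>) powr p * (t * ((\<integral>x. cmod (f x) powr p \<partial>lebesgue) / \<alpha> powr p)
      + (1 - t) * ((\<integral>x. cmod (g x) powr p \<partial>lebesgue) / \<beta> powr p))"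
    unfolding G_def using LpD(2)[OF f] LpD(2)[OF g] by simp
  also have "\<dots> \<le> (\<alpha> + \<beta>) powr p * (t * 1 + (1 - t) * 1)"
    using t a b p Lp_norm_le_iff[of p \<alpha> f] Lp_norm_le_iff[of p \<beta> g]
    by (intro mult_left_mono add_mono) auto
  finally show "Lp_norm p (\<lambda>x. f x + g x) \<le> \<alpha> + \<beta>"
    using p a b by (subst Lp_norm_le_iff) auto
qed

lemma Lp_add:
  assumes p: "1 \<le> p" and f: "f \<in> Lp p" and g: "g \<in> Lp p"
  shows "(\<lambda>x. f x + g x) \<in> Lp p" "Lp_norm p (\<lambda>x. f x + g x) \<le> Lp_norm p f + Lp_norm p g"
proof -
  have "Lp_norm p f \<le> Lp_norm p f + 1" "0 < Lp_norm p f + 1" "Lp_norm p g \<le> Lp_norm p g + 1" "0 < Lp_norm p g + 1"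
    using Lp_norm_nonneg[of p f] Lp_norm_nonneg[of p g] by linarith+
  from Lp_add_aux(1)[OF p f g this] show "(\<lambda>x. f x + g x) \<in> Lp p" .
  show "Lp_norm p (\<lambda>x. f x + g x) \<le> Lp_norm p f + Lp_norm p g"
  proof (rule field_le_epsilon)
    fix e :: real assume e: "0 < e"
    have "Lp_norm p f \<le> Lp_norm p f + e/2" "0 < Lp_norm p f + e/2"
      "Lp_norm p g \<le> Lp_norm p g + e/2" "0 < Lp_norm p g + e/2"
      using e Lp_norm_nonneg[of p f] Lp_norm_nonneg[of p g] by linarith+
    from Lp_add_aux(2)[OF p f g this]
    show "Lp_norm p (\<lambda>x. f x + g x) \<le> Lp_norm p f + Lp_norm p g + e" by simp
  qed
qed

lemma Lp_diff:
  assumes p: "1 \<le> p" and f: "f \<in> Lp p" and g: "g \<in> Lp p"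
  shows "(\<lambda>x. f x - g x) \<in> Lp p" "Lp_norm p (\<lambda>x. f x - g x) \<le> Lp_norm p f + Lp_norm p g"
  using Lp_add[OF p f Lp_scale(1)[of p g "-1"]] Lp_norm_scale[of p "-1" g] p g by auto

lemma Lp_norm_minus_commute: "Lp_norm p (\<lambda>x. f x - g x) = Lp_norm p (\<lambda>x. g x - f x)"
  by (simp add: Lp_norm_def norm_minus_commute)

lemma Lp_norm_diff_triangle:
  assumes p: "1 \<le> p" and f: "f \<in> Lp p" and g: "g \<in> Lp p" and h: "h \<in> Lp p"
  shows "Lp_norm p (\<lambda>x. f x - h x) \<le> Lp_norm p (\<lambda>x. f x - g x) + Lp_norm p (\<lambda>x. g x - h x)"
  using Lp_add(2)[OF p Lp_diff(1)[OF p f g] Lp_diff(1)[OF p g h]] by simp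

lemma Lp_norm_le_add_diff:
  assumes p: "1 \<le> p" and f: "f \<in> Lp p" and g: "g \<in> Lp p"
  shows "Lp_norm p f \<le> Lp_norm p g + Lp_norm p (\<lambda>x. f x - g x)"
  using Lp_add(2)[OF p g Lp_diff(1)[OF p f g]] by simp

lemma Lp_norm_tendsto:
  assumes p: "1 \<le> p" and f: "f \<in> Lp p" and u: "\<And>j. u j \<in> Lp p"
    and lim: "(\<lambda>j. Lp_norm p (\<lambda>x. u j x - f x)) \<longlonglongrightarrow> 0"
  shows "(\<lambda>j. Lp_norm p (u j)) \<longlonglongrightarrow> Lp_norm p f"
proof -
  have "\<bar>Lp_norm p (u j) - Lp_norm p f\<bar> \<le> Lp_norm p (\<lambda>x. u j x - f x)" for j
    using Lp_norm_le_add_diff[OF p u f, of j] Lp_norm_le_add_diff[OF p f u, of j]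
      Lp_norm_minus_commute[of p f "u j"] by linarith
  then have "(\<lambda>j. Lp_norm p (u j) - Lp_norm p f) \<longlonglongrightarrow> 0"
    by (intro Lim_null_comparison[OF _ lim]) auto
  then show ?thesis by (simp add: LIM_zero_iff)
qed

lemma Lp_norm_eq_0:
  assumes "0 < p" "f \<in> Lp p" "Lp_norm p f = 0"
  shows "AE x in lebesgue. f x = 0"
proof -
  have "(\<integral>x. cmod (f x) powr p \<partial>lebesgue) = 0"
    using Lp_norm_powr[OF assms(1), of f] assms(3,1) by simp
  then have "AE x in lebesgue. cmod (f x) powr p = 0"
    using integral_nonneg_eq_0_iff_AE[OF LpD(2)[OF assms(2)]] by simp
  then show ?thesis by eventually_elim simp
qed

lemma Lp_limit_unique:
  assumes p: "1 \<le> p" and f: "f \<in> Lp p" and g: "g \<in> Lp p" and u: "\<And>j. u j \<in> Lp p"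
    and 1: "(\<lambda>j. Lp_norm p (\<lambda>x. u j x - f x)) \<longlonglongrightarrow> 0"
    and 2: "(\<lambda>j. Lp_norm p (\<lambda>x. u j x - g x)) \<longlonglongrightarrow> 0"
  shows "AE x in lebesgue. f x = g x"
proof -
  have "Lp_norm p (\<lambda>x. f x - g x) \<le> 0"
  proof (rule tendsto_lowerbound)
    show "(\<lambda>j. Lp_norm p (\<lambda>x. u j x - f x) + Lp_norm p (\<lambda>x. u j x - g x)) \<longlonglongrightarrow> 0"
      using tendsto_add[OF 1 2] by simp
    show "\<forall>\<^sub>F j in sequentially. Lp_norm p (\<lambda>x. f x - g x)
        \<le> Lp_norm p (\<lambda>x. u j x - f x) + Lp_norm p (\<lambda>x. u j x - g x)"
      using Lp_norm_diff_triangle[OF p f u g] Lp_norm_minus_commute[of p f] by simp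
  qed simp
  then have "Lp_norm p (\<lambda>x. f x - g x) = 0" using Lp_norm_nonneg[of p "\<lambda>x. f x - g x"] by linarith
  from Lp_norm_eq_0[OF _ Lp_diff(1)[OF p f g] this] p
  show ?thesis by auto
qed

lemma Lp_dominated_convergence:
  fixes u :: "nat \<Rightarrow> real^'n \<Rightarrow> complex" and f :: "real^'n \<Rightarrow> complex"
  assumes p: "0 < p" and [measurable]: "f \<in> borel_measurable lebesgue"
    and [measurable]: "\<And>j. u j \<in> borel_measurable lebesgue"
    and g: "integrable lebesgue (\<lambda>x. g x powr p)"
    and lim: "AE x in lebesgue. (\<lambda>j. u j x) \<longlonglongrightarrow> f x"
    and bd: "\<And>j. AE x in lebesgue. cmod (u j x - f x) \<le> g x"
  shows "(\<lambda>j. Lp_norm p (\<lambda>x. u j x - f x)) \<longlonglongrightarrow> 0"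
proof -
  have "(\<lambda>j. \<integral>x. cmod (u j x - f x) powr p \<partial>lebesgue) \<longlonglongrightarrow> (\<integral>x. 0 \<partial>(lebesgue :: (real^'n) measure))"
  proof (rule integral_dominated_convergence[where w = "\<lambda>x. g x powr p"])
    show "AE x in lebesgue. (\<lambda>j. cmod (u j x - f x) powr p) \<longlonglongrightarrow> 0"
      using lim
    proof eventually_elim
      case (elim x)
      then have "(\<lambda>j. cmod (u j x - f x)) \<longlonglongrightarrow> 0" by (simp add: LIM_zero tendsto_norm_zero)
      then show ?case using tendsto_powr'[of "\<lambda>j. cmod (u j x - f x)" 0 sequentially "\<lambda>_. p" p] p by simp
    qed
    show "AE x in lebesgue. norm (cmod (u j x - f x) powr p) \<le> g x powr p" for j
      using bd[of j] by eventually_elim (use p in \<open>auto intro!: powr_mono2\<close>)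
  qed (use g in auto)
  then have "(\<lambda>j. \<integral>x. cmod (u j x - f x) powr p \<partial>lebesgue) \<longlonglongrightarrow> 0" by simp
  then have "(\<lambda>j. (\<integral>x. cmod (u j x - f x) powr p \<partial>lebesgue) powr (1/p)) \<longlonglongrightarrow> 0 powr (1/p)"
    using p by (intro tendsto_powr') auto
  then show ?thesis by (simp add: Lp_norm_def)
qed

lemma Lp_fatou:
  fixes u :: "nat \<Rightarrow> real^'n \<Rightarrow> complex" and f :: "real^'n \<Rightarrow> complex"
  assumes p: "0 < p" and C: "0 \<le> C" and u: "\<And>j. u j \<in> Lp p"
    and bd: "\<forall>\<^sub>F j in sequentially. Lp_norm p (u j) \<le> C"
    and f[measurable]: "f \<in> borel_measurable lebesgue"
    and lim: "AE x in lebesgue. (\<lambda>j. u j x) \<longlonglongrightarrow> f x"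
  shows "f \<in> Lp p" "Lp_norm p f \<le> C"
proof -
  note [measurable] = LpD(1)[OF u]
  have "(\<integral>\<^sup>+x. ennreal (cmod (f x) powr p) \<partial>lebesgue)
      = (\<integral>\<^sup>+x. liminf (\<lambda>j. ennreal (cmod (u j x) powr p)) \<partial>lebesgue)"
  proof (rule nn_integral_cong_AE)
    show "AE x in lebesgue. ennreal (cmod (f x) powr p) = liminf (\<lambda>j. ennreal (cmod (u j x) powr p))"
      using lim
    proof eventually_elim
      case (elim x)
      then have "(\<lambda>j. cmod (u j x) powr p) \<longlonglongrightarrow> cmod (f x) powr p"
        using p by (intro tendsto_powr' tendsto_norm) auto
      then have "(\<lambda>j. ennreal (cmod (u j x) powr p)) \<longlonglongrightarrow> ennreal (cmod (f x) powr p)"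
        by (rule tendsto_ennrealI)
      from lim_imp_Liminf[OF _ this] show ?case by simp
    qed
  qed
  also have "\<dots> \<le> liminf (\<lambda>j. \<integral>\<^sup>+x. ennreal (cmod (u j x) powr p) \<partial>lebesgue)"
    by (rule nn_integral_liminf) auto
  also have "\<dots> \<le> ennreal (C powr p)"
  proof (rule Liminf_le)
    show "\<forall>\<^sub>F j in sequentially. (\<integral>\<^sup>+x. ennreal (cmod (u j x) powr p) \<partial>lebesgue) \<le> ennreal (C powr p)"
      using bd
    proof eventually_elim
      case (elim j)
      then show ?case
        using nn_integral_eq_integral[OF LpD(2)[OF u[of j]]] Lp_norm_le_iff[OF p C, of "u j"]
        by (simp add: ennreal_leI)
    qed
  qed simp
  finally have le: "(\<integral>\<^sup>+x. ennreal (cmod (f x) powr p) \<partial>lebesgue) \<le> ennreal (C powr p)" .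
  then have i: "integrable lebesgue (\<lambda>x. cmod (f x) powr p)"
    by (intro integrableI_bounded) (auto simp: le_less_trans)
  then show "f \<in> Lp p" by (simp add: Lp_def)
  have "(\<integral>x. cmod (f x) powr p \<partial>lebesgue) \<le> C powr p"
    using le nn_integral_eq_integral[OF i] by simp
  then show "Lp_norm p f \<le> C" using Lp_norm_le_iff[OF p C, of f] by blast
qed

text \<open>Young's inequality at each point for the functions divided by positive upper bounds of their norms.\<close>

lemma Lp_Hoelder_aux:
  fixes f g :: "real^'n \<Rightarrow> complex"
  assumes p: "1 < p" "1 < q" "1/p + 1/q = 1" and f: "f \<in> Lp p" and g: "g \<in> Lp q"
    and a: "Lp_norm p f \<le> \<alpha>" "0 < \<alpha>" and b: "Lp_norm q g \<le> \<beta>" "0 < \<beta>"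
  shows "integrable lebesgue (\<lambda>x. f x * g x)" "(\<integral>x. cmod (f x * g x) \<partial>lebesgue) \<le> \<alpha> * \<beta>"
proof -
  note [measurable] = LpD(1)[OF f] LpD(1)[OF g]
  define G where "G x = \<alpha> * \<beta> * (cmod (f x) powr p / \<alpha> powr p / p + cmod (g x) powr q / \<beta> powr q / q)" for x
  have le: "cmod (f x * g x) \<le> G x" for x
    using Youngs_inequality[OF p, of "cmod (f x) / \<alpha>" "cmod (g x) / \<beta>"] a b
    by (simp add: G_def norm_mult powr_divide field_simps)
  have Gi: "integrable lebesgue G"
    unfolding G_def using LpD(2)[OF f] LpD(2)[OF g]
    by (intro integrable_mult_right Bochner_Integration.integrable_add) auto
  show i: "integrable lebesgue (\<lambda>x. f x * g x)"
    by (rule Bochner_Integration.integrable_bound[OF Gi]) (auto intro!: order_trans[OF le])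
  have "(\<integral>x. cmod (f x * g x) \<partial>lebesgue) \<le> (\<integral>x. G x \<partial>lebesgue)"
    by (intro integral_mono le Gi integrable_norm i)
  also have "\<dots> = \<alpha> * \<beta> * ((\<integral>x. cmod (f x) powr p \<partial>lebesgue) / \<alpha> powr p / p
      + (\<integral>x. cmod (g x) powr q \<partial>lebesgue) / \<beta> powr q / q)"
    unfolding G_def using LpD(2)[OF f] LpD(2)[OF g] by simp
  also have "\<dots> \<le> \<alpha> * \<beta> * (1 / p + 1 / q)"
    using a b p Lp_norm_le_iff[of p \<alpha> f] Lp_norm_le_iff[of q \<beta> g]
    by (intro mult_left_mono add_mono divide_right_mono) auto
  finally show "(\<integral>x. cmod (f x * g x) \<partial>lebesgue) \<le> \<alpha> * \<beta>" using p by simp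
qed

lemma Lp_Hoelder:
  fixes f g :: "real^'n \<Rightarrow> complex"
  assumes p: "1 < p" "1 < q" "1/p + 1/q = 1" and f: "f \<in> Lp p" and g: "g \<in> Lp q"
  shows "integrable lebesgue (\<lambda>x. f x * g x)"
    "(\<integral>x. cmod (f x * g x) \<partial>lebesgue) \<le> Lp_norm p f * Lp_norm q g"
    "cmod (\<integral>x. f x * g x \<partial>lebesgue) \<le> Lp_norm p f * Lp_norm q g"
proof -
  have "Lp_norm p f \<le> Lp_norm p f + e" "0 < Lp_norm p f + e" if "e > 0" for f and e p :: real
    using that Lp_norm_nonneg[of p f] by linarith+
  note pos = this
  show "integrable lebesgue (\<lambda>x. f x * g x)"
    using Lp_Hoelder_aux(1)[OF p f g pos(1)[of 1] pos(2)[of 1] pos(1)[of 1] pos(2)[of 1]] by simp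
  have lim: "(\<lambda>n. (Lp_norm p f + inverse (real (Suc n))) * (Lp_norm q g + inverse (real (Suc n))))
      \<longlonglongrightarrow> (Lp_norm p f + 0) * (Lp_norm q g + 0)"
    by (intro tendsto_intros LIMSEQ_inverse_real_of_nat)
  show *: "(\<integral>x. cmod (f x * g x) \<partial>lebesgue) \<le> Lp_norm p f * Lp_norm q g"
  proof (rule tendsto_lowerbound)
    show "(\<lambda>n. (Lp_norm p f + inverse (real (Suc n))) * (Lp_norm q g + inverse (real (Suc n))))
      \<longlonglongrightarrow> Lp_norm p f * Lp_norm q g" using lim by simp
    show "\<forall>\<^sub>F n in sequentially. (\<integral>x. cmod (f x * g x) \<partial>lebesgue)
      \<le> (Lp_norm p f + inverse (real (Suc n))) * (Lp_norm q g + inverse (real (Suc n)))"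
      by (intro always_eventually allI Lp_Hoelder_aux(2)[OF p f g] pos) auto
  qed simp
  show "cmod (\<integral>x. f x * g x \<partial>lebesgue) \<le> Lp_norm p f * Lp_norm q g"
    using order_trans[OF integral_norm_bound *] .
qed

section \<open>Schwartz functions\<close>

lemma partial_derivI:
  "(f has_derivative f') (at x) \<Longrightarrow> partial_deriv i f x = f' (axis i 1)"
  unfolding partial_deriv_def using frechet_derivative_at[of f f' x] by simp

lemma partial_deriv_add:
  assumes "\<And>x. f differentiable (at x)" "\<And>x. g differentiable (at x)"
  shows "partial_deriv i (\<lambda>x. f x + g x) = (\<lambda>x. partial_deriv i f x + partial_deriv i g x)"
proof
  fix x
  obtain f' g' where "(f has_derivative f') (at x)" "(g has_derivative g') (at x)"
    using assms unfolding differentiable_def by blast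
  from partial_derivI[OF has_derivative_add[OF this]] partial_derivI[OF this(1)] partial_derivI[OF this(2)]
  show "partial_deriv i (\<lambda>x. f x + g x) x = partial_deriv i f x + partial_deriv i g x"
    by simp
qed

lemma partial_deriv_mult:
  assumes "\<And>x. f differentiable (at x)" "\<And>x. g differentiable (at x)"
  shows "partial_deriv i (\<lambda>x. f x * g x) = (\<lambda>x. f x * partial_deriv i g x + partial_deriv i f x * g x)"
proof
  fix x
  obtain f' g' where "(f has_derivative f') (at x)" "(g has_derivative g') (at x)"
    using assms unfolding differentiable_def by blast
  from partial_derivI[OF has_derivative_mult[OF this]] partial_derivI[OF this(1)] partial_derivI[OF this(2)]
  show "partial_deriv i (\<lambda>x. f x * g x) x = f x * partial_deriv i g x + partial_deriv i f x * g x"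
    by simp
qed

lemma partial_deriv_const: "partial_deriv i (\<lambda>x. c) = (\<lambda>x. 0)"
  by (rule ext, rule partial_derivI[OF has_derivative_const])

lemma partial_deriv_cmult:
  assumes "\<And>x. f differentiable (at x)"
  shows "partial_deriv i (\<lambda>x. c * f x) = (\<lambda>x. c * partial_deriv i f x)"
  using partial_deriv_mult[of "\<lambda>x. c" f i] assms by (simp add: partial_deriv_const)

lemma smooth_differentiable: "smooth f \<Longrightarrow> iter_deriv is f differentiable (at x)"
  by (simp add: smooth_def)

lemma iter_deriv_add:
  assumes "smooth f" "smooth g"
  shows "iter_deriv is (\<lambda>x. f x + g x) = (\<lambda>x. iter_deriv is f x + iter_deriv is g x)"
  by (induction "is") (simp_all add: partial_deriv_add smooth_differentiable assms)

lemma iter_deriv_cmult: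
  assumes "smooth f"
  shows "iter_deriv is (\<lambda>x. c * f x) = (\<lambda>x. c * iter_deriv is f x)"
  by (induction "is") (simp_all add: partial_deriv_cmult smooth_differentiable assms)

text \<open>Each differentiation of \<open>x \<mapsto> f (a + s x)\<close> contributes one factor \<open>s\<close>. The cases \<open>s = -1\<close> and
  \<open>s = 1\<close> are the reflections that occur in a convolution and the translations.\<close>

lemma iter_deriv_affine:
  assumes "smooth f"
  shows "iter_deriv is (\<lambda>x. f (a + s *\<^sub>R x)) = (\<lambda>x. of_real (s ^ length is) * iter_deriv is f (a + s *\<^sub>R x))"
proof (induction "is")
  case (Cons i "is")
  have diff: "((\<lambda>x. of_real (s ^ length is) * iter_deriv is f (a + s *\<^sub>R x)) has_derivative
       (\<lambda>h. of_real (s ^ length is) * frechet_derivative (iter_deriv is f) (at (a + s *\<^sub>R x)) (s *\<^sub>R h))) (at x)" for x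
  proof -
    have 1: "(iter_deriv is f has_derivative frechet_derivative (iter_deriv is f) (at (a + s *\<^sub>R x))) (at (a + s *\<^sub>R x))"
      using smooth_differentiable[OF assms] frechet_derivative_works by blast
    have 2: "((\<lambda>x. a + s *\<^sub>R x) has_derivative (\<lambda>h. s *\<^sub>R h)) (at x)"
      by (auto intro!: derivative_eq_intros)
    have "((\<lambda>x. iter_deriv is f (a + s *\<^sub>R x)) has_derivative
       (\<lambda>h. frechet_derivative (iter_deriv is f) (at (a + s *\<^sub>R x)) (s *\<^sub>R h))) (at x)"
      by (rule has_derivative_compose[OF 2 1])
    then show ?thesis by (rule has_derivative_mult_right)
  qed
  have lin: "frechet_derivative (iter_deriv is f) (at y) (s *\<^sub>R h) = s *\<^sub>R frechet_derivative (iter_deriv is f) (at y) h" for y h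
    using smooth_differentiable[OF assms, of "is" y]
    by (simp add: linear_frechet_derivative linear_cmul)
  show ?case
  proof
    fix x
    have "iter_deriv (i # is) (\<lambda>x. f (a + s *\<^sub>R x)) x
        = of_real (s ^ length is) * (s *\<^sub>R frechet_derivative (iter_deriv is f) (at (a + s *\<^sub>R x)) (axis i 1))"
      by (simp only: iter_deriv.simps Cons partial_derivI[OF diff] lin)
    then show "iter_deriv (i # is) (\<lambda>x. f (a + s *\<^sub>R x)) x
        = of_real (s ^ length (i # is)) * iter_deriv (i # is) f (a + s *\<^sub>R x)"
      by (simp add: partial_deriv_def scaleR_conv_of_real)
  qed
qed simp

lemma smooth_add: "smooth f \<Longrightarrow> smooth g \<Longrightarrow> smooth (\<lambda>x. f x + g x)"
  by (subst smooth_def) (simp add: iter_deriv_add smooth_differentiable)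

lemma smooth_cmult: "smooth f \<Longrightarrow> smooth (\<lambda>x. c * f x)"
  by (subst smooth_def) (simp add: iter_deriv_cmult smooth_differentiable)

lemma smooth_affine:
  assumes "smooth f" shows "smooth (\<lambda>x. f (a + s *\<^sub>R x))"
  unfolding smooth_def iter_deriv_affine[OF assms]
proof (intro allI differentiable_mult differentiable_const)
  fix "is" x
  show "(\<lambda>x. iter_deriv is f (a + s *\<^sub>R x)) differentiable at x"
    using differentiable_chain_at[of "\<lambda>x. a + s *\<^sub>R x" x "iter_deriv is f"] smooth_differentiable[OF assms]
    by (simp add: o_def)
qed

lemma schwartzI:
  assumes "smooth f" "\<And>m is. \<exists>C. \<forall>x. schwartz_weight m is f x \<le> C"
  shows "f \<in> schwartz"
  using assms unfolding schwartz_def bdd_above_def by fastforce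

lemma schwartzD:
  assumes "f \<in> schwartz"
  shows "smooth f" "\<exists>C. \<forall>x. schwartz_weight m is f x \<le> C"
  using assms unfolding schwartz_def bdd_above_def by fastforce+

lemma schwartz_add:
  assumes "f \<in> schwartz" "g \<in> schwartz"
  shows "(\<lambda>x. f x + g x) \<in> schwartz"
proof (rule schwartzI)
  note s = schwartzD(1)[OF assms(1)] schwartzD(1)[OF assms(2)]
  show "smooth (\<lambda>x. f x + g x)" using s by (rule smooth_add)
  fix m "is"
  obtain C D where C: "\<forall>x. schwartz_weight m is f x \<le> C" and D: "\<forall>x. schwartz_weight m is g x \<le> D"
    using schwartzD(2)[OF assms(1), of m "is"] schwartzD(2)[OF assms(2), of m "is"] by blast
  have "schwartz_weight m is (\<lambda>x. f x + g x) x \<le> C + D" for x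
  proof -
    have "schwartz_weight m is (\<lambda>x. f x + g x) x \<le> schwartz_weight m is f x + schwartz_weight m is g x"
      unfolding schwartz_weight_def iter_deriv_add[OF s] distrib_left[symmetric]
      by (intro mult_left_mono norm_triangle_ineq) auto
    then show ?thesis using C D by (smt (verit))
  qed
  then show "\<exists>C. \<forall>x. schwartz_weight m is (\<lambda>x. f x + g x) x \<le> C" by blast
qed

lemma schwartz_cmult:
  assumes "f \<in> schwartz"
  shows "(\<lambda>x. c * f x) \<in> schwartz"
proof (rule schwartzI)
  note s = schwartzD(1)[OF assms(1)]
  show "smooth (\<lambda>x. c * f x)" using s by (rule smooth_cmult)
  fix m "is"
  obtain C where C: "\<forall>x. schwartz_weight m is f x \<le> C"
    using schwartzD(2)[OF assms(1), of m "is"] by blast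
  have "schwartz_weight m is (\<lambda>x. c * f x) x = cmod c * schwartz_weight m is f x" for x
    unfolding schwartz_weight_def iter_deriv_cmult[OF s] by (simp add: norm_mult)
  then have "schwartz_weight m is (\<lambda>x. c * f x) x \<le> cmod c * C" for x
    using C by (simp add: mult_left_mono)
  then show "\<exists>C. \<forall>x. schwartz_weight m is (\<lambda>x. c * f x) x \<le> C" by blast
qed

lemma schwartz_diff:
  assumes "f \<in> schwartz" "g \<in> schwartz"
  shows "(\<lambda>x. f x - g x) \<in> schwartz"
  using schwartz_add[OF assms(1) schwartz_cmult[OF assms(2), of "-1"]] by simp

lemma schwartz_affine:
  assumes "f \<in> schwartz" and s: "\<bar>s\<bar> = 1"
  shows "(\<lambda>x. f (a + s *\<^sub>R x)) \<in> schwartz"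
proof (rule schwartzI)
  note f = schwartzD(1)[OF assms(1)]
  show "smooth (\<lambda>x. f (a + s *\<^sub>R x))" using f by (rule smooth_affine)
  fix m "is"
  obtain C where C: "\<forall>x. schwartz_weight m is f x \<le> C"
    using schwartzD(2)[OF assms(1), of m "is"] by blast
  have "schwartz_weight m is (\<lambda>x. f (a + s *\<^sub>R x)) x \<le> (1 + norm a) ^ m * C" for x
  proof -
    have "norm x = norm ((a + s *\<^sub>R x) - a)" using s by simp
    also have "\<dots> \<le> norm (a + s *\<^sub>R x) + norm a" by (rule norm_triangle_ineq4)
    finally have "1 + norm x \<le> (1 + norm a) * (1 + norm (a + s *\<^sub>R x))"
      using mult_nonneg_nonneg[OF norm_ge_zero[of a] norm_ge_zero[of "a + s *\<^sub>R x"]]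
      unfolding distrib_left distrib_right by linarith
    then have "(1 + norm x) ^ m \<le> (1 + norm a) ^ m * (1 + norm (a + s *\<^sub>R x)) ^ m"
      unfolding power_mult_distrib[symmetric] by (intro power_mono) auto
    then have "schwartz_weight m is (\<lambda>x. f (a + s *\<^sub>R x)) x \<le> (1 + norm a) ^ m * schwartz_weight m is f (a + s *\<^sub>R x)"
      unfolding schwartz_weight_def iter_deriv_affine[OF f] using s
      by (auto simp: norm_mult norm_power mult.assoc[symmetric] intro!: mult_right_mono)
    also have "\<dots> \<le> (1 + norm a) ^ m * C" using C by (intro mult_left_mono) auto
    finally show ?thesis .
  qed
  then show "\<exists>C. \<forall>x. schwartz_weight m is (\<lambda>x. f (a + s *\<^sub>R x)) x \<le> C" by blast
qed

lemma schwartz_reflect: "f \<in> schwartz \<Longrightarrow> (\<lambda>y. f (x - y)) \<in> schwartz"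
  using schwartz_affine[of f "-1" x] by simp

lemma schwartz_translate: "f \<in> schwartz \<Longrightarrow> (\<lambda>y. f (y - x)) \<in> schwartz"
  using schwartz_affine[of f "1" "-x"] by simp

section \<open>Exponentials of polynomials\<close>

text \<open>Complex polynomial functions of the coordinates. The inductive form suits the only facts needed
  about them: closure under differentiation and polynomial growth.\<close>

inductive_set cpoly :: "(real^'n::finite \<Rightarrow> complex) set" where
  const: "(\<lambda>x. c) \<in> cpoly"
| coord: "(\<lambda>x. of_real (x $ i)) \<in> cpoly"
| add: "f \<in> cpoly \<Longrightarrow> g \<in> cpoly \<Longrightarrow> (\<lambda>x. f x + g x) \<in> cpoly"
| mult: "f \<in> cpoly \<Longrightarrow> g \<in> cpoly \<Longrightarrow> (\<lambda>x. f x * g x) \<in> cpoly"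

lemma cpoly_diff: "f \<in> cpoly \<Longrightarrow> g \<in> cpoly \<Longrightarrow> (\<lambda>x. f x - g x) \<in> cpoly"
  using cpoly.add[of f "\<lambda>x. -1 * g x"] cpoly.mult[OF cpoly.const[of "-1"], of g] by simp

lemma cpoly_power: "f \<in> cpoly \<Longrightarrow> (\<lambda>x. f x ^ m) \<in> cpoly"
  by (induction m) (auto intro: cpoly.const cpoly.mult)

lemma cpoly_sum: "(\<And>i. i \<in> I \<Longrightarrow> f i \<in> cpoly) \<Longrightarrow> (\<lambda>x. \<Sum>i\<in>I. f i x) \<in> cpoly"
  by (induction I rule: infinite_finite_induct) (auto intro: cpoly.const cpoly.add)

lemma cpoly_differentiable: "f \<in> cpoly \<Longrightarrow> f differentiable (at x)"
proof (induction rule: cpoly.induct)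
  case (coord i)
  have "bounded_linear (\<lambda>x::real^'a. complex_of_real (x $ i))"
    by (intro bounded_linear_compose[OF bounded_linear_of_real] bounded_linear_vec_nth)
  then show ?case by (rule bounded_linear_imp_differentiable)
qed (auto intro: differentiable_add differentiable_mult)

lemma cpoly_partial_deriv: "f \<in> cpoly \<Longrightarrow> partial_deriv j f \<in> cpoly"
proof (induction rule: cpoly.induct)
  case (const c) then show ?case by (simp add: partial_deriv_const cpoly.const)
next
  case (coord i)
  have "bounded_linear (\<lambda>x::real^'a. complex_of_real (x $ i))"
    by (intro bounded_linear_compose[OF bounded_linear_of_real] bounded_linear_vec_nth)
  from partial_derivI[OF bounded_linear_imp_has_derivative[OF this]]
  have "partial_deriv j (\<lambda>x::real^'a. complex_of_real (x $ i)) = (\<lambda>x. of_real (axis j 1 $ i))" by auto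
  then show ?case by (simp add: cpoly.const)
next
  case (add f g) then show ?case by (simp add: partial_deriv_add cpoly_differentiable cpoly.add)
next
  case (mult f g) then show ?case
    by (simp add: partial_deriv_mult cpoly_differentiable cpoly.add cpoly.mult)
qed

lemma cpoly_bound: "f \<in> cpoly \<Longrightarrow> \<exists>C m. 0 \<le> C \<and> (\<forall>x. cmod (f x) \<le> C * (1 + norm x) ^ m)"
proof (induction rule: cpoly.induct)
  case (const c) show ?case by (rule exI[of _ "cmod c"], rule exI[of _ 0]) auto
next
  case (coord i) show ?case
    by (rule exI[of _ 1], rule exI[of _ 1]) (auto intro: order_trans[OF component_le_norm_cart])
next
  case (add f g)
  then obtain C m D l where C: "0 \<le> C" "\<And>x. cmod (f x) \<le> C * (1 + norm x) ^ m"
    and D: "0 \<le> D" "\<And>x. cmod (g x) \<le> D * (1 + norm x) ^ l" by blast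
  have "cmod (f x + g x) \<le> (C + D) * (1 + norm x) ^ (m + l)" for x
  proof -
    have "cmod (f x + g x) \<le> C * (1 + norm x) ^ m + D * (1 + norm x) ^ l"
      using norm_triangle_ineq[of "f x" "g x"] C(2)[of x] D(2)[of x] by linarith
    also have "\<dots> \<le> C * (1 + norm x) ^ (m + l) + D * (1 + norm x) ^ (m + l)"
      using C D by (intro add_mono mult_left_mono power_increasing) auto
    finally show ?thesis by (simp add: distrib_right)
  qed
  with C D show ?case by (intro exI[of _ "C + D"] exI[of _ "m + l"]) auto
next
  case (mult f g)
  then obtain C m D l where C: "0 \<le> C" "\<And>x. cmod (f x) \<le> C * (1 + norm x) ^ m"
    and D: "0 \<le> D" "\<And>x. cmod (g x) \<le> D * (1 + norm x) ^ l" by blast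
  have "cmod (f x * g x) \<le> (C * D) * (1 + norm x) ^ (m + l)" for x
    using mult_mono[OF C(2)[of x] D(2)[of x]] C D by (simp add: norm_mult power_add mult_ac)
  with C D show ?case by (intro exI[of _ "C * D"] exI[of _ "m + l"]) auto
qed

lemma power_le_exp:
  fixes z :: real assumes "0 \<le> z" shows "z ^ m \<le> fact m * exp z"
proof -
  have "(\<Sum>n\<in>{m}. z ^ n /\<^sub>R fact n) \<le> (\<Sum>n. z ^ n /\<^sub>R fact n)"
    using assms by (intro sum_le_suminf summable_exp_generic) auto
  then show ?thesis by (simp add: exp_def field_simps)
qed

text \<open>Derivatives of a polynomial times \<open>exp (- P)\<close> have the same form. Such a function is bounded
  together with all its polynomial multiples, since the real part of \<open>P\<close> grows at least linearly.\<close>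

lemma schwartz_exp_cpoly:
  assumes P: "P \<in> cpoly" and a: "0 < a" and low: "\<And>x. a * norm x - b \<le> Re (P x)"
  shows "(\<lambda>x::real^'n::finite. exp (- P x)) \<in> schwartz"
proof (rule schwartzI)
  let ?E = "\<lambda>x. exp (- P x)"
  have dE: "?E differentiable (at x)" "partial_deriv i ?E x = - partial_deriv i P x * ?E x" for x i
  proof -
    obtain P' where P': "(P has_derivative P') (at x)"
      using cpoly_differentiable[OF P] unfolding differentiable_def by blast
    have d: "(?E has_derivative (\<lambda>h. exp (- P x) * (- P' h))) (at x)"
      using has_derivative_compose[OF has_derivative_minus[OF P']
          DERIV_exp[unfolded has_field_derivative_def]] by simp
    then show "?E differentiable (at x)" by (auto simp: differentiable_def)
    show "partial_deriv i ?E x = - partial_deriv i P x * ?E x"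
      by (simp add: partial_derivI[OF d] partial_derivI[OF P'])
  qed
  \<comment> \<open>every iterated derivative is again a polynomial multiple of the exponential\<close>
  have it: "\<exists>q\<in>cpoly. iter_deriv is ?E = (\<lambda>x. q x * ?E x)" for "is"
  proof (induction "is")
    case Nil show ?case by (intro bexI[of _ "\<lambda>x. 1"]) (auto intro: cpoly.const)
  next
    case (Cons i "is")
    then obtain q where q: "q \<in> cpoly" "iter_deriv is ?E = (\<lambda>x. q x * ?E x)" by blast
    have "partial_deriv i (\<lambda>x. q x * ?E x) = (\<lambda>x. (partial_deriv i q x - q x * partial_deriv i P x) * ?E x)"
      using partial_deriv_mult[of q ?E i, OF cpoly_differentiable[OF q(1)] dE(1)]
      by (simp add: dE(2) algebra_simps)
    then show ?case using q P
      by (intro bexI[of _ "\<lambda>x. partial_deriv i q x - q x * partial_deriv i P x"])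
        (auto intro!: cpoly_diff cpoly.mult cpoly_partial_deriv)
  qed
  show "smooth ?E" unfolding smooth_def
  proof (intro allI)
    fix "is" x
    obtain q where "q \<in> cpoly" "iter_deriv is ?E = (\<lambda>x. q x * ?E x)" using it by blast
    then show "iter_deriv is ?E differentiable at x"
      using dE(1) by (simp add: cpoly_differentiable differentiable_mult)
  qed
  fix m "is"
  obtain q where q: "q \<in> cpoly" "iter_deriv is ?E = (\<lambda>x. q x * ?E x)" using it by blast
  obtain C l where C: "0 \<le> C" "\<And>x. cmod (q x) \<le> C * (1 + norm x) ^ l" using cpoly_bound[OF q(1)] by blast
  have "schwartz_weight m is ?E x \<le> C * (fact (m + l) / a ^ (m + l) * exp (a + b))" for x
  proof -
    have "(a * (1 + norm x)) ^ (m + l) \<le> fact (m + l) * exp (a * (1 + norm x))"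
      using a by (intro power_le_exp) auto
    then have pw: "(1 + norm x) ^ (m + l) \<le> fact (m + l) / a ^ (m + l) * exp (a * (1 + norm x))"
    proof -
      have "(1 + norm x) ^ (m + l) \<le> (fact (m + l) * exp (a * (1 + norm x))) / a ^ (m + l)"
        using a \<open>(a * (1 + norm x)) ^ (m + l) \<le> _\<close> unfolding power_mult_distrib
        by (subst pos_le_divide_eq) (simp_all only: zero_less_power mult.commute)
      then show ?thesis by simp
    qed
    have "schwartz_weight m is ?E x = (1 + norm x) ^ m * (cmod (q x) * exp (- Re (P x)))"
      by (simp add: schwartz_weight_def q(2) norm_mult)
    also have "\<dots> \<le> (1 + norm x) ^ m * ((C * (1 + norm x) ^ l) * exp (b - a * norm x))"
      using C low[of x] by (intro mult_left_mono mult_mono) auto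
    also have "\<dots> = C * ((1 + norm x) ^ (m + l) * exp (b - a * norm x))" by (simp add: power_add)
    also have "\<dots> \<le> C * ((fact (m + l) / a ^ (m + l) * exp (a * (1 + norm x))) * exp (b - a * norm x))"
      using C pw by (intro mult_left_mono mult_right_mono) auto
    also have "\<dots> = C * (fact (m + l) / a ^ (m + l) * exp (a + b))"
      by (simp add: exp_add[symmetric] distrib_left algebra_simps)
    finally show ?thesis .
  qed
  then show "\<exists>C. \<forall>x. schwartz_weight m is ?E x \<le> C" by blast
qed

section \<open>Integrability of exponentials\<close>

lemma integrable_exp_abs:
  assumes "0 < a" shows "integrable lborel (\<lambda>t::real. exp (- a * \<bar>t\<bar>))"
proof (rule Bochner_Integration.integrable_bound)
  show "integrable lborel (\<lambda>t::real. (1 + 2 / a\<^sup>2) * inverse (1 + t\<^sup>2))"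
    using integrable_inverse_1_plus_square by (simp add: set_integrable_def)
  show "AE t in lborel. norm (exp (- a * \<bar>t\<bar>)) \<le> norm ((1 + 2 / a\<^sup>2) * inverse (1 + t\<^sup>2))"
  proof (intro always_eventually allI)
    fix t :: real
    have pos: "0 < 1 + t\<^sup>2" by (simp add: add_pos_nonneg)
    have "1 + (a * \<bar>t\<bar>) + (a * \<bar>t\<bar>)\<^sup>2 / 2 \<le> exp (a * \<bar>t\<bar>)"
      using assms by (intro exp_lower_Taylor_quadratic) auto
    then have e: "1 + (a * \<bar>t\<bar>)\<^sup>2 / 2 \<le> exp (a * \<bar>t\<bar>)" using assms by (smt (verit) mult_nonneg_nonneg abs_ge_zero)
    have "1 + t\<^sup>2 \<le> (1 + 2 / a\<^sup>2) * (1 + (a * \<bar>t\<bar>)\<^sup>2 / 2)"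
      using assms by (simp add: field_simps power_mult_distrib)
    also have "\<dots> \<le> (1 + 2 / a\<^sup>2) * exp (a * \<bar>t\<bar>)" using e by (intro mult_left_mono) auto
    finally have "exp (- a * \<bar>t\<bar>) * (1 + t\<^sup>2) \<le> exp (- a * \<bar>t\<bar>) * ((1 + 2 / a\<^sup>2) * exp (a * \<bar>t\<bar>))"
      by (intro mult_left_mono) auto
    also have "\<dots> = 1 + 2 / a\<^sup>2" by (simp add: exp_minus field_simps)
    finally show "norm (exp (- a * \<bar>t\<bar>)) \<le> norm ((1 + 2 / a\<^sup>2) * inverse (1 + t\<^sup>2))"
      using pos by (simp add: field_simps abs_mult)
  qed
qed auto

text \<open>The norm is at least the average of the absolute values of the coordinates, which bounds the function
  by a product of integrable functions of one coordinate each.\<close>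

lemma integrable_exp_norm:
  assumes a: "0 < a" shows "integrable lebesgue (\<lambda>x::'a::euclidean_space. exp (- a * norm x))"
proof -
  interpret product_sigma_finite "\<lambda>b::'a. lborel :: real measure" ..
  define c where "c = a / real DIM('a)"
  have c: "0 < c" using a by (simp add: c_def)
  have "(\<integral>\<^sup>+x. ennreal (exp (- a * norm (x::'a))) \<partial>lborel)
      \<le> (\<integral>\<^sup>+x. (\<Prod>b\<in>Basis. ennreal (exp (- c * \<bar>(x::'a) \<bullet> b\<bar>))) \<partial>lborel)"
  proof (rule nn_integral_mono)
    fix x :: 'a
    have "(\<Sum>b\<in>Basis. \<bar>x \<bullet> b\<bar>) \<le> (\<Sum>b\<in>(Basis::'a set). norm x)" by (intro sum_mono Basis_le_norm)
    then have "c * (\<Sum>b\<in>Basis. \<bar>x \<bullet> b\<bar>) \<le> a * norm x"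
      using a by (simp add: c_def field_simps)
    then have "exp (- a * norm x) \<le> exp (\<Sum>b\<in>Basis. - c * \<bar>x \<bullet> b\<bar>)"
      by (simp add: sum_distrib_left sum_negf)
    also have "\<dots> = (\<Prod>b\<in>Basis. exp (- c * \<bar>x \<bullet> b\<bar>))" by (simp add: exp_sum)
    finally show "ennreal (exp (- a * norm x)) \<le> (\<Prod>b\<in>Basis. ennreal (exp (- c * \<bar>x \<bullet> b\<bar>)))"
      by (simp add: prod_ennreal ennreal_leI)
  qed
  also have "\<dots> = (\<integral>\<^sup>+f. (\<Prod>b\<in>Basis. ennreal (exp (- c * \<bar>(\<Sum>b\<in>Basis. f b *\<^sub>R b) \<bullet> (b::'a)\<bar>)))
       \<partial>(\<Pi>\<^sub>M b\<in>Basis. lborel))"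
    by (subst lborel_eq) (simp add: nn_integral_distr)
  also have "\<dots> = (\<integral>\<^sup>+f. (\<Prod>b\<in>Basis. ennreal (exp (- c * \<bar>f (b::'a)\<bar>))) \<partial>(\<Pi>\<^sub>M b\<in>Basis. lborel))"
    by (intro nn_integral_cong prod.cong) (auto simp: inner_sum_left_Basis)
  also have "\<dots> = (\<Prod>b\<in>(Basis::'a set). \<integral>\<^sup>+t. ennreal (exp (- c * \<bar>t\<bar>)) \<partial>lborel)"
    by (subst product_nn_integral_prod) auto
  also have "\<dots> < \<infinity>"
    using integrable_exp_abs[OF c] by (simp add: integrable_iff_bounded power_less_top_ennreal)
  finally have "integrable lborel (\<lambda>x::'a. exp (- a * norm x))"
    by (intro integrableI_bounded) auto
  then show ?thesis by (simp add: integrable_completion)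
qed

section \<open>Density of Schwartz functions in Lebesgue spaces\<close>

definition schwartz_closure :: "real \<Rightarrow> (real^'n::finite \<Rightarrow> complex) set" where
  "schwartz_closure p = {f \<in> Lp p. \<forall>e>0. \<exists>g \<in> schwartz \<inter> Lp p. Lp_norm p (\<lambda>x. g x - f x) < e}"

lemma schwartz_closure_add:
  assumes p: "1 \<le> p" and f: "f \<in> schwartz_closure p" and g: "g \<in> schwartz_closure p"
  shows "(\<lambda>x. f x + g x) \<in> schwartz_closure p"
  unfolding schwartz_closure_def
proof (intro CollectI conjI allI impI)
  have fL: "f \<in> Lp p" and gL: "g \<in> Lp p" using f g by (auto simp: schwartz_closure_def)
  show "(\<lambda>x. f x + g x) \<in> Lp p" using Lp_add(1)[OF p fL gL] .
  fix e :: real assume "0 < e"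
  then have "0 < e / 2" by simp
  then obtain u v where u: "u \<in> schwartz" "u \<in> Lp p" "Lp_norm p (\<lambda>x. u x - f x) < e / 2"
    and v: "v \<in> schwartz" "v \<in> Lp p" "Lp_norm p (\<lambda>x. v x - g x) < e / 2"
    using f g unfolding schwartz_closure_def by blast
  have "Lp_norm p (\<lambda>x. (u x + v x) - (f x + g x)) \<le> Lp_norm p (\<lambda>x. u x - f x) + Lp_norm p (\<lambda>x. v x - g x)"
    using Lp_add(2)[OF p Lp_diff(1)[OF p u(2) fL] Lp_diff(1)[OF p v(2) gL]]
    by (simp add: algebra_simps)
  then show "\<exists>w\<in>schwartz \<inter> Lp p. Lp_norm p (\<lambda>x. w x - (f x + g x)) < e"
    using u v Lp_add(1)[OF p u(2) v(2)]
    by (intro bexI[of _ "\<lambda>x. u x + v x"]) (auto intro: schwartz_add)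
qed

lemma schwartz_closure_cmult:
  assumes p: "1 \<le> p" and f: "f \<in> schwartz_closure p"
  shows "(\<lambda>x. c * f x) \<in> schwartz_closure p"
  unfolding schwartz_closure_def
proof (intro CollectI conjI allI impI)
  have fL: "f \<in> Lp p" using f by (auto simp: schwartz_closure_def)
  show "(\<lambda>x. c * f x) \<in> Lp p" using Lp_scale(1)[OF _ fL] p by simp
  fix e :: real assume e: "0 < e"
  then have "0 < e / (cmod c + 1)" by (simp add: add_nonneg_pos)
  then obtain u where u: "u \<in> schwartz" "u \<in> Lp p" "Lp_norm p (\<lambda>x. u x - f x) < e / (cmod c + 1)"
    using f unfolding schwartz_closure_def by blast
  have "Lp_norm p (\<lambda>x. c * u x - c * f x) = cmod c * Lp_norm p (\<lambda>x. u x - f x)"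
    using Lp_norm_scale[of p c "\<lambda>x. u x - f x"] p by (simp add: right_diff_distrib)
  also have "\<dots> \<le> (cmod c + 1) * Lp_norm p (\<lambda>x. u x - f x)" by (intro mult_right_mono) auto
  also have "\<dots> < e" using u(3) by (simp add: pos_less_divide_eq add_nonneg_pos mult.commute)
  finally show "\<exists>w\<in>schwartz \<inter> Lp p. Lp_norm p (\<lambda>x. w x - c * f x) < e"
    using u Lp_scale(1)[of p u c] p
    by (intro bexI[of _ "\<lambda>x. c * u x"]) (auto intro: schwartz_cmult)
qed

text \<open>The empty sum needs a Schwartz function that vanishes identically; a zero multiple of a Gaussian
  function serves.\<close>

lemma schwartz_closure_sum:
  fixes f :: "'i \<Rightarrow> real^'a::finite \<Rightarrow> complex"
  assumes p: "1 \<le> p" and "\<And>i. i \<in> I \<Longrightarrow> f i \<in> schwartz_closure p"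
  shows "(\<lambda>x. \<Sum>i\<in>I. f i x) \<in> schwartz_closure p"
proof -
  have zero: "(\<lambda>x::real^'a. 0) \<in> schwartz_closure p"
  proof -
    have "(\<lambda>x::real^'a. 0 * exp (- (complex_of_real ((norm x)\<^sup>2)))) \<in> schwartz"
    proof (intro schwartz_cmult schwartz_exp_cpoly[where a = 1 and b = 1])
      have "(\<lambda>x::real^'a. of_real ((norm x)\<^sup>2)) = (\<lambda>x. \<Sum>i\<in>UNIV. complex_of_real (x $ i) ^ 2)"
        by (auto simp: norm_vec_def L2_set_def sum_nonneg)
      then show "(\<lambda>x::real^'a. of_real ((norm x)\<^sup>2)) \<in> cpoly"
        by (simp only:) (intro cpoly_sum cpoly_power cpoly.coord)
      show "1 * norm x - 1 \<le> Re (complex_of_real ((norm x)\<^sup>2))" for x :: "real^'a"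
      proof -
        have "0 \<le> (norm x - 1)\<^sup>2 + norm x" by simp
        then show ?thesis by (simp add: power2_eq_square algebra_simps)
      qed
    qed simp
    then show ?thesis by (auto simp: schwartz_closure_def intro!: bexI[of _ "\<lambda>x. 0"])
  qed
  from assms(2) show ?thesis
    by (induction I rule: infinite_finite_induct) (auto simp: zero intro: schwartz_closure_add[OF p])
qed

lemma schwartz_closure_limit:
  assumes p: "1 \<le> p" and f: "f \<in> Lp p" and u: "\<And>j. u j \<in> schwartz_closure p"
    and lim: "(\<lambda>j. Lp_norm p (\<lambda>x. u j x - f x)) \<longlonglongrightarrow> 0"
  shows "f \<in> schwartz_closure p"
  unfolding schwartz_closure_def
proof (intro CollectI conjI allI impI f)
  fix e :: real assume e: "0 < e"
  then have "\<forall>\<^sub>F j in sequentially. Lp_norm p (\<lambda>x. u j x - f x) < e / 2"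
    using lim by (intro order_tendstoD(2)) auto
  then obtain j where j: "Lp_norm p (\<lambda>x. u j x - f x) < e / 2"
    by (auto simp: eventually_sequentially)
  have uL: "u j \<in> Lp p" using u by (auto simp: schwartz_closure_def)
  from e have "0 < e / 2" by simp
  then obtain g where g: "g \<in> schwartz" "g \<in> Lp p" "Lp_norm p (\<lambda>x. g x - u j x) < e / 2"
    using u[of j] unfolding schwartz_closure_def by blast
  have "Lp_norm p (\<lambda>x. g x - f x) < e"
    using Lp_norm_diff_triangle[OF p g(2) uL f] j g(3) by simp
  then show "\<exists>w\<in>schwartz \<inter> Lp p. Lp_norm p (\<lambda>x. w x - f x) < e" using g by blast
qed

lemma Lp_indicator_lmeasurable:
  fixes A :: "(real^'n::finite) set"
  assumes "A \<in> lmeasurable"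
  shows "(\<lambda>x. indicator A x) \<in> Lp p" "Lp_norm p (\<lambda>x. indicator A x) = measure lebesgue A powr (1 / p)"
proof -
  have [measurable]: "A \<in> sets lebesgue" using assms by (simp add: fmeasurable_def)
  have eq: "(\<lambda>x. cmod (indicator A x) powr p) = indicat_real A"
    by (auto simp: indicator_def)
  have "integrable lebesgue (\<lambda>x. indicator A x :: real)"
    using assms by (simp add: lmeasurable_iff_integrable)
  then show "(\<lambda>x. indicator A x) \<in> Lp p" by (simp add: Lp_def eq)
  show "Lp_norm p (\<lambda>x. indicator A x) = measure lebesgue A powr (1 / p)"
    by (simp add: Lp_norm_def eq)
qed

lemma Lp_exp_norm:
  assumes "0 < a" "0 < p"
  shows "integrable lebesgue (\<lambda>x::'a::euclidean_space. (C * exp (- a * norm x)) powr p)"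
proof -
  have "(\<lambda>x::'a. (C * exp (- a * norm x)) powr p) = (\<lambda>x. C powr p * exp (- (a * p) * norm x))"
  proof
    fix x :: 'a
    have "(C * exp (- a * norm x)) powr p = C powr p * exp (- a * norm x) powr p"
      by (cases "C = 0") (auto simp: powr_def ln_mult exp_add[symmetric] algebra_simps)
    then show "(C * exp (- a * norm x)) powr p = C powr p * exp (- (a * p) * norm x)"
      by (simp add: powr_def mult_ac)
  qed
  then show ?thesis using integrable_exp_norm[of "a * p", where 'a = 'a] assms by simp
qed

text \<open>Let \<open>y\<close> be the affine coordinates that map the box onto the cube with corners at \<open>\<plusminus>1\<close>. The functions
  \<open>exp (- (\<Sum>i. (y i ^ 2) ^ Suc m))\<close> are Schwartz functions that tend to 1 inside the box and to 0 outside its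
  closure, and the elementary inequality \<open>\<bar>t\<bar> - 1 \<le> (t ^ 2) ^ Suc m\<close> gives a common integrable bound.\<close>

lemma indicator_box_in_schwartz_closure:
  fixes a b :: "real^'a::finite"
  assumes p: "1 \<le> p"
  shows "(\<lambda>x. indicator (box a b) x) \<in> schwartz_closure p"
proof (cases "box a b = {}")
  case True then show ?thesis using schwartz_closure_sum[OF p, of "{}"] by simp
next
  case False
  then have ab: "a $ i < b $ i" for i
    by (simp add: interval_ne_empty_cart)
  define c where "c i = (a $ i + b $ i) / 2" for i
  define d where "d i = (b $ i - a $ i) / 2" for i
  have d: "0 < d i" for i using ab[of i] by (simp add: d_def)
  define y where "y x i = (x $ i - c i) / d i" for x :: "real^'a" and i
  define P where "P m x = (\<Sum>i\<in>UNIV. ((y x i)\<^sup>2) ^ Suc m)" for m x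
  define D where "D = (\<Sum>i\<in>UNIV. d i)"
  define N where "N = real CARD('a)"
  define B where "B = norm (\<chi> i. c i) / D + N"
  have D: "0 < D" unfolding D_def by (intro sum_pos d) auto
  have dD: "d i \<le> D" for i unfolding D_def by (intro member_le_sum) (auto simp: less_imp_le d)
  have in_box: "x \<in> box a b \<longleftrightarrow> (\<forall>i. \<bar>y x i\<bar> < 1)" for x
  proof -
    have "a $ i < x $ i \<and> x $ i < b $ i \<longleftrightarrow> \<bar>y x i\<bar> < 1" for i
      using ab[of i] by (auto simp: y_def c_def d_def field_simps abs_less_iff)
    then show ?thesis by (simp add: mem_box_cart)
  qed
  have in_cbox: "x \<in> cbox a b \<longleftrightarrow> (\<forall>i. \<bar>y x i\<bar> \<le> 1)" for x
  proof -
    have "a $ i \<le> x $ i \<and> x $ i \<le> b $ i \<longleftrightarrow> \<bar>y x i\<bar> \<le> 1" for i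
      using ab[of i] by (auto simp: y_def c_def d_def field_simps abs_le_iff)
    then show ?thesis by (simp add: mem_box_cart)
  qed
  have lower: "(1 / D) * norm x - B \<le> (\<Sum>i\<in>UNIV. \<bar>y x i\<bar> - 1)" for x
  proof -
    have "norm x \<le> norm (x - (\<chi> i. c i)) + norm (\<chi> i. c i)" using norm_triangle_sub[of x "\<chi> i. c i"] by simp
    also have "norm (x - (\<chi> i. c i)) \<le> (\<Sum>i\<in>UNIV. \<bar>x $ i - c i\<bar>)"
      using norm_le_l1_cart[of "x - (\<chi> i. c i)"] by simp
    also have "\<dots> \<le> (\<Sum>i\<in>UNIV. D * \<bar>y x i\<bar>)"
    proof (rule sum_mono)
      fix i
      have "\<bar>x $ i - c i\<bar> = d i * \<bar>y x i\<bar>" using d[of i] by (simp add: y_def abs_mult)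
      also have "\<dots> \<le> D * \<bar>y x i\<bar>" by (intro mult_right_mono dD) auto
      finally show "\<bar>x $ i - c i\<bar> \<le> D * \<bar>y x i\<bar>" .
    qed
    finally have "norm x \<le> D * (\<Sum>i\<in>UNIV. \<bar>y x i\<bar>) + norm (\<chi> i. c i)" by (simp add: sum_distrib_left)
    then have "(1 / D) * norm x \<le> (1 / D) * (D * (\<Sum>i\<in>UNIV. \<bar>y x i\<bar>) + norm (\<chi> i. c i))"
      using D by (intro mult_left_mono) auto
    then show ?thesis using D by (simp add: B_def N_def sum_subtractf distrib_left)
  qed
  have P_lower: "(1 / D) * norm x - B \<le> P m x" for m x
  proof -
    have "\<bar>t\<bar> - 1 \<le> (t\<^sup>2) ^ Suc m" for t :: real
    proof (cases "\<bar>t\<bar> \<le> 1")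
      case False
      have "\<bar>t\<bar> * 1 \<le> \<bar>t\<bar> * \<bar>t\<bar>" using False by (intro mult_left_mono) auto
      then have t: "\<bar>t\<bar> \<le> t\<^sup>2" by (simp add: power2_eq_square)
      with False have "t\<^sup>2 \<le> (t\<^sup>2) ^ Suc m" by (intro self_le_power) auto
      with t show ?thesis by linarith
    next
      case True
      have "0 \<le> (t\<^sup>2) ^ Suc m" by (rule zero_le_power) simp
      with True show ?thesis by linarith
    qed
    then have "(\<Sum>i\<in>UNIV. \<bar>y x i\<bar> - 1) \<le> P m x" unfolding P_def by (intro sum_mono)
    with lower[of x] show ?thesis by linarith
  qed
  define u where "u m x = exp (- complex_of_real (P m x))" for m x
  have norm_u: "cmod (u m x) = exp (- P m x)" for m x by (simp add: u_def)
  have u_bound: "cmod (u m x) \<le> exp B * exp (- (1 / D) * norm x)" for m x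
    using P_lower[of x m] by (simp add: norm_u exp_add[symmetric])
  have u_schwartz: "u m \<in> schwartz" for m
    unfolding u_def
  proof (rule schwartz_exp_cpoly)
    have eq: "(\<lambda>x. complex_of_real (P m x))
        = (\<lambda>x. \<Sum>i\<in>UNIV. ((of_real (x $ i) * of_real (1 / d i) - of_real (c i / d i)) ^ 2) ^ Suc m)"
      by (simp add: P_def y_def diff_divide_distrib)
    show "(\<lambda>x. complex_of_real (P m x)) \<in> cpoly"
      unfolding eq by (intro cpoly_sum cpoly_power cpoly_diff cpoly.mult cpoly.coord cpoly.const)
    show "0 < 1 / D" using D by simp
    show "(1 / D) * norm x - B \<le> Re (complex_of_real (P m x))" for x using P_lower by simp
  qed
  have u_meas[measurable]: "u m \<in> borel_measurable lebesgue" for m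
    unfolding u_def P_def y_def
    by (intro measurable_completion) simp
  have dom: "integrable lebesgue (\<lambda>x::real^'a. (C * exp (- (1 / D) * norm x)) powr p)" for C
    using D p by (intro Lp_exp_norm) auto
  have u_Lp: "u m \<in> Lp p" for m
  proof -
    have "integrable lebesgue (\<lambda>x. cmod (u m x) powr p)"
      by (rule Bochner_Integration.integrable_bound[OF dom[of "exp B"]])
        (use p u_bound in \<open>auto intro!: powr_mono2\<close>)
    then show ?thesis by (simp add: Lp_def)
  qed
  have ind_Lp: "(\<lambda>x. indicator (box a b) x) \<in> Lp p"
    by (rule Lp_indicator_lmeasurable(1)) (simp add: lmeasurable_open)
  show ?thesis
  proof (rule schwartz_closure_limit[OF p ind_Lp])
    show "u m \<in> schwartz_closure p" for m
      using u_schwartz u_Lp by (auto simp: schwartz_closure_def intro!: bexI[of _ "u m"])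
    show "(\<lambda>m. Lp_norm p (\<lambda>x. u m x - indicator (box a b) x)) \<longlonglongrightarrow> 0"
    proof (rule Lp_dominated_convergence[OF _ _ _ dom[of "2 * exp B"]])
      show "AE x in lebesgue. (\<lambda>m. u m x) \<longlonglongrightarrow> indicator (box a b) x"
      proof -
        have "AE x in lebesgue. x \<notin> cbox a b - box a b"
          by (intro AE_not_in null_sets_completionI null_sets_cbox_Diff_box)
        then show ?thesis
        proof eventually_elim
          case (elim x)
          show ?case
          proof (cases "x \<in> box a b")
            case True
            then have "((y x i)\<^sup>2) < 1" for i
              using in_box[of x] by (simp add: abs_square_less_1)
            then have "(\<lambda>m. P m x) \<longlonglongrightarrow> (\<Sum>i\<in>(UNIV::'a set). 0)"
              unfolding P_def by (intro tendsto_sum LIMSEQ_Suc LIMSEQ_power_zero) auto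
            then have "(\<lambda>m. u m x) \<longlonglongrightarrow> exp (- complex_of_real 0)"
              unfolding u_def by (intro tendsto_intros) simp
            then show ?thesis using True by simp
          next
            case False
            with elim have "x \<notin> cbox a b" by auto
            then obtain i where i: "1 < \<bar>y x i\<bar>" by (auto simp: in_cbox not_le)
            then have i2: "1 < (y x i)\<^sup>2" using abs_square_less_1[of "y x i"] abs_square_eq_1[of "y x i"] by linarith
            have "filterlim (\<lambda>m. norm (((y x i)\<^sup>2) ^ m)) at_top sequentially"
              using filterlim_realpow_sequentially_gt1[of "(y x i)\<^sup>2"] i2
              by (intro filterlim_at_infinity_imp_norm_at_top) simp
            then have A: "filterlim (\<lambda>m. ((y x i)\<^sup>2) ^ Suc m) at_top sequentially"
              by (subst filterlim_sequentially_Suc) simp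
            have B: "((y x i)\<^sup>2) ^ Suc m \<le> P m x" for m
              unfolding P_def by (rule member_le_sum[where f = "\<lambda>i. ((y x i)\<^sup>2) ^ Suc m"]) auto
            have "filterlim (\<lambda>m. P m x) at_top sequentially"
              by (intro filterlim_at_top_mono[OF A] always_eventually allI B)
            then have "(\<lambda>m. exp (- P m x)) \<longlonglongrightarrow> 0"
              by (rule filterlim_compose[OF exp_at_bot filterlim_compose[OF filterlim_uminus_at_bot_at_top]])
            then have "(\<lambda>m. u m x) \<longlonglongrightarrow> 0"
              by (subst tendsto_norm_zero_iff[symmetric]) (simp add: norm_u)
            then show ?thesis using False by simp
          qed
        qed
      qed
      show "AE x in lebesgue. cmod (u m x - indicator (box a b) x) \<le> 2 * exp B * exp (- (1 / D) * norm x)" for m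
      proof (intro always_eventually allI)
        fix x
        have "cmod (indicator (box a b) x) \<le> exp B * exp (- (1 / D) * norm x)"
        proof (cases "x \<in> box a b")
          case True
          then have "(\<Sum>i\<in>UNIV. \<bar>y x i\<bar> - 1) \<le> (\<Sum>i\<in>(UNIV::'a set). 0)"
            using in_box[of x] by (intro sum_mono) (auto simp: less_imp_le)
          then have "1 / D * norm x - B \<le> 0" using lower[of x] by simp
          then show ?thesis using True by (simp add: exp_add[symmetric])
        qed simp
        then show "cmod (u m x - indicator (box a b) x) \<le> 2 * exp B * exp (- (1 / D) * norm x)"
          using u_bound[of m x] norm_triangle_ineq4[of "u m x" "indicator (box a b) x"] by linarith
      qed
    qed (use p LpD(1)[OF ind_Lp] in auto)
  qed
qed

text \<open>The Borel sets with this property contain the boxes, which are closed under intersection, and form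
  a Dynkin system. Intersecting with a box keeps the indicators of complements and of countable unions in
  the Lebesgue space.\<close>

lemma indicator_Int_box_in_schwartz_closure:
  fixes A :: "(real^'n::finite) set"
  assumes p: "1 \<le> p" and A: "A \<in> sets borel"
  shows "(\<lambda>x. indicator (A \<inter> box a b) x) \<in> schwartz_closure p"
proof -
  define G where "G = range (\<lambda>(a, b). box a b :: (real^'n) set)"
  have sets_eq: "sets (borel :: (real^'n) measure) = sigma_sets UNIV G"
    unfolding G_def by (subst borel_eq_box) (rule sets_measure_of, simp)
  have A': "A \<in> sigma_sets UNIV G" using A unfolding sets_eq .
  have "Int_stable G"
    unfolding Int_stable_def
  proof (intro ballI)
    fix A B assume "A \<in> G" "B \<in> G"
    then obtain a b c d where "A = box a b" "B = box c d" by (auto simp: G_def)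
    moreover obtain e f where "box a b \<inter> box c d = box e f" using box_Int_box by blast
    ultimately show "A \<inter> B \<in> G" unfolding G_def by (auto intro!: image_eqI[of _ _ "(e, f)"])
  qed
  moreover have "G \<subseteq> Pow UNIV" by simp
  ultimately have "\<forall>a b. (\<lambda>x. indicator (A \<inter> box a b) x :: complex) \<in> schwartz_closure p"
    using A'
  proof (induction rule: sigma_sets_induct_disjoint)
    case (basic A)
    then obtain c d where "A = box c d" by (auto simp: G_def)
    show ?case
    proof (intro allI)
      fix a b
      obtain e f where ef: "box c d \<inter> box a b = box e f" using box_Int_box by blast
      show "(\<lambda>x. indicator (A \<inter> box a b) x :: complex) \<in> schwartz_closure p"
        unfolding \<open>A = box c d\<close> ef by (rule indicator_box_in_schwartz_closure[OF p])
    qed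
  next
    case empty
    then show ?case using schwartz_closure_sum[OF p, of "{}"] by simp
  next
    case (compl A)
    show ?case
    proof (intro allI)
      fix a b :: "real^'n"
      have "(\<lambda>x. indicator (box a b) x + (-1) * indicator (A \<inter> box a b) x :: complex) \<in> schwartz_closure p"
        using compl(2) by (intro schwartz_closure_add[OF p] schwartz_closure_cmult[OF p, of _ "-1"]
            indicator_box_in_schwartz_closure[OF p]) blast
      also have "(\<lambda>x. indicator (box a b) x + (-1) * indicator (A \<inter> box a b) x :: complex)
          = (\<lambda>x. indicator ((UNIV - A) \<inter> box a b) x)"
        by (rule ext) (simp add: indicator_def)
      finally show "(\<lambda>x. indicator ((UNIV - A) \<inter> box a b) x :: complex) \<in> schwartz_closure p" .
    qed
  next
    case (union A)
    show ?case
    proof (intro allI)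
      fix a b :: "real^'n"
      have [measurable]: "A i \<in> sets borel" for i
        unfolding sets_eq using union(2) by (rule subsetD) (rule rangeI)
      have box_i: "integrable lebesgue (\<lambda>x. indicator (box a b) x :: real)"
        by (simp add: lmeasurable_iff_integrable[symmetric])
      have 1: "(\<lambda>x. indicator (\<Union>(range A) \<inter> box a b) x :: complex) \<in> Lp p"
        by (intro Lp_indicator_lmeasurable(1) bounded_set_imp_lmeasurable) auto
      show "(\<lambda>x. indicator (\<Union>(range A) \<inter> box a b) x :: complex) \<in> schwartz_closure p"
      proof (rule schwartz_closure_limit[OF p 1, where u = "\<lambda>m x. \<Sum>i<m. indicator (A i \<inter> box a b) x"])
        show "(\<lambda>x. \<Sum>i<m. indicator (A i \<inter> box a b) x) \<in> schwartz_closure p" for m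
          using union(3) by (intro schwartz_closure_sum[OF p]) auto
        have eq: "(\<Sum>i<m. indicator (A i \<inter> box a b) x) = (indicator ((\<Union>i<m. A i) \<inter> box a b) x :: complex)" for m x
        proof -
          have "(\<Sum>i<m. indicator (A i) x) = (indicator (\<Union>i<m. A i) x :: complex)"
            using union(1) by (intro indicator_UN_disjoint[symmetric]) (auto simp: disjoint_family_on_def)
          then show ?thesis by (simp only: indicator_inter_arith sum_distrib_right[symmetric])
        qed
        show "(\<lambda>m. Lp_norm p (\<lambda>x. (\<Sum>i<m. indicator (A i \<inter> box a b) x) - indicator (\<Union> (range A) \<inter> box a b) x)) \<longlonglongrightarrow> 0"
        proof (rule Lp_dominated_convergence[where g = "\<lambda>x. indicator (box a b) x"])
          show "integrable lebesgue (\<lambda>x. indicator (box a b) x powr p)"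
          proof -
            have "(\<lambda>x. indicator (box a b) x powr p) = indicat_real (box a b)"
              by (rule ext) (simp add: indicator_def)
            then show ?thesis using box_i by simp
          qed
          show "AE x in lebesgue. (\<lambda>m. \<Sum>i<m. indicator (A i \<inter> box a b) x) \<longlonglongrightarrow> (indicator (\<Union> (range A) \<inter> box a b) x :: complex)"
          proof (intro always_eventually allI)
            fix x :: "real^'n"
            have "incseq (\<lambda>m. (\<Union>i<m. A i) \<inter> box a b)"
              by (intro incseq_SucI Int_mono UN_mono) auto
            have UN: "(\<Union>m. (\<Union>i<m. A i) \<inter> box a b) = \<Union>(range A) \<inter> box a b"
              using UN_UN_finite_eq[of A] unfolding lessThan_atLeast0 Int_UN_distrib2[symmetric]
              by (simp only: Int_UN_distrib2 UN_simps)
            have "(\<lambda>m. indicator ((\<Union>i<m. A i) \<inter> box a b) x :: complex) \<longlonglongrightarrow>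
                indicator (\<Union>m. (\<Union>i<m. A i) \<inter> box a b) x"
              by (rule LIMSEQ_indicator_incseq) fact
            from this[unfolded UN]
            show "(\<lambda>m. \<Sum>i<m. indicator (A i \<inter> box a b) x) \<longlonglongrightarrow> (indicator (\<Union> (range A) \<inter> box a b) x :: complex)"
              by (simp only: eq)
          qed
          show "AE x in lebesgue. cmod ((\<Sum>i<m. indicator (A i \<inter> box a b) x) - indicator (\<Union> (range A) \<inter> box a b) x) \<le> indicator (box a b) x" for m
          proof (intro always_eventually allI)
            fix x
            have "(\<Union>i<m. A i) \<inter> box a b \<subseteq> box a b" "\<Union>(range A) \<inter> box a b \<subseteq> box a b" by (rule Int_lower2)+
            then show "cmod ((\<Sum>i<m. indicator (A i \<inter> box a b) x) - indicator (\<Union> (range A) \<inter> box a b) x) \<le> indicator (box a b) x"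
              unfolding eq by (cases "x \<in> box a b") (simp_all add: indicator_def del: UN_iff Union_iff)
          qed
          show "(\<lambda>x. indicator (\<Union> (range A) \<inter> box a b) x :: complex) \<in> borel_measurable lebesgue"
            using LpD(1)[OF 1] .
          show "(\<lambda>x. \<Sum>i<m. indicator (A i \<inter> box a b) x :: complex) \<in> borel_measurable lebesgue" for m
            unfolding eq by (intro borel_measurable_indicator sets_completionI_sets) simp
        qed (use p in simp)
      qed
    qed
  qed
  then show ?thesis by blast
qed

text \<open>Up to a null set the set is Borel, and it is exhausted by its intersections with growing boxes.\<close>

lemma indicator_in_schwartz_closure:
  fixes A :: "(real^'n::finite) set"
  assumes p: "1 \<le> p" and A: "(\<lambda>x. indicator A x) \<in> Lp p"
  shows "(\<lambda>x. indicator A x) \<in> schwartz_closure p"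
proof -
  have "A = (\<lambda>x. indicator A x :: complex) -` {1} \<inter> space lebesgue" by (auto simp: indicator_def)
  also have "\<dots> \<in> sets lebesgue" using LpD(1)[OF A] by (rule measurable_sets) auto
  finally have Am: "A \<in> sets lebesgue" .
  then obtain S N N' where SN: "A = S \<union> N" "N \<subseteq> N'" "N' \<in> null_sets lborel" "S \<in> sets lborel"
    by (rule sets_completionE)
  have Sb[measurable]: "S \<in> sets borel" using SN by simp
  have AE: "AE x in lebesgue. indicator A x = (indicator S x :: complex)"
  proof -
    have "AE x in lebesgue. x \<notin> N'" using SN(3) by (intro AE_not_in null_sets_completionI)
    then show ?thesis by eventually_elim (use SN in \<open>auto simp: indicator_def\<close>)
  qed
  have S_meas: "(\<lambda>x. indicator S x :: complex) \<in> borel_measurable lebesgue"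
    by (intro borel_measurable_indicator sets_completionI_sets) simp
  have S_Lp: "(\<lambda>x. indicator S x :: complex) \<in> Lp p"
    by (rule Lp_cong_AE(1)[OF A S_meas AE])
  define Q :: "nat \<Rightarrow> (real^'n) set" where "Q m = box (\<chi> i. - real m) (\<chi> i. real m)" for m
  have [measurable]: "Q m \<in> sets borel" for m by (simp add: Q_def)
  show ?thesis
  proof (rule schwartz_closure_limit[OF p A, where u = "\<lambda>m x. indicator (S \<inter> Q m) x"])
    show "(\<lambda>x. indicator (S \<inter> Q m) x) \<in> schwartz_closure p" for m
      unfolding Q_def by (rule indicator_Int_box_in_schwartz_closure[OF p Sb])
    show "(\<lambda>m. Lp_norm p (\<lambda>x. indicator (S \<inter> Q m) x - indicator A x)) \<longlonglongrightarrow> 0"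
    proof (rule Lp_dominated_convergence[where g = "\<lambda>x. cmod (indicator A x)"])
      show "integrable lebesgue (\<lambda>x. cmod (indicator A x) powr p)" using LpD(2)[OF A] .
      show "AE x in lebesgue. (\<lambda>m. indicator (S \<inter> Q m) x) \<longlonglongrightarrow> (indicator A x :: complex)"
        using AE
      proof eventually_elim
        case (elim x)
        obtain m0 :: nat where m0: "norm x < real m0" using reals_Archimedean2 by blast
        have "x \<in> Q m" if "m0 \<le> m" for m
        proof -
          have "\<bar>x $ i\<bar> < real m" for i using component_le_norm_cart[of x i] m0 that by linarith
          then show ?thesis by (auto simp: Q_def mem_box_cart abs_less_iff minus_less_iff)
        qed
        then have "\<forall>\<^sub>F m in sequentially. indicator (S \<inter> Q m) x = (indicator A x :: complex)"
          unfolding eventually_sequentially elim by (intro exI[of _ m0]) (auto simp: indicator_def)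
        then show ?case by (rule tendsto_eventually)
      qed
      show "AE x in lebesgue. cmod (indicator (S \<inter> Q m) x - indicator A x) \<le> cmod (indicator A x)" for m
        using SN(1) by (auto simp: indicator_def)
      show "(\<lambda>x. indicator A x :: complex) \<in> borel_measurable lebesgue" using LpD(1)[OF A] .
      show "(\<lambda>x. indicator (S \<inter> Q m) x :: complex) \<in> borel_measurable lebesgue" for m
        by (intro borel_measurable_indicator sets_completionI_sets) measurable
    qed (use p in simp)
  qed
qed

text \<open>Every \<open>L\<^sub>p\<close> function is a dominated limit of simple functions, and the indicators occurring in a
  simple \<open>L\<^sub>p\<close> function with nonzero coefficient are themselves in \<open>L\<^sub>p\<close>.\<close>

theorem schwartz_dense_in_Lp:
  fixes f :: "real^'n::finite \<Rightarrow> complex"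
  assumes p: "1 \<le> p" and f: "f \<in> Lp p"
  shows "f \<in> schwartz_closure p"
proof -
  obtain s where s: "\<And>i. simple_function lebesgue (s i)" "\<And>x. (\<lambda>i. s i x) \<longlonglongrightarrow> f x"
    "\<And>i x. cmod (s i x) \<le> 2 * cmod (f x)"
    using borel_measurable_implies_sequence_metric[OF LpD(1)[OF f], of 0] by simp metis
  have sm[measurable]: "s i \<in> borel_measurable lebesgue" for i
    using s(1) by (rule borel_measurable_simple_function)
  have sL: "s i \<in> Lp p" for i
  proof (rule Lp_mono(1)[OF _ Lp_scale(1)[OF _ f, of 2] sm])
    show "AE x in lebesgue. cmod (s i x) \<le> cmod (2 * f x)"
      using s(3) by (intro always_eventually allI) (simp add: norm_mult)
  qed (use p in auto)
  show ?thesis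
  proof (rule schwartz_closure_limit[OF p f, where u = s])
    show "s i \<in> schwartz_closure p" for i
    proof -
      have fin: "finite (range (s i))" using s(1)[of i] by (simp add: simple_function_def)
      have "s i x = (\<Sum>y\<in>range (s i) - {0}. y * indicator (s i -` {y}) x)" for x
      proof -
        have "s i x = (\<Sum>y\<in>range (s i). indicator (s i -` {y}) x *\<^sub>R y)"
          by (rule simple_function_indicator_representation_banach[OF s(1)[of i], of x,
                unfolded space_completion space_lborel space_borel Int_UNIV_right, OF UNIV_I])
        also have "\<dots> = (\<Sum>y\<in>range (s i). y * indicator (s i -` {y}) x)"
          by (intro sum.cong) (auto simp: indicator_def)
        also have "\<dots> = (\<Sum>y\<in>range (s i) - {0}. y * indicator (s i -` {y}) x)"
          by (intro sum.mono_neutral_right fin) auto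
        finally show ?thesis .
      qed
      then have eq: "s i = (\<lambda>x. \<Sum>y\<in>range (s i) - {0}. y * indicator (s i -` {y}) x)" by (rule ext)
      show ?thesis
      proof (subst eq, rule schwartz_closure_sum[OF p], rule schwartz_closure_cmult[OF p],
          rule indicator_in_schwartz_closure[OF p])
        fix y assume y: "y \<in> range (s i) - {0}"
        have [measurable]: "s i -` {y} \<in> sets lebesgue"
          using measurable_sets[OF sm, of "{y}" i] by simp
        show "(\<lambda>x. indicator (s i -` {y}) x) \<in> Lp p"
        proof (rule Lp_mono(1)[OF _ Lp_scale(1)[OF _ sL, of "1 / y" i]])
          show "AE x in lebesgue. cmod (indicator (s i -` {y}) x) \<le> cmod (1 / y * s i x)"
          proof (intro always_eventually allI)
            fix x
            show "cmod (indicator (s i -` {y}) x) \<le> cmod (1 / y * s i x)"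
              using y by (cases "s i x = y") (simp_all add: indicator_def)
          qed
        qed (use p in auto)
      qed
    qed
    have "integrable lebesgue (\<lambda>x. 3 powr p * cmod (f x) powr p)" using LpD(2)[OF f] by simp
    then have i: "integrable lebesgue (\<lambda>x. (3 * cmod (f x)) powr p)" by (simp add: powr_mult)
    show "(\<lambda>j. Lp_norm p (\<lambda>x. s j x - f x)) \<longlonglongrightarrow> 0"
    proof (rule Lp_dominated_convergence[OF _ _ _ i])
      show "AE x in lebesgue. cmod (s j x - f x) \<le> 3 * cmod (f x)" for j
      proof (intro always_eventually allI)
        fix x
        show "cmod (s j x - f x) \<le> 3 * cmod (f x)"
          using s(3)[of j x] norm_triangle_ineq4[of "s j x" "f x"] by linarith
      qed
      show "AE x in lebesgue. (\<lambda>j. s j x) \<longlonglongrightarrow> f x" using s(2) by (intro always_eventually allI)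
    qed (use p sm LpD(1)[OF f] in simp_all)
  qed
qed

lemma schwartz_approximation:
  fixes f :: "real^'n::finite \<Rightarrow> complex"
  assumes p: "1 \<le> p" and f: "f \<in> Lp p"
  obtains u where "\<And>j. u j \<in> schwartz" "\<And>j. u j \<in> Lp p" "(\<lambda>j. Lp_norm p (\<lambda>x. u j x - f x)) \<longlonglongrightarrow> 0"
proof -
  have "\<exists>g. g \<in> schwartz \<and> g \<in> Lp p \<and> Lp_norm p (\<lambda>x. g x - f x) < inverse (real (Suc j))" for j
  proof -
    have "0 < inverse (real (Suc j))" by simp
    then show ?thesis using schwartz_dense_in_Lp[OF p f] unfolding schwartz_closure_def by blast
  qed
  then obtain u where u: "\<And>j. u j \<in> schwartz" "\<And>j. u j \<in> Lp p"
      "\<And>j. Lp_norm p (\<lambda>x. u j x - f x) < inverse (real (Suc j))" by metis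
  have "(\<lambda>j. Lp_norm p (\<lambda>x. u j x - f x)) \<longlonglongrightarrow> 0"
    by (rule tendsto_sandwich[OF _ _ tendsto_const LIMSEQ_inverse_real_of_nat])
      (use u(3) in \<open>auto intro!: always_eventually less_imp_le\<close>)
  then show thesis using that u by blast
qed

section \<open>Completeness of Lebesgue spaces\<close>

text \<open>A subsequence along which consecutive distances decay geometrically converges almost everywhere:
  by Tonelli, the series of the \<open>p\<close>-th powers of the differences, scaled up by \<open>2 ^ k\<close>, is finite almost
  everywhere, so the differences are eventually bounded by \<open>(1/2) ^ k\<close>. Fatou's lemma turns the limit at
  each point into a limit in norm.\<close>

lemma Lp_complete:
  fixes u :: "nat \<Rightarrow> real^'n::finite \<Rightarrow> complex"
  assumes p: "1 \<le> p" and u: "\<And>j. u j \<in> Lp p"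
    and cauchy: "\<And>e. 0 < e \<Longrightarrow> \<exists>N. \<forall>i\<ge>N. \<forall>j\<ge>N. Lp_norm p (\<lambda>x. u i x - u j x) < e"
  shows "\<exists>f \<in> Lp p. (\<lambda>j. Lp_norm p (\<lambda>x. u j x - f x)) \<longlonglongrightarrow> 0"
proof -
  have p0: "0 < p" using p by simp
  note [measurable] = LpD(1)[OF u]
  have "\<exists>N. \<forall>i\<ge>N. \<forall>j\<ge>N. Lp_norm p (\<lambda>x. u i x - u j x) < (1/4) ^ k" for k :: nat
    by (rule cauchy) simp
  then obtain N where N: "\<And>k i j. N k \<le> i \<Longrightarrow> N k \<le> j \<Longrightarrow> Lp_norm p (\<lambda>x. u i x - u j x) < (1/4) ^ k"
    by metis
  define s where "s k = (\<Sum>i\<le>k. N i)" for k :: nat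
  have s: "N m \<le> s k" if "m \<le> k" for m k
    unfolding s_def using that by (intro member_le_sum) auto
  define d where "d k x = u (s (Suc k)) x - u (s k) x" for k x
  have [measurable]: "d k \<in> borel_measurable lebesgue" for k unfolding d_def by measurable
  have dL: "d k \<in> Lp p" for k unfolding d_def by (rule Lp_diff(1)[OF p u u])
  have d: "Lp_norm p (d k) \<le> (1/4) ^ k" for k
    unfolding d_def using N[of k "s (Suc k)" "s k"] s[of k "Suc k"] s[of k k] by simp
  have "(\<integral>\<^sup>+x. (\<Sum>k. ennreal ((2 ^ k * cmod (d k x)) powr p)) \<partial>lebesgue)
      = (\<Sum>k. \<integral>\<^sup>+x. ennreal ((2 ^ k * cmod (d k x)) powr p) \<partial>lebesgue)"
    by (rule nn_integral_suminf) measurable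
  also have "\<dots> \<le> (\<Sum>k. ennreal ((1/2) ^ k))"
  proof (intro suminf_le allI)
    fix k
    have eq: "(2 ^ k * cmod (d k x)) powr p = (2 ^ k) powr p * cmod (d k x) powr p" for x
      by (rule powr_mult)
    have "(\<integral>x. cmod (d k x) powr p \<partial>lebesgue) \<le> ((1/4) ^ k) powr p"
      using d[of k] Lp_norm_le_iff[OF p0, of "(1/4) ^ k" "d k"] by simp
    then have "(2 ^ k) powr p * (\<integral>x. cmod (d k x) powr p \<partial>lebesgue) \<le> (2 ^ k) powr p * ((1/4) ^ k) powr p"
      by (intro mult_left_mono) auto
    also have "\<dots> = ((1/2) ^ k) powr p"
      unfolding powr_mult[symmetric] power_mult_distrib[symmetric] by simp
    also have "\<dots> \<le> ((1/2) ^ k) powr 1" using p by (intro powr_mono') (auto simp: power_le_one)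
    finally have "(2 ^ k) powr p * (\<integral>x. cmod (d k x) powr p \<partial>lebesgue) \<le> (1/2) ^ k" by simp
    moreover have "(\<integral>\<^sup>+x. ennreal ((2 ^ k * cmod (d k x)) powr p) \<partial>lebesgue)
        = ennreal (\<integral>x. (2 ^ k) powr p * cmod (d k x) powr p \<partial>lebesgue)"
      unfolding eq using LpD(2)[OF dL[of k]] by (intro nn_integral_eq_integral) auto
    ultimately show "(\<integral>\<^sup>+x. ennreal ((2 ^ k * cmod (d k x)) powr p) \<partial>lebesgue) \<le> ennreal ((1/2) ^ k)"
      by (simp add: ennreal_leI)
  qed auto
  also have "\<dots> = ennreal (\<Sum>k. (1/2) ^ k)" by (rule suminf_ennreal2) auto
  also have "\<dots> < \<infinity>" by simp
  finally have "AE x in lebesgue. (\<Sum>k. ennreal ((2 ^ k * cmod (d k x)) powr p)) \<noteq> \<infinity>"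
    by (intro nn_integral_PInf_AE) auto
  then have conv: "AE x in lebesgue. convergent (\<lambda>k. u (s k) x)"
  proof eventually_elim
    case (elim x)
    have "summable (\<lambda>k. (2 ^ k * cmod (d k x)) powr p)"
    proof (rule ccontr)
      assume "\<not> summable (\<lambda>k. (2 ^ k * cmod (d k x)) powr p)"
      from summable_iff_suminf_neq_top[OF powr_ge_zero this] elim show False by simp
    qed
    then have "(\<lambda>k. (2 ^ k * cmod (d k x)) powr p) \<longlonglongrightarrow> 0" by (rule summable_LIMSEQ_zero)
    then have "\<forall>\<^sub>F k in sequentially. (2 ^ k * cmod (d k x)) powr p < 1"
      by (rule order_tendstoD) simp
    then have ev: "\<forall>\<^sub>F k in sequentially. norm (d k x) \<le> (1/2) ^ k"
    proof eventually_elim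
      case (elim k)
      have "2 ^ k * cmod (d k x) < 1"
      proof (rule ccontr)
        assume "\<not> 2 ^ k * cmod (d k x) < 1"
        then have "1 powr p \<le> (2 ^ k * cmod (d k x)) powr p" using p by (intro powr_mono2) auto
        with elim show False by simp
      qed
      then show ?case by (simp add: power_one_over pos_le_divide_eq mult.commute)
    qed
    have "summable (\<lambda>k. d k x)" by (rule summable_comparison_test_ev[OF ev]) simp
    then have "convergent (\<lambda>n. \<Sum>k<n. d k x)" by (simp add: summable_iff_convergent)
    then have "convergent (\<lambda>n. (\<Sum>k<n. d k x) + u (s 0) x)"
      by (intro convergent_add convergent_const)
    moreover have "(\<Sum>k<n. d k x) + u (s 0) x = u (s n) x" for n
      unfolding d_def by (subst sum_lessThan_telescope) simp
    ultimately show ?case by simp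
  qed
  define f where "f x = lim (\<lambda>k. u (s k) x)" for x
  have f[measurable]: "f \<in> borel_measurable lebesgue" unfolding f_def by measurable
  have lim: "AE x in lebesgue. (\<lambda>k. u (s k) x) \<longlonglongrightarrow> f x"
    using conv by eventually_elim (simp add: f_def convergent_LIMSEQ_iff)
  have key: "(\<lambda>x. u j x - f x) \<in> Lp p \<and> Lp_norm p (\<lambda>x. u j x - f x) \<le> (1/4) ^ m" if j: "N m \<le> j" for j m
  proof -
    have L: "(\<lambda>x. u j x - u (s k) x) \<in> Lp p" for k by (rule Lp_diff(1)[OF p u u])
    have bd: "\<forall>\<^sub>F k in sequentially. Lp_norm p (\<lambda>x. u j x - u (s k) x) \<le> (1/4) ^ m"
      unfolding eventually_sequentially
    proof (intro exI allI impI)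
      fix k assume "m \<le> k"
      then show "Lp_norm p (\<lambda>x. u j x - u (s k) x) \<le> (1/4) ^ m"
        using N[OF j s] by (intro less_imp_le)
    qed
    have l: "AE x in lebesgue. (\<lambda>k. u j x - u (s k) x) \<longlonglongrightarrow> u j x - f x"
      using lim by eventually_elim (intro tendsto_intros)
    have me: "(\<lambda>x. u j x - f x) \<in> borel_measurable lebesgue" by measurable
    show ?thesis using Lp_fatou[OF p0 _ L bd me l] by simp
  qed
  have "f \<in> Lp p"
    using Lp_diff(1)[OF p u conjunct1[OF key[OF order_refl]], of "N 0" 0] by simp
  moreover have "(\<lambda>j. Lp_norm p (\<lambda>x. u j x - f x)) \<longlonglongrightarrow> 0"
  proof (rule LIMSEQ_I)
    fix e :: real assume "0 < e"
    then obtain m where m: "(1/4) ^ m < e" using real_arch_pow_inv[of e "1/4"] by auto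
    show "\<exists>n0. \<forall>n\<ge>n0. norm (Lp_norm p (\<lambda>x. u n x - f x) - 0) < e"
    proof (intro exI allI impI)
      fix n assume "N m \<le> n"
      from conjunct2[OF key[OF this]] m
      show "norm (Lp_norm p (\<lambda>x. u n x - f x) - 0) < e" by simp
    qed
  qed
  ultimately show ?thesis by blast
qed

section \<open>Continuous extension of a convolution\<close>

lemma tempered_distribution_linear:
  assumes "tempered_distribution k" "f \<in> schwartz"
  shows "g \<in> schwartz \<Longrightarrow> k (\<lambda>x. f x + g x) = k f + k g" "k (\<lambda>x. c * f x) = c * k f"
  using assms unfolding tempered_distribution_def by simp_all

lemma dist_conv_diff:
  assumes k: "tempered_distribution k" and f: "f \<in> schwartz" and g: "g \<in> schwartz"
  shows "dist_conv k (\<lambda>x. f x - g x) = (\<lambda>x. dist_conv k f x - dist_conv k g x)"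
proof
  fix x
  note s = schwartz_reflect[OF f, of x] schwartz_reflect[OF g, of x]
  have "k (\<lambda>y. f (x - y) + (-1) * g (x - y)) = k (\<lambda>y. f (x - y)) + k (\<lambda>y. (-1) * g (x - y))"
    by (rule tempered_distribution_linear(1)[OF k s(1) schwartz_cmult[OF s(2), of "-1"]])
  also have "k (\<lambda>y. (-1) * g (x - y)) = (-1) * k (\<lambda>y. g (x - y))"
    by (rule tempered_distribution_linear(2)[OF k s(2)])
  finally show "dist_conv k (\<lambda>x. f x - g x) x = dist_conv k f x - dist_conv k g x"
    by (simp add: dist_conv_def)
qed

lemma dist_conv_cmult:
  assumes k: "tempered_distribution k" and f: "f \<in> schwartz"
  shows "dist_conv k (\<lambda>x. c * f x) = (\<lambda>x. c * dist_conv k f x)"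
proof
  fix x
  show "dist_conv k (\<lambda>x. c * f x) x = c * dist_conv k f x"
    unfolding dist_conv_def by (rule tempered_distribution_linear(2)[OF k schwartz_reflect[OF f, of x]])
qed

lemma dist_conv_translate:
  "dist_conv k (\<lambda>x. f (x - a)) x = dist_conv k f (x - a)"
  by (simp add: dist_conv_def algebra_simps)

lemma CnvD:
  assumes "k \<in> Cnv p r"
  obtains C where "0 \<le> C" "tempered_distribution k" "\<And>f. f \<in> schwartz \<Longrightarrow> dist_conv k f \<in> Lp r"
    "\<And>f. f \<in> schwartz \<Longrightarrow> Lp_norm r (dist_conv k f) \<le> C * Lp_norm p f"
proof -
  obtain C where C: "tempered_distribution k" "\<And>f. f \<in> schwartz \<Longrightarrow> dist_conv k f \<in> Lp r"
    "\<And>f. f \<in> schwartz \<Longrightarrow> Lp_norm r (dist_conv k f) \<le> C * Lp_norm p f"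
    using assms unfolding Cnv_def by blast
  have "Lp_norm r (dist_conv k f) \<le> max C 0 * Lp_norm p f" if "f \<in> schwartz" for f
    using C(3)[OF that] mult_right_mono[OF max.cobounded1[of C 0] Lp_norm_nonneg[of p f]] by linarith
  then show thesis using that[of "max C 0"] C by simp
qed

text \<open>The images of approximating Schwartz functions form a Cauchy sequence. Bounding the distance of its
  limit from the image of every Schwartz function \<open>g\<close> makes the limit independent of the
  approximating sequence and gives the Lipschitz continuity of the extension at once.\<close>

lemma Cnv_extension_point:
  fixes k :: "(real^'n::finite \<Rightarrow> complex) \<Rightarrow> complex"
  assumes p: "1 \<le> p" and r: "1 \<le> r" and k: "tempered_distribution k" and C: "0 \<le> C"
    and kL: "\<And>f. f \<in> schwartz \<Longrightarrow> dist_conv k f \<in> Lp r"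
    and kC: "\<And>f. f \<in> schwartz \<Longrightarrow> Lp_norm r (dist_conv k f) \<le> C * Lp_norm p f"
    and f: "f \<in> Lp p"
  shows "\<exists>F \<in> Lp r. \<forall>g \<in> schwartz \<inter> Lp p.
      Lp_norm r (\<lambda>x. dist_conv k g x - F x) \<le> C * Lp_norm p (\<lambda>x. g x - f x)"
proof -
  have lip: "Lp_norm r (\<lambda>x. dist_conv k g x - dist_conv k h x) \<le> C * Lp_norm p (\<lambda>x. g x - h x)"
    if "g \<in> schwartz" "h \<in> schwartz" for g h :: "real^'n \<Rightarrow> complex"
    using kC[OF schwartz_diff[OF that]] by (simp add: dist_conv_diff[OF k that])
  obtain u where u: "\<And>j. u j \<in> schwartz" "\<And>j. u j \<in> Lp p"
    "(\<lambda>j. Lp_norm p (\<lambda>x. u j x - f x)) \<longlonglongrightarrow> 0" using schwartz_approximation[OF p f] by blast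
  have "\<exists>F\<in>Lp r. (\<lambda>j. Lp_norm r (\<lambda>x. dist_conv k (u j) x - F x)) \<longlonglongrightarrow> 0"
  proof (rule Lp_complete[OF r kL[OF u(1)]])
    fix e :: real assume e: "0 < e"
    then have "0 < e / (2 * (C + 1))" using C by simp
    from order_tendstoD(2)[OF u(3) this] obtain N where
      N: "\<And>j. N \<le> j \<Longrightarrow> Lp_norm p (\<lambda>x. u j x - f x) < e / (2 * (C + 1))"
      unfolding eventually_sequentially by blast
    have "Lp_norm r (\<lambda>x. dist_conv k (u i) x - dist_conv k (u j) x) < e" if "N \<le> i" "N \<le> j" for i j
    proof -
      have "Lp_norm p (\<lambda>x. u i x - u j x) < 2 * (e / (2 * (C + 1)))"
        using Lp_norm_diff_triangle[OF p u(2) f u(2), of i j] N[OF that(1)] N[OF that(2)]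
          Lp_norm_minus_commute[of p f "u j"] by linarith
      also have "2 * (e / (2 * (C + 1))) = e / (C + 1)" using C by (simp add: field_simps)
      finally have 1: "Lp_norm p (\<lambda>x. u i x - u j x) < e / (C + 1)" .
      have "Lp_norm r (\<lambda>x. dist_conv k (u i) x - dist_conv k (u j) x) \<le> (C + 1) * Lp_norm p (\<lambda>x. u i x - u j x)"
        using lip[OF u(1) u(1), of i j] Lp_norm_nonneg[of p "\<lambda>x. u i x - u j x"]
        unfolding distrib_right by linarith
      also have "\<dots> < e" using 1 C by (simp add: pos_less_divide_eq mult.commute)
      finally show ?thesis .
    qed
    then show "\<exists>N. \<forall>i\<ge>N. \<forall>j\<ge>N. Lp_norm r (\<lambda>x. dist_conv k (u i) x - dist_conv k (u j) x) < e"
      by blast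
  qed
  then obtain F where F: "F \<in> Lp r" "(\<lambda>j. Lp_norm r (\<lambda>x. dist_conv k (u j) x - F x)) \<longlonglongrightarrow> 0" by blast
  show ?thesis
  proof (intro bexI[OF _ F(1)] ballI)
    fix g :: "real^'n \<Rightarrow> complex" assume g: "g \<in> schwartz \<inter> Lp p"
    show "Lp_norm r (\<lambda>x. dist_conv k g x - F x) \<le> C * Lp_norm p (\<lambda>x. g x - f x)"
    proof (rule tendsto_lowerbound)
      show "(\<lambda>j. C * (Lp_norm p (\<lambda>x. g x - f x) + Lp_norm p (\<lambda>x. u j x - f x))
          + Lp_norm r (\<lambda>x. dist_conv k (u j) x - F x)) \<longlonglongrightarrow> C * Lp_norm p (\<lambda>x. g x - f x)"
        using tendsto_add[OF tendsto_mult_left[OF tendsto_add[OF tendsto_const u(3)], of C] F(2)] by simp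
      show "\<forall>\<^sub>F j in sequentially. Lp_norm r (\<lambda>x. dist_conv k g x - F x)
         \<le> C * (Lp_norm p (\<lambda>x. g x - f x) + Lp_norm p (\<lambda>x. u j x - f x))
          + Lp_norm r (\<lambda>x. dist_conv k (u j) x - F x)"
      proof (intro always_eventually allI)
        fix j
        have "Lp_norm r (\<lambda>x. dist_conv k g x - F x) \<le> Lp_norm r (\<lambda>x. dist_conv k g x - dist_conv k (u j) x)
            + Lp_norm r (\<lambda>x. dist_conv k (u j) x - F x)"
          using g by (intro Lp_norm_diff_triangle r kL u F) auto
        moreover have "Lp_norm r (\<lambda>x. dist_conv k g x - dist_conv k (u j) x) \<le> C * Lp_norm p (\<lambda>x. g x - u j x)"
          using g by (intro lip u) auto
        moreover have "C * Lp_norm p (\<lambda>x. g x - u j x) \<le> C * (Lp_norm p (\<lambda>x. g x - f x) + Lp_norm p (\<lambda>x. u j x - f x))"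
          using Lp_norm_diff_triangle[OF p _ f u(2), of g j] g Lp_norm_minus_commute[of p f "u j"] C
          by (intro mult_left_mono) auto
        ultimately show "Lp_norm r (\<lambda>x. dist_conv k g x - F x)
         \<le> C * (Lp_norm p (\<lambda>x. g x - f x) + Lp_norm p (\<lambda>x. u j x - f x))
          + Lp_norm r (\<lambda>x. dist_conv k (u j) x - F x)" by linarith
      qed
    qed simp
  qed
qed

lemma continuous_LpI_Lipschitz:
  fixes K :: "(real^'n::finite \<Rightarrow> complex) \<Rightarrow> real^'n \<Rightarrow> complex"
  assumes "\<And>f. f \<in> Lp p \<Longrightarrow> K f \<in> Lp r"
    and lip: "\<And>f g. f \<in> Lp p \<Longrightarrow> g \<in> Lp p \<Longrightarrow>
      Lp_norm r (\<lambda>x. K f x - K g x) \<le> C * Lp_norm p (\<lambda>x. f x - g x)"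
  shows "continuous_Lp p r K"
  unfolding continuous_Lp_def
proof (intro conjI ballI allI impI assms(1))
  fix u and f :: "real^'n \<Rightarrow> complex" assume f: "f \<in> Lp p" and u: "\<forall>j. u j \<in> Lp p"
    and lim: "(\<lambda>j. Lp_norm p (\<lambda>x. u j x - f x)) \<longlonglongrightarrow> 0"
  show "(\<lambda>j. Lp_norm r (\<lambda>x. K (u j) x - K f x)) \<longlonglongrightarrow> 0"
  proof (rule tendsto_sandwich[OF _ _ tendsto_const])
    show "(\<lambda>j. C * Lp_norm p (\<lambda>x. u j x - f x)) \<longlonglongrightarrow> 0"
      using tendsto_mult_left[OF lim, of C] by simp
    show "\<forall>\<^sub>F j in sequentially. Lp_norm r (\<lambda>x. K (u j) x - K f x) \<le> C * Lp_norm p (\<lambda>x. u j x - f x)"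
      using u f by (intro always_eventually allI lip) auto
  qed simp
qed

text \<open>A Schwartz function that lies outside \<open>Lp p\<close> is mapped to its convolution, so the condition on
  Schwartz functions holds for it by definition; continuity concerns only functions in \<open>Lp p\<close>.\<close>

lemma Cnv_extension_exists:
  fixes k :: "(real^'n::finite \<Rightarrow> complex) \<Rightarrow> complex"
  assumes p: "1 \<le> p" and r: "1 \<le> r" and k: "k \<in> Cnv p r"
  shows "\<exists>K. continuous_Lp p r K \<and> (\<forall>f\<in>schwartz. AE x in lebesgue. K f x = dist_conv k f x)"
proof -
  from CnvD[OF k] obtain C where C: "0 \<le> C" "tempered_distribution k"
    "\<And>f. f \<in> schwartz \<Longrightarrow> dist_conv k f \<in> Lp r"
    "\<And>f. f \<in> schwartz \<Longrightarrow> Lp_norm r (dist_conv k f) \<le> C * Lp_norm p f" by blast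
  have "\<forall>f. \<exists>F. f \<in> Lp p \<longrightarrow> F \<in> Lp r \<and> (\<forall>g \<in> schwartz \<inter> Lp p.
      Lp_norm r (\<lambda>x. dist_conv k g x - F x) \<le> C * Lp_norm p (\<lambda>x. g x - f x))"
    using Cnv_extension_point[OF p r C(2,1,3,4)] by blast
  then obtain K0 where K0: "\<And>f. f \<in> Lp p \<Longrightarrow> K0 f \<in> Lp r"
    "\<And>f g. f \<in> Lp p \<Longrightarrow> g \<in> schwartz \<Longrightarrow> g \<in> Lp p \<Longrightarrow>
      Lp_norm r (\<lambda>x. dist_conv k g x - K0 f x) \<le> C * Lp_norm p (\<lambda>x. g x - f x)" by (metis IntI)
  define K where "K f = (if f \<in> Lp p then K0 f else dist_conv k f)" for f
  have "continuous_Lp p r K"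
  proof (rule continuous_LpI_Lipschitz[where C = C])
    show "K f \<in> Lp r" if "f \<in> Lp p" for f using that K0 by (simp add: K_def)
    fix f g :: "real^'n \<Rightarrow> complex" assume f: "f \<in> Lp p" and g: "g \<in> Lp p"
    obtain u where u: "\<And>j. u j \<in> schwartz" "\<And>j. u j \<in> Lp p"
      "(\<lambda>j. Lp_norm p (\<lambda>x. u j x - f x)) \<longlonglongrightarrow> 0" using schwartz_approximation[OF p f] by blast
    have "Lp_norm r (\<lambda>x. K0 f x - K0 g x) \<le> C * Lp_norm p (\<lambda>x. f x - g x)"
    proof (rule tendsto_lowerbound)
      show "(\<lambda>j. C * (2 * Lp_norm p (\<lambda>x. u j x - f x) + Lp_norm p (\<lambda>x. f x - g x)))
          \<longlonglongrightarrow> C * Lp_norm p (\<lambda>x. f x - g x)"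
        using tendsto_mult_left[OF tendsto_add[OF tendsto_mult_left[OF u(3), of 2] tendsto_const], of C] by simp
      show "\<forall>\<^sub>F j in sequentially. Lp_norm r (\<lambda>x. K0 f x - K0 g x)
          \<le> C * (2 * Lp_norm p (\<lambda>x. u j x - f x) + Lp_norm p (\<lambda>x. f x - g x))"
      proof (intro always_eventually allI)
        fix j
        have "Lp_norm r (\<lambda>x. K0 f x - K0 g x) \<le> Lp_norm r (\<lambda>x. dist_conv k (u j) x - K0 f x)
            + Lp_norm r (\<lambda>x. dist_conv k (u j) x - K0 g x)"
          using Lp_norm_diff_triangle[OF r K0(1)[OF f] C(3)[OF u(1)] K0(1)[OF g], of j]
            Lp_norm_minus_commute[of r "K0 f"] by simp
        also have "\<dots> \<le> C * Lp_norm p (\<lambda>x. u j x - f x) + C * Lp_norm p (\<lambda>x. u j x - g x)"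
          by (intro add_mono K0 f g u)
        also have "\<dots> \<le> C * Lp_norm p (\<lambda>x. u j x - f x)
            + C * (Lp_norm p (\<lambda>x. u j x - f x) + Lp_norm p (\<lambda>x. f x - g x))"
          by (intro add_left_mono mult_left_mono Lp_norm_diff_triangle p u f g C)
        finally show "Lp_norm r (\<lambda>x. K0 f x - K0 g x)
          \<le> C * (2 * Lp_norm p (\<lambda>x. u j x - f x) + Lp_norm p (\<lambda>x. f x - g x))"
          by (simp add: algebra_simps)
      qed
    qed simp
    then show "Lp_norm r (\<lambda>x. K f x - K g x) \<le> C * Lp_norm p (\<lambda>x. f x - g x)"
      using f g by (simp add: K_def)
  qed
  moreover have "AE x in lebesgue. K f x = dist_conv k f x" if f: "f \<in> schwartz" for f :: "real^'n \<Rightarrow> complex"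
  proof (cases "f \<in> Lp p")
    case True
    have "Lp_norm r (\<lambda>x. dist_conv k f x - K0 f x) \<le> 0" using K0(2)[OF True f True] by simp
    then have "Lp_norm r (\<lambda>x. dist_conv k f x - K0 f x) = 0"
      using Lp_norm_nonneg by (metis antisym)
    from Lp_norm_eq_0[OF _ Lp_diff(1)[OF r C(3)[OF f] K0(1)[OF True]] this] r
    have "AE x in lebesgue. dist_conv k f x - K0 f x = 0" by simp
    then show ?thesis by eventually_elim (simp add: K_def True)
  qed (simp add: K_def)
  ultimately show ?thesis by blast
qed

lemma continuous_LpD:
  fixes K :: "(real^'n::finite \<Rightarrow> complex) \<Rightarrow> real^'n \<Rightarrow> complex"
  assumes "continuous_Lp p r K"
  shows "f \<in> Lp p \<Longrightarrow> K f \<in> Lp r"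
    "f \<in> Lp p \<Longrightarrow> (\<And>j. u j \<in> Lp p) \<Longrightarrow> (\<lambda>j. Lp_norm p (\<lambda>x. u j x - f x)) \<longlonglongrightarrow> 0 \<Longrightarrow>
      (\<lambda>j. Lp_norm r (\<lambda>x. K (u j) x - K f x)) \<longlonglongrightarrow> 0"
  using assms unfolding continuous_Lp_def by blast+

text \<open>Schwartz functions are dense, and limits in a Lebesgue space are unique almost everywhere.\<close>

lemma continuous_Lp_unique:
  fixes K L :: "(real^'n::finite \<Rightarrow> complex) \<Rightarrow> real^'n \<Rightarrow> complex"
  assumes p: "1 \<le> p" and r: "1 \<le> r" and K: "continuous_Lp p r K" and L: "continuous_Lp p r L"
    and eq: "\<And>f. f \<in> schwartz \<Longrightarrow> f \<in> Lp p \<Longrightarrow> AE x in lebesgue. K f x = L f x"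
    and f: "f \<in> Lp p"
  shows "AE x in lebesgue. K f x = L f x"
proof -
  obtain u where u: "\<And>j. u j \<in> schwartz" "\<And>j. u j \<in> Lp p"
    "(\<lambda>j. Lp_norm p (\<lambda>x. u j x - f x)) \<longlonglongrightarrow> 0" using schwartz_approximation[OF p f] by blast
  note KL = continuous_LpD(1)[OF K] and LL = continuous_LpD(1)[OF L]
  have "Lp_norm r (\<lambda>x. K (u j) x - L f x) = Lp_norm r (\<lambda>x. L (u j) x - L f x)" for j
  proof (rule Lp_norm_cong_AE)
    show "AE x in lebesgue. K (u j) x - L f x = L (u j) x - L f x"
      using eq[OF u(1,2), of j] by eventually_elim simp
  qed (rule LpD(1)[OF Lp_diff(1)[OF r KL[OF u(2)] LL[OF f]]] LpD(1)[OF Lp_diff(1)[OF r LL[OF u(2)] LL[OF f]]])+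
  then have "(\<lambda>j. Lp_norm r (\<lambda>x. K (u j) x - L f x)) \<longlonglongrightarrow> 0"
    using continuous_LpD(2)[OF L f u(2,3)] by simp
  then show ?thesis
    using Lp_limit_unique[OF r KL[OF f] LL[OF f] KL[OF u(2)] continuous_LpD(2)[OF K f u(2,3)]] by blast
qed

lemma conv_op:
  fixes k :: "(real^'n::finite \<Rightarrow> complex) \<Rightarrow> complex"
  assumes "\<exists>K. continuous_Lp p r K \<and> (\<forall>f\<in>schwartz. AE x in lebesgue. K f x = dist_conv k f x)"
  shows "continuous_Lp p r (conv_op p r k)"
    "f \<in> schwartz \<Longrightarrow> AE x in lebesgue. conv_op p r k f x = dist_conv k f x"
  using someI_ex[OF assms] unfolding conv_op_def by blast+

section \<open>Translations and reflections\<close>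

text \<open>The case of scaling factors of modulus one in the change of variables formula for affine maps.\<close>

lemma lebesgue_affine_unit:
  fixes a :: "'a::euclidean_space"
  assumes s: "\<bar>s\<bar> = 1"
  shows "(\<lambda>x. a + s *\<^sub>R x) \<in> lebesgue \<rightarrow>\<^sub>M lebesgue" "distr lebesgue lebesgue (\<lambda>x. a + s *\<^sub>R x) = lebesgue"
proof -
  have T: "(\<lambda>x. a + (\<Sum>j\<in>Basis. (s * (x \<bullet> j)) *\<^sub>R j)) = (\<lambda>x. a + s *\<^sub>R x)"
    unfolding scaleR_scaleR[symmetric] scaleR_sum_right[symmetric] euclidean_representation ..
  have s0: "s \<noteq> 0" using s by auto
  show "(\<lambda>x. a + s *\<^sub>R x) \<in> lebesgue \<rightarrow>\<^sub>M lebesgue"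
    using lebesgue_affine_measurable[of "\<lambda>_. s" a, OF s0] unfolding T .
  have "lebesgue = density (distr lebesgue lebesgue (\<lambda>x. a + s *\<^sub>R x)) (\<lambda>_. (\<Prod>j\<in>(Basis::'a set). \<bar>s\<bar>))"
    using lebesgue_affine_euclidean[of "\<lambda>_. s" a, OF s0] unfolding T .
  then show "distr lebesgue lebesgue (\<lambda>x. a + s *\<^sub>R x) = lebesgue"
    using s by (simp add: density_1)
qed

lemma AE_affine:
  fixes a :: "'a::euclidean_space"
  assumes s: "\<bar>s\<bar> = 1" and "AE x in lebesgue. P x"
  shows "AE x in lebesgue. P (a + s *\<^sub>R x)"
  using AE_distrD[OF lebesgue_affine_unit(1)[OF s, of a], of P] assms(2)
  unfolding lebesgue_affine_unit(2)[OF s] by blast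

lemma integral_affine:
  fixes a :: "'a::euclidean_space" and f :: "'a \<Rightarrow> 'b::{banach, second_countable_topology}"
  assumes s: "\<bar>s\<bar> = 1" and f: "f \<in> borel_measurable lebesgue"
  shows "(\<lambda>x. f (a + s *\<^sub>R x)) \<in> borel_measurable lebesgue"
    "(\<integral>x. f (a + s *\<^sub>R x) \<partial>lebesgue) = (\<integral>x. f x \<partial>lebesgue)"
    "integrable lebesgue (\<lambda>x. f (a + s *\<^sub>R x)) \<longleftrightarrow> integrable lebesgue f"
proof -
  note T = lebesgue_affine_unit[OF s, of a]
  show "(\<lambda>x. f (a + s *\<^sub>R x)) \<in> borel_measurable lebesgue"
    using measurable_compose[OF T(1) f] .
  show "(\<integral>x. f (a + s *\<^sub>R x) \<partial>lebesgue) = (\<integral>x. f x \<partial>lebesgue)"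
    using integral_distr[OF T(1) f] unfolding T(2) by simp
  show "integrable lebesgue (\<lambda>x. f (a + s *\<^sub>R x)) \<longleftrightarrow> integrable lebesgue f"
    using integrable_distr_eq[OF T(1) f] unfolding T(2) by simp
qed

lemma Lp_affine:
  fixes f :: "real^'n::finite \<Rightarrow> complex"
  assumes s: "\<bar>s\<bar> = 1" and f: "f \<in> Lp p"
  shows "(\<lambda>x. f (a + s *\<^sub>R x)) \<in> Lp p" "Lp_norm p (\<lambda>x. f (a + s *\<^sub>R x)) = Lp_norm p f"
proof -
  note [measurable] = LpD(1)[OF f]
  have m: "(\<lambda>x. cmod (f x) powr p) \<in> borel_measurable lebesgue" by measurable
  show "(\<lambda>x. f (a + s *\<^sub>R x)) \<in> Lp p"
    using integral_affine(3)[OF s m, of a] integral_affine(1)[OF s LpD(1)[OF f], of a] LpD(2)[OF f]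
    by (simp add: Lp_def)
  show "Lp_norm p (\<lambda>x. f (a + s *\<^sub>R x)) = Lp_norm p f"
    using integral_affine(2)[OF s m, of a] by (simp add: Lp_norm_def)
qed

lemma Lp_translate:
  fixes f :: "real^'n::finite \<Rightarrow> complex"
  assumes f: "f \<in> Lp p"
  shows "(\<lambda>x. f (x - a)) \<in> Lp p" "Lp_norm p (\<lambda>x. f (x - a)) = Lp_norm p f"
  using Lp_affine[of 1, OF _ f, of "-a"] by simp_all

section \<open>Symmetries of the extended convolution operator\<close>

text \<open>Both sides, as functions of \<open>f\<close>, are continuous operators, and they agree on Schwartz functions.\<close>

lemma continuous_Lp_homogeneous:
  fixes K :: "(real^'n::finite \<Rightarrow> complex) \<Rightarrow> real^'n \<Rightarrow> complex"
  assumes p: "1 \<le> p" and r: "1 \<le> r" and K: "continuous_Lp p r K" and k: "tempered_distribution k"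
    and eq: "\<And>f. f \<in> schwartz \<Longrightarrow> AE x in lebesgue. K f x = dist_conv k f x"
    and f: "f \<in> Lp p"
  shows "AE x in lebesgue. K (\<lambda>x. c * f x) x = c * K f x"
proof (rule continuous_Lp_unique[OF p r _ _ _ f])
  have p0: "0 < p" and r0: "0 < r" using p r by auto
  show "continuous_Lp p r (\<lambda>f. K (\<lambda>x. c * f x))" unfolding continuous_Lp_def
  proof (intro conjI ballI allI impI)
    show "K (\<lambda>x. c * f x) \<in> Lp r" if "f \<in> Lp p" for f
      by (rule continuous_LpD(1)[OF K Lp_scale(1)[OF p0 that]])
    fix u :: "nat \<Rightarrow> real^'n \<Rightarrow> complex" and f assume f: "f \<in> Lp p" and u: "\<forall>j. u j \<in> Lp p"
      and lim: "(\<lambda>j. Lp_norm p (\<lambda>x. u j x - f x)) \<longlonglongrightarrow> 0"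
    show "(\<lambda>j. Lp_norm r (\<lambda>x. K (\<lambda>x. c * u j x) x - K (\<lambda>x. c * f x) x)) \<longlonglongrightarrow> 0"
    proof (rule continuous_LpD(2)[OF K Lp_scale(1)[OF p0 f] Lp_scale(1)[OF p0]])
      show "u j \<in> Lp p" for j using u by blast
      have "Lp_norm p (\<lambda>x. c * u j x - c * f x) = cmod c * Lp_norm p (\<lambda>x. u j x - f x)" for j
        using Lp_norm_scale[OF p0, of c "\<lambda>x. u j x - f x"] by (simp add: right_diff_distrib)
      then show "(\<lambda>j. Lp_norm p (\<lambda>x. c * u j x - c * f x)) \<longlonglongrightarrow> 0"
        using tendsto_mult_left[OF lim, of "cmod c"] by simp
    qed
  qed
  show "continuous_Lp p r (\<lambda>f x. c * K f x)" unfolding continuous_Lp_def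
  proof (intro conjI ballI allI impI)
    show "(\<lambda>x. c * K f x) \<in> Lp r" if "f \<in> Lp p" for f
      by (rule Lp_scale(1)[OF r0 continuous_LpD(1)[OF K that]])
    fix u :: "nat \<Rightarrow> real^'n \<Rightarrow> complex" and f assume f: "f \<in> Lp p" and u: "\<forall>j. u j \<in> Lp p"
      and lim: "(\<lambda>j. Lp_norm p (\<lambda>x. u j x - f x)) \<longlonglongrightarrow> 0"
    have "(\<lambda>j. Lp_norm r (\<lambda>x. K (u j) x - K f x)) \<longlonglongrightarrow> 0"
      using u by (intro continuous_LpD(2)[OF K f _ lim]) blast
    moreover have "Lp_norm r (\<lambda>x. c * K (u j) x - c * K f x) = cmod c * Lp_norm r (\<lambda>x. K (u j) x - K f x)" for j
      using Lp_norm_scale[OF r0, of c "\<lambda>x. K (u j) x - K f x"] by (simp add: right_diff_distrib)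
    ultimately show "(\<lambda>j. Lp_norm r (\<lambda>x. c * K (u j) x - c * K f x)) \<longlonglongrightarrow> 0"
      using tendsto_mult_left[of "\<lambda>j. Lp_norm r (\<lambda>x. K (u j) x - K f x)" 0 sequentially "cmod c"] by simp
  qed
  fix f :: "real^'n \<Rightarrow> complex" assume f: "f \<in> schwartz"
  show "AE x in lebesgue. K (\<lambda>x. c * f x) x = c * K f x"
    using eq[OF f] eq[OF schwartz_cmult[OF f, of c]]
    by eventually_elim (simp add: dist_conv_cmult[OF k f])
qed

text \<open>The same uniqueness argument: convolution commutes with translations on Schwartz functions.\<close>

lemma continuous_Lp_translation_invariant:
  fixes K :: "(real^'n::finite \<Rightarrow> complex) \<Rightarrow> real^'n \<Rightarrow> complex"
  assumes p: "1 \<le> p" and r: "1 \<le> r" and K: "continuous_Lp p r K"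
    and eq: "\<And>f. f \<in> schwartz \<Longrightarrow> AE x in lebesgue. K f x = dist_conv k f x"
    and f: "f \<in> Lp p"
  shows "AE x in lebesgue. K (\<lambda>x. f (x - a)) x = K f (x - a)"
proof (rule continuous_Lp_unique[OF p r _ _ _ f])
  show "continuous_Lp p r (\<lambda>f. K (\<lambda>x. f (x - a)))" unfolding continuous_Lp_def
  proof (intro conjI ballI allI impI)
    show "K (\<lambda>x. f (x - a)) \<in> Lp r" if "f \<in> Lp p" for f
      by (rule continuous_LpD(1)[OF K Lp_translate(1)[OF that]])
    fix u :: "nat \<Rightarrow> real^'n \<Rightarrow> complex" and f assume f: "f \<in> Lp p" and u: "\<forall>j. u j \<in> Lp p"
      and lim: "(\<lambda>j. Lp_norm p (\<lambda>x. u j x - f x)) \<longlonglongrightarrow> 0"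
    show "(\<lambda>j. Lp_norm r (\<lambda>x. K (\<lambda>x. u j (x - a)) x - K (\<lambda>x. f (x - a)) x)) \<longlonglongrightarrow> 0"
    proof (rule continuous_LpD(2)[OF K Lp_translate(1)[OF f] Lp_translate(1)])
      show uj: "u j \<in> Lp p" for j using u by blast
      show "(\<lambda>j. Lp_norm p (\<lambda>x. u j (x - a) - f (x - a))) \<longlonglongrightarrow> 0"
        using lim Lp_translate(2)[OF Lp_diff(1)[OF p uj f], of _ a] by simp
    qed
  qed
  show "continuous_Lp p r (\<lambda>f x. K f (x - a))" unfolding continuous_Lp_def
  proof (intro conjI ballI allI impI)
    show "(\<lambda>x. K f (x - a)) \<in> Lp r" if "f \<in> Lp p" for f
      by (rule Lp_translate(1)[OF continuous_LpD(1)[OF K that]])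
    fix u :: "nat \<Rightarrow> real^'n \<Rightarrow> complex" and f assume f: "f \<in> Lp p" and u: "\<forall>j. u j \<in> Lp p"
      and lim: "(\<lambda>j. Lp_norm p (\<lambda>x. u j x - f x)) \<longlonglongrightarrow> 0"
    have uj: "u j \<in> Lp p" for j using u by blast
    show "(\<lambda>j. Lp_norm r (\<lambda>x. K (u j) (x - a) - K f (x - a))) \<longlonglongrightarrow> 0"
      using continuous_LpD(2)[OF K f uj lim]
        Lp_translate(2)[OF Lp_diff(1)[OF r continuous_LpD(1)[OF K uj] continuous_LpD(1)[OF K f]], of _ a] by simp
  qed
  fix f :: "real^'n \<Rightarrow> complex" assume f: "f \<in> schwartz"
  have "AE x in lebesgue. K f (x - a) = dist_conv k f (x - a)"
    using AE_affine[of 1, OF _ eq[OF f], of "-a"] by simp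
  then show "AE x in lebesgue. K (\<lambda>x. f (x - a)) x = K f (x - a)"
    using eq[OF schwartz_translate[OF f, of a]]
    by eventually_elim (simp add: dist_conv_translate)
qed

lemma continuous_Lp_bounded:
  fixes K :: "(real^'n::finite \<Rightarrow> complex) \<Rightarrow> real^'n \<Rightarrow> complex"
  assumes p: "1 \<le> p" and r: "1 \<le> r" and K: "continuous_Lp p r K" and k: "k \<in> Cnv p r"
    and eq: "\<And>f. f \<in> schwartz \<Longrightarrow> AE x in lebesgue. K f x = dist_conv k f x"
  obtains C where "0 \<le> C" "\<And>f. f \<in> Lp p \<Longrightarrow> Lp_norm r (K f) \<le> C * Lp_norm p f"
proof -
  from CnvD[OF k] obtain C where C: "0 \<le> C" "tempered_distribution k"
    "\<And>f. f \<in> schwartz \<Longrightarrow> dist_conv k f \<in> Lp r"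
    "\<And>f. f \<in> schwartz \<Longrightarrow> Lp_norm r (dist_conv k f) \<le> C * Lp_norm p f" by blast
  have "Lp_norm r (K f) \<le> C * Lp_norm p f" if f: "f \<in> Lp p" for f
  proof -
    obtain u where u: "\<And>j. u j \<in> schwartz" "\<And>j. u j \<in> Lp p"
      "(\<lambda>j. Lp_norm p (\<lambda>x. u j x - f x)) \<longlonglongrightarrow> 0" using schwartz_approximation[OF p f] by blast
    note KL = continuous_LpD(1)[OF K]
    have le: "Lp_norm r (K (u j)) \<le> C * Lp_norm p (u j)" for j
      using C(4)[OF u(1), of j]
        Lp_norm_cong_AE[where p = r, OF LpD(1)[OF KL[OF u(2)[of j]]] LpD(1)[OF C(3)[OF u(1)]] eq[OF u(1)]] by simp
    show ?thesis
    proof (rule LIMSEQ_le)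
      show "(\<lambda>j. Lp_norm r (K (u j))) \<longlonglongrightarrow> Lp_norm r (K f)"
        by (rule Lp_norm_tendsto[OF r KL[OF f] KL[OF u(2)] continuous_LpD(2)[OF K f u(2,3)]])
      show "(\<lambda>j. C * Lp_norm p (u j)) \<longlonglongrightarrow> C * Lp_norm p f"
        by (rule tendsto_mult_left[OF Lp_norm_tendsto[OF p f u(2,3)]])
      show "\<exists>N. \<forall>n\<ge>N. Lp_norm r (K (u n)) \<le> C * Lp_norm p (u n)" using le by blast
    qed
  qed
  from that[OF C(1) this] show thesis .
qed

text \<open>Homogeneity extends the bound from the unit ball. Dividing \<open>f\<close> by numbers larger than its norm, and
  letting them tend to the norm, includes functions of norm zero.\<close>

lemma op_norm_bound:
  fixes K :: "(real^'n::finite \<Rightarrow> complex) \<Rightarrow> real^'n \<Rightarrow> complex"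
  assumes p: "1 \<le> p" and r: "1 \<le> r" and KL: "\<And>f. f \<in> Lp p \<Longrightarrow> K f \<in> Lp r"
    and hom: "\<And>c f. f \<in> Lp p \<Longrightarrow> AE x in lebesgue. K (\<lambda>x. c * f x) x = c * K f x"
    and M: "0 \<le> M" "op_norm p r K \<le> ennreal M"
    and f: "f \<in> Lp p"
  shows "Lp_norm r (K f) \<le> M * Lp_norm p f"
proof -
  have p0: "0 < p" and r0: "0 < r" using p r by auto
  have unit: "Lp_norm r (K g) \<le> M" if "g \<in> Lp p" "Lp_norm p g \<le> 1" for g
  proof -
    have "ennreal (Lp_norm r (K g)) \<le> op_norm p r K"
      unfolding op_norm_def using that by (intro SUP_upper) auto
    also note M(2)
    finally show ?thesis using M(1) by simp
  qed
  \<comment> \<open>the bound with any number above the norm of \<open>f\<close> in place of the norm\<close>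
  have *: "Lp_norm r (K f) \<le> t * M" if t: "Lp_norm p f < t" for t
  proof -
    have t0: "0 < t" using t Lp_norm_nonneg[of p f] by linarith
    define c where "c = complex_of_real (1 / t)"
    have cn: "cmod c = 1 / t" using t0 by (simp add: c_def norm_divide)
    have cf: "(\<lambda>x. c * f x) \<in> Lp p" "Lp_norm p (\<lambda>x. c * f x) \<le> 1"
      using Lp_scale[OF p0 f, of c] t t0 by (auto simp: cn)
    have "Lp_norm r (K (\<lambda>x. c * f x)) = Lp_norm r (\<lambda>x. c * K f x)"
      by (rule Lp_norm_cong_AE[OF LpD(1)[OF KL[OF cf(1)]] LpD(1)[OF Lp_scale(1)[OF r0 KL[OF f]]] hom[OF f]])
    also have "\<dots> = (1 / t) * Lp_norm r (K f)" by (simp add: Lp_norm_scale[OF r0] cn)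
    finally have "Lp_norm r (K f) = t * Lp_norm r (K (\<lambda>x. c * f x))" using t0 by simp
    also have "\<dots> \<le> t * M" using unit[OF cf] t0 by (intro mult_left_mono) auto
    finally show ?thesis .
  qed
  show ?thesis
  proof (rule tendsto_lowerbound)
    show "(\<lambda>n. (Lp_norm p f + inverse (real (Suc n))) * M) \<longlonglongrightarrow> M * Lp_norm p f"
      using tendsto_mult_right[OF tendsto_add[OF tendsto_const LIMSEQ_inverse_real_of_nat], of "Lp_norm p f" M]
      by (simp add: mult.commute)
    show "\<forall>\<^sub>F n in sequentially. Lp_norm r (K f) \<le> (Lp_norm p f + inverse (real (Suc n))) * M"
      by (intro always_eventually allI *) simp
  qed simp
qed

section \<open>Convolution with a bounded kernel of bounded support\<close>

lemma AE_lborel_lebesgue: "(AE x in lborel. P x) \<Longrightarrow> (AE x in lebesgue. P x)"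
  by (rule AE_completion)

text \<open>The integrand of a convolution must be jointly measurable in two variables, which composition with
  subtraction guarantees for Borel functions.\<close>

lemma lebesgue_measurable_borel_representative:
  fixes f :: "'a::euclidean_space \<Rightarrow> complex"
  assumes "f \<in> borel_measurable lebesgue"
  obtains g where "g \<in> borel_measurable borel" "AE x in lebesgue. f x = g x"
proof -
  have "(\<lambda>x. Re (f x)) \<in> borel_measurable lebesgue" "(\<lambda>x. Im (f x)) \<in> borel_measurable lebesgue"
    using assms by measurable
  then obtain a b where a: "a \<in> borel_measurable lborel" "AE x in lborel. Re (f x) = a x"
    and b: "b \<in> borel_measurable lborel" "AE x in lborel. Im (f x) = b x"
    using completion_ex_borel_measurable_real by metis
  have "AE x in lborel. f x = Complex (a x) (b x)"
    using a(2) b(2) by eventually_elim (simp add: complex_eq_iff)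
  moreover have "(\<lambda>x. Complex (a x) (b x)) \<in> borel_measurable borel"
    using a(1) b(1) by (simp add: borel_measurable_complex_iff)
  ultimately show thesis using that AE_lborel_lebesgue by blast
qed

text \<open>Placing the translation on the kernel makes the value at \<open>x\<close> the pairing of \<open>f\<close> with a fixed function,
  as weak convergence requires.\<close>

definition kernel_conv :: "(real^'n::finite \<Rightarrow> complex) \<Rightarrow> (real^'n \<Rightarrow> complex) \<Rightarrow> real^'n \<Rightarrow> complex" where
  "kernel_conv h f x = (\<integral>y. h (x - y) * f y \<partial>lebesgue)"

lemma dist_conv_dist_of_fun:
  fixes h f :: "real^'n::finite \<Rightarrow> complex"
  assumes "h \<in> borel_measurable lebesgue" "f \<in> borel_measurable lebesgue"
  shows "dist_conv (dist_of_fun h) f x = kernel_conv h f x"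
proof -
  have "(\<lambda>y. f (x - y)) \<in> borel_measurable lebesgue"
    using integral_affine(1)[of "-1" f x] assms(2) by simp
  then have "(\<lambda>y. h y * f (x - y)) \<in> borel_measurable lebesgue" using assms(1) by measurable
  from integral_affine(2)[of "-1", OF _ this, of x] show ?thesis
    by (simp add: dist_conv_def dist_of_fun_def kernel_conv_def)
qed

locale bounded_kernel =
  fixes h :: "real^'n::finite \<Rightarrow> complex" and R M :: real
  assumes h_meas: "h \<in> borel_measurable lebesgue"
    and h_support: "\<And>x. R < norm x \<Longrightarrow> h x = 0"
    and h_bound: "AE x in lebesgue. cmod (h x) \<le> M"
    and R_pos: "0 < R" and M_nonneg: "0 \<le> M"
begin

lemma h_Lp: assumes "0 < q" shows "h \<in> Lp q"
proof (rule Lp_mono(1)[OF assms Lp_scale(1)[OF assms Lp_indicator_lmeasurable(1)[OF lmeasurable_cball]] h_meas])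
  show "AE x in lebesgue. cmod (h x) \<le> cmod (complex_of_real M * indicator (cball 0 R) x)"
    using h_bound
  proof eventually_elim
    case (elim x)
    then show ?case using h_support[of x] M_nonneg by (cases "norm x \<le> R") (simp_all add: norm_mult)
  qed
qed

lemma reflected_kernel:
  assumes "0 < q"
  shows "(\<lambda>y. h (x - y)) \<in> Lp q" "Lp_norm q (\<lambda>y. h (x - y)) = Lp_norm q h"
  using Lp_affine[of "-1", OF _ h_Lp[OF assms], of x] by simp_all

lemma reflected_kernel_cut:
  "h (x - y) * f y = h (x - y) * (indicator (cball x R) y * f y)"
proof (cases "y \<in> cball x R")
  case False
  then have "h (x - y) = 0" by (intro h_support) (simp add: dist_norm)
  then show ?thesis by simp
qed simp

lemma integrable_kernel_conv:
  assumes p: "1 < p" and f: "f \<in> Lp p"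
  shows "integrable lebesgue (\<lambda>y. h (x - y) * f y)"
proof -
  define q where "q = p / (p - 1)"
  have q: "1 < q" "1 / q + 1 / p = 1" using p by (auto simp: q_def field_simps)
  then have "0 < q" by simp
  from Lp_Hoelder(1)[OF q(1) p q(2) reflected_kernel(1)[OF this] f] show ?thesis .
qed

lemma kernel_conv_add:
  assumes p: "1 < p" and f: "f \<in> Lp p" and g: "g \<in> Lp p"
  shows "kernel_conv h (\<lambda>y. f y + g y) x = kernel_conv h f x + kernel_conv h g x"
  unfolding kernel_conv_def
  using Bochner_Integration.integral_add[OF integrable_kernel_conv[OF p f] integrable_kernel_conv[OF p g]]
  by (simp add: distrib_left)

lemma kernel_conv_diff:
  assumes p: "1 < p" and f: "f \<in> Lp p" and g: "g \<in> Lp p"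
  shows "kernel_conv h (\<lambda>y. f y - g y) x = kernel_conv h f x - kernel_conv h g x"
  unfolding kernel_conv_def
  using Bochner_Integration.integral_diff[OF integrable_kernel_conv[OF p f] integrable_kernel_conv[OF p g]]
  by (simp add: right_diff_distrib)

lemma kernel_conv_cmult: "kernel_conv h (\<lambda>y. c * f y) x = c * kernel_conv h f x"
  unfolding kernel_conv_def by (simp add: mult.left_commute)

lemma kernel_conv_eq_0:
  assumes "\<And>y. y \<in> cball x R \<Longrightarrow> f y = 0"
  shows "kernel_conv h f x = 0"
proof -
  have "h (x - y) * f y = 0" for y
    using reflected_kernel_cut[of x y f] assms[of y] by (cases "y \<in> cball x R") simp_all
  then have "(\<lambda>y. h (x - y) * f y) = (\<lambda>y. 0)" by (rule ext)
  then show ?thesis unfolding kernel_conv_def by simp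
qed

text \<open>Hoelder's inequality against the reflected kernel; the value at \<open>x\<close> sees only the part of \<open>f\<close> in the
  ball of radius \<open>R\<close> around \<open>x\<close>.\<close>

lemma kernel_conv_pointwise:
  assumes p: "1 < p" and q: "1 / q + 1 / p = 1" and f: "f \<in> Lp p"
  shows "cmod (kernel_conv h f x) \<le> Lp_norm q h * Lp_norm p (\<lambda>y. indicator (cball x R) y * f y)"
proof -
  have q1: "1 < q"
  proof -
    have "0 < 1 / p" "1 / p < 1" using p by auto
    with q have "0 < 1 / q" "1 / q < 1" by linarith+
    then show ?thesis by (simp add: divide_less_eq zero_less_divide_iff split: if_splits)
  qed
  have f': "(\<lambda>y. indicator (cball x R) y * f y) \<in> Lp p"
    using p by (intro Lp_indicator(1) f) auto
  have "kernel_conv h f x = (\<integral>y. h (x - y) * (indicator (cball x R) y * f y) \<partial>lebesgue)"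
    unfolding kernel_conv_def by (subst reflected_kernel_cut) (rule refl)
  also have "cmod \<dots> \<le> Lp_norm q (\<lambda>y. h (x - y)) * Lp_norm p (\<lambda>y. indicator (cball x R) y * f y)"
    using q1 by (intro Lp_Hoelder(3) p q reflected_kernel f') auto
  finally show ?thesis using reflected_kernel(2)[of q x] q1 by simp
qed

lemma kernel_conv_measurable:
  assumes f: "f \<in> borel_measurable lebesgue"
  shows "kernel_conv h f \<in> borel_measurable lebesgue"
proof -
  obtain h' where h'[measurable]: "h' \<in> borel_measurable borel" "AE x in lebesgue. h x = h' x"
    using lebesgue_measurable_borel_representative[OF h_meas] by blast
  obtain f' where f'[measurable]: "f' \<in> borel_measurable borel" "AE x in lebesgue. f x = f' x"
    using lebesgue_measurable_borel_representative[OF f] by blast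
  have "kernel_conv h f x = (\<integral>y. h' (x - y) * f' y \<partial>lborel)" for x
  proof -
    have AE: "AE y in lebesgue. h (x - y) = h' (x - y)" using AE_affine[of "-1", OF _ h'(2), of x] by simp
    have "(\<lambda>y. h (x - y)) \<in> borel_measurable lebesgue" using integral_affine(1)[of "-1" h x] h_meas by simp
    then have m: "(\<lambda>y. h (x - y) * f y) \<in> borel_measurable lebesgue" using f by measurable
    have m': "(\<lambda>y. h' (x - y) * f' y) \<in> borel_measurable borel" by measurable
    have "(\<integral>y. h (x - y) * f y \<partial>lebesgue) = (\<integral>y. h' (x - y) * f' y \<partial>lebesgue)"
      using AE f'(2) m m' by (intro integral_cong_AE) (auto intro: measurable_completion)
    also have "\<dots> = (\<integral>y. h' (x - y) * f' y \<partial>lborel)" using m' by (intro integral_completion) simp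
    finally show ?thesis by (simp add: kernel_conv_def)
  qed
  moreover have "(\<lambda>x. \<integral>y. h' (x - y) * f' y \<partial>lborel) \<in> borel_measurable lborel" by measurable
  ultimately have "kernel_conv h f \<in> borel_measurable lborel" by (simp add: fun_eq_iff[symmetric] cong: measurable_cong)
  then show ?thesis by (rule measurable_completion)
qed

end

text \<open>By Tonelli, integrating the local masses over all centres counts every point with weight the volume
  of the ball of radius \<open>R\<close>.\<close>

lemma nn_integral_local_mass:
  fixes f :: "real^'n::finite \<Rightarrow> complex"
  assumes p: "0 < p" and f: "f \<in> Lp p" and R: "0 \<le> R"
  shows "(\<integral>\<^sup>+x. ennreal (Lp_norm p (\<lambda>y. indicator (cball x R) y * f y) powr p) \<partial>lebesgue)
      = ennreal (unit_ball_vol (real CARD('n)) * R ^ CARD('n) * Lp_norm p f powr p)"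
    "(\<lambda>x. Lp_norm p (\<lambda>y. indicator (cball x R) y * f y) powr p) \<in> borel_measurable lebesgue"
proof -
  obtain f' where f'[measurable]: "f' \<in> borel_measurable borel" "AE x in lebesgue. f x = f' x"
    using lebesgue_measurable_borel_representative[OF LpD(1)[OF f]] by blast
  have f'_leb: "f' \<in> borel_measurable lebesgue" using f'(1) by (intro measurable_completion) simp
  have f'L: "f' \<in> Lp p" by (rule Lp_cong_AE(1)[OF f f'_leb f'(2)])
  have f'n: "Lp_norm p f' = Lp_norm p f" by (rule Lp_cong_AE(2)[OF f f'_leb f'(2)])
  define V where "V = unit_ball_vol (real CARD('n)) * R ^ CARD('n)"
  have V: "emeasure lborel (cball y R) = ennreal V" for y :: "real^'n"
    using emeasure_cball[OF R, of y] by (simp add: V_def)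
  have V0: "0 \<le> V" using R by (simp add: V_def)
  have eq: "ennreal (Lp_norm p (\<lambda>y. indicator (cball x R) y * f y) powr p)
      = (\<integral>\<^sup>+y. indicator {y. dist x y \<le> R} y * ennreal (cmod (f' y) powr p) \<partial>lborel)" for x
  proof -
    have L: "(\<lambda>y. indicator (cball x R) y * f y) \<in> Lp p" by (intro Lp_indicator(1) p f) auto
    have "ennreal (Lp_norm p (\<lambda>y. indicator (cball x R) y * f y) powr p)
        = (\<integral>\<^sup>+y. ennreal (cmod (indicator (cball x R) y * f y) powr p) \<partial>lebesgue)"
      unfolding Lp_norm_powr[OF p] using LpD(2)[OF L] by (intro nn_integral_eq_integral[symmetric]) auto
    also have "\<dots> = (\<integral>\<^sup>+y. indicator {y. dist x y \<le> R} y * ennreal (cmod (f' y) powr p) \<partial>lebesgue)"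
    proof (rule nn_integral_cong_AE)
      show "AE y in lebesgue. ennreal (cmod (indicator (cball x R) y * f y) powr p)
          = indicator {y. dist x y \<le> R} y * ennreal (cmod (f' y) powr p)"
        using f'(2)
      proof eventually_elim
        case (elim y)
        then show ?case by (cases "dist x y \<le> R") simp_all
      qed
    qed
    also have "\<dots> = (\<integral>\<^sup>+y. indicator {y. dist x y \<le> R} y * ennreal (cmod (f' y) powr p) \<partial>lborel)"
      by (rule nn_integral_completion)
    finally show ?thesis .
  qed
  have joint: "(\<lambda>(x, y). indicator {y. dist x y \<le> R} y * ennreal (cmod (f' y) powr p) :: ennreal)
      \<in> borel_measurable (lborel \<Otimes>\<^sub>M lborel)"
  proof -
    have "(\<lambda>(x, y). (if dist x y \<le> R then 1 else 0) * ennreal (cmod (f' y) powr p) :: ennreal)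
      \<in> borel_measurable (lborel \<Otimes>\<^sub>M (lborel :: (real^'n) measure))" by measurable
    then show ?thesis by (simp add: indicator_def of_bool_def)
  qed
  have "(\<integral>\<^sup>+x. ennreal (Lp_norm p (\<lambda>y. indicator (cball x R) y * f y) powr p) \<partial>lebesgue)
     = (\<integral>\<^sup>+x. \<integral>\<^sup>+y. indicator {y. dist x y \<le> R} y * ennreal (cmod (f' y) powr p) \<partial>lborel \<partial>lborel)"
    unfolding eq by (rule nn_integral_completion)
  also have "\<dots> = (\<integral>\<^sup>+y. \<integral>\<^sup>+x. indicator {y. dist x y \<le> R} y * ennreal (cmod (f' y) powr p) \<partial>lborel \<partial>lborel)"
    by (rule lborel_pair.Fubini'[OF joint, symmetric])
  also have "\<dots> = (\<integral>\<^sup>+y. ennreal V * ennreal (cmod (f' y) powr p) \<partial>lborel)"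
  proof (rule nn_integral_cong)
    fix y
    have "(\<integral>\<^sup>+x. indicator {y. dist x y \<le> R} y * ennreal (cmod (f' y) powr p) \<partial>lborel)
        = (\<integral>\<^sup>+x. ennreal (cmod (f' y) powr p) * indicator (cball y R) x \<partial>lborel)"
      by (intro nn_integral_cong) (simp add: indicator_def dist_commute)
    also have "\<dots> = ennreal (cmod (f' y) powr p) * emeasure lborel (cball y R)"
      by (rule nn_integral_cmult_indicator) simp
    finally show "(\<integral>\<^sup>+x. indicator {y. dist x y \<le> R} y * ennreal (cmod (f' y) powr p) \<partial>lborel)
        = ennreal V * ennreal (cmod (f' y) powr p)" by (simp add: V mult.commute)
  qed
  also have "\<dots> = ennreal V * (\<integral>\<^sup>+y. ennreal (cmod (f' y) powr p) \<partial>lebesgue)"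
    by (simp add: nn_integral_cmult nn_integral_completion)
  also have "(\<integral>\<^sup>+y. ennreal (cmod (f' y) powr p) \<partial>lebesgue) = ennreal (Lp_norm p f powr p)"
    unfolding f'n[symmetric] Lp_norm_powr[OF p] using LpD(2)[OF f'L] by (intro nn_integral_eq_integral) auto
  finally show "(\<integral>\<^sup>+x. ennreal (Lp_norm p (\<lambda>y. indicator (cball x R) y * f y) powr p) \<partial>lebesgue)
      = ennreal (unit_ball_vol (real CARD('n)) * R ^ CARD('n) * Lp_norm p f powr p)"
    using V0 by (simp add: V_def ennreal_mult)
  have "(\<lambda>x. \<integral>\<^sup>+y. indicator {y. dist x y \<le> R} y * ennreal (cmod (f' y) powr p) \<partial>lborel) \<in> borel_measurable lborel"
    using joint by (intro lborel.borel_measurable_nn_integral) simp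
  then have "(\<lambda>x. ennreal (Lp_norm p (\<lambda>y. indicator (cball x R) y * f y) powr p)) \<in> borel_measurable lborel"
    unfolding eq .
  then have "(\<lambda>x. enn2real (ennreal (Lp_norm p (\<lambda>y. indicator (cball x R) y * f y) powr p))) \<in> borel_measurable lborel"
    by measurable
  then show "(\<lambda>x. Lp_norm p (\<lambda>y. indicator (cball x R) y * f y) powr p) \<in> borel_measurable lebesgue"
    by (intro measurable_completion) simp
qed

context bounded_kernel
begin

text \<open>A bounded kernel of bounded support maps \<open>L\<^sub>p\<close> into \<open>L\<^sub>r\<close> because the local \<open>L\<^sub>p\<close> masses
  control the convolution at each point, are bounded by the total mass, and integrate to a multiple of it.\<close>

lemma kernel_conv_Lp:
  assumes p: "1 < p" and pr: "p \<le> r"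
  shows "\<exists>C\<ge>0. \<forall>f \<in> Lp p. kernel_conv h f \<in> Lp r \<and> Lp_norm r (kernel_conv h f) \<le> C * Lp_norm p f"
proof -
  define q where "q = p / (p - 1)"
  have q: "1 / q + 1 / p = 1" using p by (auto simp: q_def field_simps)
  define A where "A = Lp_norm q h"
  define V where "V = unit_ball_vol (real CARD('n)) * R ^ CARD('n)"
  have p0: "0 < p" and r0: "0 < r" using p pr by auto
  have A0: "0 \<le> A" and V0: "0 \<le> V" using R_pos by (auto simp: A_def V_def)
  have *: "kernel_conv h f \<in> Lp r \<and> Lp_norm r (kernel_conv h f) \<le> (A * V powr (1 / r)) * Lp_norm p f"
    if f: "f \<in> Lp p" for f
  proof -
    let ?K = "kernel_conv h f" and ?N = "Lp_norm p f"
    define G where "G x = Lp_norm p (\<lambda>y. indicator (cball x R) y * f y)" for x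
    have K_meas[measurable]: "?K \<in> borel_measurable lebesgue"
      by (rule kernel_conv_measurable[OF LpD(1)[OF f]])
    have G_le: "G x \<le> ?N" for x unfolding G_def by (intro Lp_indicator(2) p0 f) auto
    have G0: "0 \<le> G x" for x by (simp add: G_def)
    have pt: "cmod (?K x) powr r \<le> A powr r * ?N powr (r - p) * G x powr p" for x
    proof -
      have "cmod (?K x) powr r \<le> (A * G x) powr r"
        using kernel_conv_pointwise[OF p q f, of x] r0 unfolding A_def G_def by (intro powr_mono2) auto
      also have "\<dots> = A powr r * (G x powr (r - p) * G x powr p)"
        using A0 G0[of x] by (simp add: powr_mult powr_add[symmetric])
      also have "\<dots> \<le> A powr r * (?N powr (r - p) * G x powr p)"
        using G_le[of x] G0[of x] pr by (intro mult_left_mono mult_right_mono powr_mono2) auto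
      finally show ?thesis by (simp add: mult.assoc)
    qed
    define B where "B = A powr r * ?N powr (r - p) * (V * ?N powr p)"
    have B: "B = ((A * V powr (1 / r)) * ?N) powr r"
    proof -
      have "?N powr (r - p) * ?N powr p = ?N powr r" by (simp add: powr_add[symmetric])
      then have "B = A powr r * V * ?N powr r" by (simp add: B_def mult_ac)
      then show ?thesis using A0 V0 r0 by (simp add: powr_mult powr_powr)
    qed
    have "(\<integral>\<^sup>+x. ennreal (cmod (?K x) powr r) \<partial>lebesgue)
        \<le> (\<integral>\<^sup>+x. ennreal (A powr r * ?N powr (r - p)) * ennreal (G x powr p) \<partial>lebesgue)"
      using pt by (intro nn_integral_mono) (simp add: ennreal_mult[symmetric] ennreal_leI)
    also have "\<dots> = ennreal (A powr r * ?N powr (r - p)) * (\<integral>\<^sup>+x. ennreal (G x powr p) \<partial>lebesgue)"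
      unfolding G_def using nn_integral_local_mass(2)[OF p0 f less_imp_le[OF R_pos]]
      by (intro nn_integral_cmult) simp
    also have "\<dots> = ennreal B"
      unfolding G_def nn_integral_local_mass(1)[OF p0 f less_imp_le[OF R_pos]]
      using V0 by (simp add: ennreal_mult[symmetric] B_def V_def)
    finally have le: "(\<integral>\<^sup>+x. ennreal (cmod (?K x) powr r) \<partial>lebesgue) \<le> ennreal B" .
    then have i: "integrable lebesgue (\<lambda>x. cmod (?K x) powr r)"
      by (intro integrableI_bounded) (auto simp: le_less_trans)
    have B0: "0 \<le> B" using B by simp
    have "(\<integral>x. cmod (?K x) powr r \<partial>lebesgue) \<le> B"
      using le nn_integral_eq_integral[OF i] B0 by simp
    then have "Lp_norm r ?K \<le> (A * V powr (1 / r)) * ?N"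
      unfolding B using A0 by (subst Lp_norm_le_iff[OF r0]) auto
    with i show ?thesis by (simp add: Lp_def)
  qed
  then show ?thesis using A0 by (intro exI[of _ "A * V powr (1 / r)"]) auto
qed

lemma continuous_Lp_kernel_conv:
  assumes p: "1 < p" and pr: "p \<le> r"
  shows "continuous_Lp p r (kernel_conv h)"
proof -
  obtain C where C: "\<And>f. f \<in> Lp p \<Longrightarrow> kernel_conv h f \<in> Lp r"
    "\<And>f. f \<in> Lp p \<Longrightarrow> Lp_norm r (kernel_conv h f) \<le> C * Lp_norm p f"
    using kernel_conv_Lp[OF p pr] by blast
  show ?thesis
  proof (rule continuous_LpI_Lipschitz[where C = C])
    fix f g :: "real^'n \<Rightarrow> complex" assume f: "f \<in> Lp p" and g: "g \<in> Lp p"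
    have "(\<lambda>x. f x - g x) \<in> Lp p" using p by (intro Lp_diff f g) auto
    from C(2)[OF this] have "Lp_norm r (kernel_conv h (\<lambda>x. f x - g x)) \<le> C * Lp_norm p (\<lambda>x. f x - g x)" .
    moreover have "kernel_conv h (\<lambda>x. f x - g x) = (\<lambda>x. kernel_conv h f x - kernel_conv h g x)"
      by (rule ext) (rule kernel_conv_diff[OF p f g])
    ultimately show "Lp_norm r (\<lambda>x. kernel_conv h f x - kernel_conv h g x) \<le> C * Lp_norm p (\<lambda>x. f x - g x)"
      by simp
  qed (rule C)
qed

end

lemma schwartz_measurable:
  fixes f :: "real^'n::finite \<Rightarrow> complex"
  assumes "f \<in> schwartz" shows "f \<in> borel_measurable lebesgue"
proof -
  have "f differentiable at x" for x
    using smooth_differentiable[OF schwartzD(1)[OF assms], of "[]" x] by simp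
  then have "continuous_on UNIV f"
    by (simp add: continuous_at_imp_continuous_on differentiable_imp_continuous_within)
  then have "f \<in> borel_measurable borel" by (rule borel_measurable_continuous_onI)
  then show ?thesis by (intro measurable_completion) simp
qed

text \<open>On Schwartz functions, convolution with the distribution of \<open>h\<close> is the integral convolution.
  Hence \<open>K - h * _\<close> is a continuous extension of convolution with \<open>k - h\<close>, and uniqueness of the
  extension identifies it with the chosen one.\<close>

lemma conv_op_diff_kernel:
  fixes k :: "(real^'n::finite \<Rightarrow> complex) \<Rightarrow> complex"
  assumes p: "1 < p" and pr: "p \<le> r" and k: "k \<in> Cnv p r" and "bounded_kernel h R M"
  defines "T \<equiv> conv_op p r (\<lambda>\<phi>. k \<phi> - dist_of_fun h \<phi>)"
  shows "continuous_Lp p r T"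
    "f \<in> Lp p \<Longrightarrow> AE x in lebesgue. T f x = conv_op p r k f x - kernel_conv h f x"
proof -
  interpret bounded_kernel h R M by fact
  have p1: "1 \<le> p" and r1: "1 \<le> r" using p pr by auto
  note K = conv_op[OF Cnv_extension_exists[OF p1 r1 k]]
  let ?K = "conv_op p r k"
  let ?D = "\<lambda>f x. ?K f x - kernel_conv h f x"
  note KC = continuous_Lp_kernel_conv[OF p pr]
  have D: "continuous_Lp p r ?D" unfolding continuous_Lp_def
  proof (intro conjI ballI allI impI)
    show "?D f \<in> Lp r" if "f \<in> Lp p" for f
      by (rule Lp_diff(1)[OF r1 continuous_LpD(1)[OF K(1) that] continuous_LpD(1)[OF KC that]])
    fix u :: "nat \<Rightarrow> real^'n \<Rightarrow> complex" and f assume f: "f \<in> Lp p" and u': "\<forall>j. u j \<in> Lp p"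
      and lim: "(\<lambda>j. Lp_norm p (\<lambda>x. u j x - f x)) \<longlonglongrightarrow> 0"
    have u: "u j \<in> Lp p" for j using u' by blast
    have "(\<lambda>j. Lp_norm r (\<lambda>x. ?K (u j) x - ?K f x) + Lp_norm r (\<lambda>x. kernel_conv h (u j) x - kernel_conv h f x)) \<longlonglongrightarrow> 0 + 0"
      by (rule tendsto_add[OF continuous_LpD(2)[OF K(1) f u lim] continuous_LpD(2)[OF KC f u lim]])
    then have l: "(\<lambda>j. Lp_norm r (\<lambda>x. ?K (u j) x - ?K f x) + Lp_norm r (\<lambda>x. kernel_conv h (u j) x - kernel_conv h f x)) \<longlonglongrightarrow> 0"
      by simp
    have b: "Lp_norm r (\<lambda>x. ?D (u j) x - ?D f x)
        \<le> Lp_norm r (\<lambda>x. ?K (u j) x - ?K f x) + Lp_norm r (\<lambda>x. kernel_conv h (u j) x - kernel_conv h f x)" for j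
      using Lp_diff(2)[OF r1 Lp_diff(1)[OF r1 continuous_LpD(1)[OF K(1) u] continuous_LpD(1)[OF K(1) f]]
          Lp_diff(1)[OF r1 continuous_LpD(1)[OF KC u] continuous_LpD(1)[OF KC f]], of j j]
      by (simp add: algebra_simps)
    show "(\<lambda>j. Lp_norm r (\<lambda>x. ?D (u j) x - ?D f x)) \<longlonglongrightarrow> 0"
      by (rule tendsto_sandwich[OF _ _ tendsto_const l]) (simp_all add: b)
  qed
  have Ds: "AE x in lebesgue. ?D f x = dist_conv (\<lambda>\<phi>. k \<phi> - dist_of_fun h \<phi>) f x" if f: "f \<in> schwartz" for f
    using K(2)[OF f]
  proof eventually_elim
    case (elim x)
    then show ?case
      using dist_conv_dist_of_fun[OF h_meas schwartz_measurable[OF f], of x] by (simp add: dist_conv_def)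
  qed
  have ex: "\<exists>K. continuous_Lp p r K \<and> (\<forall>f\<in>schwartz. AE x in lebesgue. K f x = dist_conv (\<lambda>\<phi>. k \<phi> - dist_of_fun h \<phi>) f x)"
    using D Ds by (intro exI[of _ ?D]) blast
  note T = conv_op[OF ex, folded T_def]
  show "continuous_Lp p r T" by (rule T(1))
  assume f: "f \<in> Lp p"
  show "AE x in lebesgue. T f x = ?K f x - kernel_conv h f x"
  proof (rule continuous_Lp_unique[OF p1 r1 T(1) D _ f])
    fix g :: "real^'n \<Rightarrow> complex" assume g: "g \<in> schwartz"
    show "AE x in lebesgue. T g x = ?D g x" using T(2)[OF g] Ds[OF g] by eventually_elim simp
  qed
qed

section \<open>Weak sequential compactness of balls in Lebesgue spaces\<close>

lemma sigma_finite_lebesgue: "sigma_finite_measure (lebesgue :: 'a::euclidean_space measure)"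
proof
  obtain A :: "'a set set" where A: "countable A" "A \<subseteq> sets lborel" "\<Union>A = space lborel"
    "\<forall>a\<in>A. emeasure lborel a \<noteq> \<infinity>"
    using lborel.sigma_finite_countable by blast
  have "emeasure lebesgue a \<noteq> \<infinity>" if "a \<in> A" for a
  proof -
    have "a \<in> sets lborel" using A(2) that by blast
    then have "emeasure lebesgue a = emeasure lborel a" by simp
    then show ?thesis using A(4) that by simp
  qed
  moreover have "A \<subseteq> sets lebesgue" using A(2) sets_completionI_sets by blast
  moreover have "\<Union>A = space (lebesgue :: 'a measure)" using A(3) by simp
  ultimately show "\<exists>A. countable A \<and> A \<subseteq> sets (lebesgue :: 'a measure) \<and> \<Union>A = space lebesgue
      \<and> (\<forall>a\<in>A. emeasure lebesgue a \<noteq> \<infinity>)"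
    using A(1) by blast
qed

lemma integrable_indicator_mult:
  fixes f :: "'a \<Rightarrow> real"
  assumes "integrable M f" "A \<in> sets M"
  shows "integrable M (\<lambda>x. indicator A x * f x)"
  using integrable_mult_indicator[OF assms(2,1)] by simp

lemma integral_indicator_tendsto_0:
  fixes W :: "'a \<Rightarrow> real"
  assumes W: "integrable M W" and A: "\<And>n. A n \<in> sets M" and dec: "decseq A" and empty: "(\<Inter>n. A n) = {}"
  shows "(\<lambda>n. \<integral>x. indicator (A n) x * W x \<partial>M) \<longlonglongrightarrow> 0"
proof -
  have "(\<lambda>n. \<integral>x. indicator (A n) x * W x \<partial>M) \<longlonglongrightarrow> (\<integral>x. 0 \<partial>M)"
  proof (rule integral_dominated_convergence[where w = "\<lambda>x. \<bar>W x\<bar>"])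
    show "AE x in M. (\<lambda>n. indicator (A n) x * W x) \<longlonglongrightarrow> 0"
    proof (intro always_eventually allI)
      fix x
      have "(\<lambda>n. indicator (A n) x :: real) \<longlonglongrightarrow> indicator (\<Inter>n. A n) x"
        by (rule LIMSEQ_indicator_decseq[OF dec])
      then have "(\<lambda>n. indicator (A n) x :: real) \<longlonglongrightarrow> 0" unfolding empty by simp
      from tendsto_mult_right[OF this, of "W x"] show "(\<lambda>n. indicator (A n) x * W x) \<longlonglongrightarrow> 0" by simp
    qed
    show "AE x in M. norm (indicator (A n) x * W x) \<le> \<bar>W x\<bar>" for n
      by (intro always_eventually allI) (simp add: abs_mult mult_left_le_one_le)
    show "(\<lambda>x. indicator (A n) x * W x) \<in> borel_measurable M" for n
      using integrable_indicator_mult[OF W A] by (rule borel_measurable_integrable)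
  qed (use W in auto)
  then show ?thesis by simp
qed

text \<open>A measurable set is approximated from outside by an open set, and an open set from inside by finite
  unions of members of a countable basis. The integrable weight makes the second step possible for
  open sets of infinite measure.\<close>

lemma countable_approximating_family:
  fixes W :: "real^'n::finite \<Rightarrow> real"
  assumes W: "integrable lebesgue W" "\<And>x. 0 \<le> W x" "\<And>x. W x \<le> 1"
  obtains \<F> :: "(real^'n) set set" where "countable \<F>" "\<F> \<subseteq> sets lebesgue"
    "\<And>A e. A \<in> sets lebesgue \<Longrightarrow> 0 < e \<Longrightarrow>
      \<exists>B\<in>\<F>. (\<integral>x. indicator (A - B \<union> (B - A)) x * W x \<partial>lebesgue) < e"
proof -
  obtain Bs :: "(real^'n) set set" where Bs: "countable Bs" "topological_basis Bs"
    using ex_countable_basis by blast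
  define \<F> where "\<F> = Union ` {B. finite B \<and> B \<subseteq> insert {} Bs}"
  have "countable \<F>" unfolding \<F>_def using Bs(1)
    by (intro countable_image countable_Collect_finite_subset) simp
  moreover have openF: "open B" if B: "B \<in> \<F>" for B
  proof -
    obtain B0 where "B = \<Union>B0" "B0 \<subseteq> insert {} Bs" using B unfolding \<F>_def by blast
    then show ?thesis using topological_basis_open[OF Bs(2)] by blast
  qed
  then have FL: "\<F> \<subseteq> sets lebesgue" by (auto intro: lborelD)
  moreover have "\<exists>B\<in>\<F>. (\<integral>x. indicator (A - B \<union> (B - A)) x * W x \<partial>lebesgue) < e"
    if A: "A \<in> sets lebesgue" and e: "0 < e" for A e
  proof -
    have "0 < e / 2" using e by simp
    from sets_lebesgue_outer_open[OF A this] obtain U where U: "open U" "A \<subseteq> U" "U - A \<in> lmeasurable"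
      "emeasure lebesgue (U - A) < ennreal (e / 2)" by blast
    obtain B' where B': "B' \<subseteq> Bs" "\<Union>B' = U" using Bs(2) U(1) unfolding topological_basis_def by blast
    define E where "E = from_nat_into (insert {} B')"
    have rE: "range E = insert {} B'" unfolding E_def
      using countable_subset[OF B'(1) Bs(1)] by (intro range_from_nat_into) auto
    define D where "D n = (\<Union>i\<le>n. E i)" for n :: nat
    have D: "D n \<in> \<F>" for n
    proof -
      have "E ` {..n} \<subseteq> insert {} Bs" using rE B'(1) by blast
      then show ?thesis unfolding \<F>_def D_def by blast
    qed
    have DU: "D n \<subseteq> U" for n
    proof -
      have "E i \<subseteq> U" for i using rE B'(2) by blast
      then show ?thesis unfolding D_def by blast
    qed
    have UL: "U \<in> sets lebesgue" using U(1) by (auto intro: lborelD)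
    have DL: "D n \<in> sets lebesgue" for n using D FL by blast
    have "(\<lambda>n. \<integral>x. indicator (U - D n) x * W x \<partial>lebesgue) \<longlonglongrightarrow> 0"
    proof (rule integral_indicator_tendsto_0[OF W(1)])
      show "U - D n \<in> sets lebesgue" for n using UL DL by blast
      have "D m \<subseteq> D n" if "m \<le> n" for m n
        unfolding D_def using that by (intro UN_mono) auto
      then show "decseq (\<lambda>n. U - D n)" unfolding decseq_def by blast
      have "U = (\<Union>n. E n)" using rE B'(2) by simp
      also have "\<dots> \<subseteq> (\<Union>n. D n)" unfolding D_def by blast
      finally show "(\<Inter>n. U - D n) = {}" by blast
    qed
    from order_tendstoD(2)[OF this \<open>0 < e / 2\<close>] obtain n where
      n: "(\<integral>x. indicator (U - D n) x * W x \<partial>lebesgue) < e / 2"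
      unfolding eventually_sequentially by blast
    have i1: "integrable lebesgue (\<lambda>x. indicator (U - A) x * W x)"
      and i2: "integrable lebesgue (\<lambda>x. indicator (U - D n) x * W x)"
      and i3: "integrable lebesgue (\<lambda>x. indicator (A - D n \<union> (D n - A)) x * W x)"
      using A UL DL by (intro integrable_indicator_mult[OF W(1)]; blast)+
    have "(\<integral>x. indicator (A - D n \<union> (D n - A)) x * W x \<partial>lebesgue)
        \<le> (\<integral>x. indicator (U - A) x * W x + indicator (U - D n) x * W x \<partial>lebesgue)"
    proof (rule integral_mono[OF i3 Bochner_Integration.integrable_add[OF i1 i2]])
      fix x
      have "x \<in> D n \<Longrightarrow> x \<in> U" "x \<in> A \<Longrightarrow> x \<in> U" using DU U(2) by blast+
      then show "indicator (A - D n \<union> (D n - A)) x * W x \<le> indicator (U - A) x * W x + indicator (U - D n) x * W x"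
        using W(2)[of x] by (cases "x \<in> A"; cases "x \<in> D n"; simp)
    qed
    also have "\<dots> = (\<integral>x. indicator (U - A) x * W x \<partial>lebesgue) + (\<integral>x. indicator (U - D n) x * W x \<partial>lebesgue)"
      by (rule Bochner_Integration.integral_add[OF i1 i2])
    also have "(\<integral>x. indicator (U - A) x * W x \<partial>lebesgue) \<le> (\<integral>x. indicator (U - A) x \<partial>lebesgue)"
      using W U(3) i1 by (intro integral_mono) (auto simp: lmeasurable_iff_integrable mult_left_le)
    also have "\<dots> = measure lebesgue (U - A)" using U(3) by (simp add: fmeasurable_def)
    also have "\<dots> < e / 2"
      using U(4) e by (metis U(3) emeasure_eq_measure2 ennreal_less_iff measure_nonneg)
    finally show ?thesis using n D by (intro bexI[of _ "D n"]) auto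
  qed
  ultimately show thesis using that by blast
qed

text \<open>The integrals over the sets of a countable approximating family converge along a subsequence, by a
  diagonal argument. The uniform modulus of absolute continuity extends the convergence to every
  measurable set and makes the limit countably additive. The density of the limit, given by the
  Radon-Nikodym theorem, is the weak limit.\<close>

lemma weak_limit_nonneg:
  fixes a :: "nat \<Rightarrow> real^'n::finite \<Rightarrow> real" and W :: "real^'n \<Rightarrow> real"
  assumes W: "integrable lebesgue W" "\<And>x. 0 \<le> W x" "\<And>x. W x \<le> 1"
    and a: "\<And>j. integrable lebesgue (a j)" "\<And>j x. 0 \<le> a j x"
    and C: "0 \<le> C" and t: "0 < t"
    and bound: "\<And>j A. A \<in> sets lebesgue \<Longrightarrow>
      (\<integral>x. indicator A x * a j x \<partial>lebesgue) \<le> C * (\<integral>x. indicator A x * W x \<partial>lebesgue) powr t"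
  obtains s b where "strict_mono s" "integrable lebesgue b" "\<And>x. 0 \<le> b x"
    "\<And>A. A \<in> sets lebesgue \<Longrightarrow>
      (\<lambda>j. \<integral>x. indicator A x * a (s j) x \<partial>lebesgue) \<longlonglongrightarrow> (\<integral>x. indicator A x * b x \<partial>lebesgue)"
proof -
  let ?I = "\<lambda>j A. \<integral>x. indicator A x * a j x \<partial>lebesgue"
  let ?\<omega> = "\<lambda>A. \<integral>x. indicator A x * W x \<partial>lebesgue"
  have I0: "0 \<le> ?I j A" for j A using a(2) by (intro integral_nonneg_AE) simp
  have \<omega>0: "0 \<le> ?\<omega> A" for A using W(2) by (intro integral_nonneg_AE) simp
  note ai = integrable_indicator_mult[OF a(1)]
  note Wi = integrable_indicator_mult[OF W(1)]
  obtain \<F> :: "(real^'n) set set" where F: "countable \<F>" "\<F> \<subseteq> sets lebesgue"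
    "\<And>A e. A \<in> sets lebesgue \<Longrightarrow> 0 < e \<Longrightarrow> \<exists>B\<in>\<F>. ?\<omega> (A - B \<union> (B - A)) < e"
    using countable_approximating_family[OF W] by blast
  have "norm (?I j A) \<le> C * (\<integral>x. W x \<partial>lebesgue) powr t" if "A \<in> \<F>" for j A
  proof -
    have A: "A \<in> sets lebesgue" using that F(2) by blast
    have "?\<omega> A \<le> (\<integral>x. W x \<partial>lebesgue)"
      using W A by (intro integral_mono Wi) (auto simp: mult_left_le_one_le)
    then have "C * ?\<omega> A powr t \<le> C * (\<integral>x. W x \<partial>lebesgue) powr t"
      using C t \<omega>0[of A] by (intro mult_left_mono powr_mono2) auto
    then show ?thesis using bound[OF A, of j] I0[of A j] by simp
  qed
  from function_convergent_subsequence[of \<F> ?I, OF F(1) this] obtain s where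
    s: "strict_mono s" "\<And>A. A \<in> \<F> \<Longrightarrow> \<exists>l. (\<lambda>j. ?I (s j) A) \<longlonglongrightarrow> l" by blast
  have conv: "convergent (\<lambda>j. ?I (s j) A)" if A: "A \<in> sets lebesgue" for A
  proof (rule Cauchy_convergent, rule CauchyI)
    fix e :: real assume e: "0 < e"
    define \<delta> where "\<delta> = (e / (4 * (C + 1))) powr (1 / t)"
    have \<delta>: "0 < \<delta>" using e C by (simp add: \<delta>_def)
    have \<delta>t: "\<delta> powr t = e / (4 * (C + 1))" using t e C by (simp add: \<delta>_def powr_powr)
    obtain B where B: "B \<in> \<F>" "?\<omega> (A - B \<union> (B - A)) < \<delta>" using F(3)[OF A \<delta>] by blast
    have Bm: "B \<in> sets lebesgue" using B(1) F(2) by blast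
    have AB: "A - B \<union> (B - A) \<in> sets lebesgue" using A Bm by blast
    have close: "\<bar>?I j A - ?I j B\<bar> \<le> e / 4" for j
    proof -
      have "?I j A - ?I j B = (\<integral>x. indicator A x * a j x - indicator B x * a j x \<partial>lebesgue)"
        by (rule Bochner_Integration.integral_diff[symmetric, OF ai[OF A] ai[OF Bm]])
      also have "\<bar>\<dots>\<bar> \<le> (\<integral>x. \<bar>indicator A x * a j x - indicator B x * a j x\<bar> \<partial>lebesgue)"
        by (rule integral_abs_bound)
      also have "\<dots> = ?I j (A - B \<union> (B - A))"
      proof (rule Bochner_Integration.integral_cong[OF refl])
        fix x show "\<bar>indicator A x * a j x - indicator B x * a j x\<bar> = indicator (A - B \<union> (B - A)) x * a j x"
          using a(2)[of j x] by (cases "x \<in> A"; cases "x \<in> B"; simp)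
      qed
      also have "\<dots> \<le> C * ?\<omega> (A - B \<union> (B - A)) powr t" by (rule bound[OF AB])
      also have "\<dots> \<le> C * \<delta> powr t"
        using B(2) \<omega>0 C t by (intro mult_left_mono powr_mono2) auto
      also have "\<dots> \<le> e / 4" unfolding \<delta>t using C e by (simp add: field_simps)
      finally show ?thesis .
    qed
    have "Cauchy (\<lambda>j. ?I (s j) B)" using s(2)[OF B(1)] by (auto intro: LIMSEQ_imp_Cauchy)
    then obtain N where N: "\<And>m n. N \<le> m \<Longrightarrow> N \<le> n \<Longrightarrow> norm (?I (s m) B - ?I (s n) B) < e / 4"
      using e CauchyD[of "\<lambda>j. ?I (s j) B" "e / 4"] by auto
    have "norm (?I (s m) A - ?I (s n) A) < e" if "N \<le> m" "N \<le> n" for m n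
      using close[of "s m"] close[of "s n"] N[OF that] e unfolding real_norm_def by linarith
    then show "\<exists>M. \<forall>m\<ge>M. \<forall>n\<ge>M. norm (?I (s m) A - ?I (s n) A) < e" by blast
  qed
  define \<nu> where "\<nu> A = lim (\<lambda>j. ?I (s j) A)" for A
  have \<nu>: "(\<lambda>j. ?I (s j) A) \<longlonglongrightarrow> \<nu> A" if "A \<in> sets lebesgue" for A
    using conv[OF that] unfolding \<nu>_def by (simp add: convergent_LIMSEQ_iff)
  have \<nu>0: "0 \<le> \<nu> A" if "A \<in> sets lebesgue" for A
    by (rule LIMSEQ_le_const[OF \<nu>[OF that]]) (use I0 in blast)
  have \<nu>_le: "\<nu> A \<le> C * ?\<omega> A powr t" if "A \<in> sets lebesgue" for A
    by (rule LIMSEQ_le_const2[OF \<nu>[OF that]]) (use bound[OF that] in blast)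
  have \<nu>_add: "\<nu> (A \<union> B) = \<nu> A + \<nu> B" if "A \<in> sets lebesgue" "B \<in> sets lebesgue" "A \<inter> B = {}" for A B
  proof (rule LIMSEQ_unique)
    show "(\<lambda>j. ?I (s j) (A \<union> B)) \<longlonglongrightarrow> \<nu> (A \<union> B)" using that by (intro \<nu>) blast
    have "?I j (A \<union> B) = ?I j A + ?I j B" for j
    proof -
      have "(\<lambda>x. indicator (A \<union> B) x * a j x) = (\<lambda>x. indicator A x * a j x + indicator B x * a j x)"
      proof
        fix x show "indicator (A \<union> B) x * a j x = indicator A x * a j x + indicator B x * a j x"
          using that(3) by (cases "x \<in> A"; cases "x \<in> B"; force)
      qed
      then show ?thesis using Bochner_Integration.integral_add[OF ai[OF that(1)] ai[OF that(2)]] by simp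
    qed
    then show "(\<lambda>j. ?I (s j) (A \<union> B)) \<longlonglongrightarrow> \<nu> A + \<nu> B"
      using tendsto_add[OF \<nu>[OF that(1)] \<nu>[OF that(2)]] by simp
  qed
  define N where "N = measure_of UNIV (sets lebesgue) (\<lambda>A. ennreal (\<nu> A))"
  have sets_N: "sets N = sets lebesgue" unfolding N_def
    by (metis sets.sets_measure_of_eq space_completion space_lborel space_borel)
  have \<nu>_empty: "\<nu> {} = 0" using \<nu>_le[of "{}"] \<nu>0[of "{}"] t by simp
  have pos: "positive (sets lebesgue) (\<lambda>A. ennreal (\<nu> A))"
    by (simp add: positive_def \<nu>_empty)
  have "countably_additive (sets (lebesgue :: (real^'n) measure)) (\<lambda>A. ennreal (\<nu> A))"
  proof (rule sets.empty_continuous_imp_countably_additive[OF pos])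
    show "additive (sets lebesgue) (\<lambda>A. ennreal (\<nu> A))"
      unfolding additive_def using \<nu>_add \<nu>0 by (simp add: ennreal_plus[symmetric] del: ennreal_plus)
    fix A :: "nat \<Rightarrow> (real^'n) set"
    assume A: "range A \<subseteq> sets lebesgue" "decseq A" "(\<Inter>i. A i) = {}"
    have Am: "A i \<in> sets lebesgue" for i using A(1) by blast
    have "(\<lambda>i. C * ?\<omega> (A i) powr t) \<longlonglongrightarrow> C * 0 powr t"
      using t \<omega>0 integral_indicator_tendsto_0[OF W(1) Am A(2,3)]
      by (intro tendsto_mult_left tendsto_powr') auto
    then have l: "(\<lambda>i. C * ?\<omega> (A i) powr t) \<longlonglongrightarrow> 0" using t by simp
    have "(\<lambda>i. \<nu> (A i)) \<longlonglongrightarrow> 0"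
      by (rule tendsto_sandwich[OF _ _ tendsto_const l]) (use \<nu>0[OF Am] \<nu>_le[OF Am] in simp_all)
    then show "(\<lambda>i. ennreal (\<nu> (A i))) \<longlonglongrightarrow> 0" using tendsto_ennrealI by fastforce
  qed auto
  then have em: "emeasure N A = ennreal (\<nu> A)" if "A \<in> sets lebesgue" for A
    using that pos sets.space_closed[of "lebesgue :: (real^'n) measure"]
    by (intro emeasure_measure_of[OF N_def]) (auto simp: sets_N)
  have "absolutely_continuous lebesgue N"
    unfolding absolutely_continuous_def
  proof
    fix A :: "(real^'n) set" assume A: "A \<in> null_sets lebesgue"
    then have Am: "A \<in> sets lebesgue" by blast
    have "AE x in lebesgue. x \<notin> A" using A by (rule AE_not_in)
    then have "AE x in lebesgue. indicator A x * W x = 0" by eventually_elim simp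
    then have "?\<omega> A = 0" by (rule integral_eq_zero_AE)
    then have "\<nu> A = 0" using \<nu>_le[OF Am] \<nu>0[OF Am] t by simp
    then show "A \<in> null_sets N" using Am by (simp add: null_sets_def sets_N em)
  qed
  from sigma_finite_measure.Radon_Nikodym[OF sigma_finite_lebesgue this sets_N]
  obtain g where g[measurable]: "g \<in> borel_measurable lebesgue" and gN: "density lebesgue g = N" by blast
  have g_int: "(\<integral>\<^sup>+x. g x * indicator A x \<partial>lebesgue) = ennreal (\<nu> A)" if "A \<in> sets lebesgue" for A
    using em[OF that] emeasure_density[OF g that] gN by simp
  have "(\<integral>\<^sup>+x. g x \<partial>lebesgue) \<noteq> \<infinity>" using g_int[of UNIV] by simp
  then have g_fin: "AE x in lebesgue. g x \<noteq> \<infinity>" using nn_integral_PInf_AE[OF g] by blast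
  define b where "b x = enn2real (g x)" for x
  have b[measurable]: "b \<in> borel_measurable lebesgue" unfolding b_def by measurable
  have b0: "0 \<le> b x" for x by (simp add: b_def)
  have b_nn: "(\<integral>\<^sup>+x. ennreal (indicator A x * b x) \<partial>lebesgue) = ennreal (\<nu> A)" if A: "A \<in> sets lebesgue" for A
  proof -
    have "(\<integral>\<^sup>+x. ennreal (indicator A x * b x) \<partial>lebesgue) = (\<integral>\<^sup>+x. g x * indicator A x \<partial>lebesgue)"
    proof (rule nn_integral_cong_AE)
      show "AE x in lebesgue. ennreal (indicator A x * b x) = g x * indicator A x" using g_fin
      proof eventually_elim
        case (elim x)
        then show ?case by (cases "x \<in> A") (simp_all add: b_def less_top)
      qed
    qed
    then show ?thesis using g_int[OF A] by simp
  qed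
  have bi: "integrable lebesgue b"
    using b_nn[of UNIV] b0 by (intro integrableI_bounded) auto
  have b_int: "(\<integral>x. indicator A x * b x \<partial>lebesgue) = \<nu> A" if A: "A \<in> sets lebesgue" for A
    using nn_integral_eq_integral[OF integrable_indicator_mult[OF bi A]] b_nn[OF A] b0 \<nu>0[OF A] by simp
  show thesis
  proof (rule that[OF s(1) bi b0])
    fix A :: "(real^'n) set" assume A: "A \<in> sets lebesgue"
    show "(\<lambda>j. ?I (s j) A) \<longlonglongrightarrow> (\<integral>x. indicator A x * b x \<partial>lebesgue)"
      unfolding b_int[OF A] by (rule \<nu>[OF A])
  qed
qed

lemma integral_bounded_mult:
  fixes a :: "'a \<Rightarrow> real"
  assumes a: "integrable M a" and G: "G \<in> borel_measurable M" "\<And>x. \<bar>G x\<bar> \<le> B"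
  shows "integrable M (\<lambda>x. G x * a x)" "\<bar>\<integral>x. G x * a x \<partial>M\<bar> \<le> B * (\<integral>x. \<bar>a x\<bar> \<partial>M)"
proof -
  have B: "0 \<le> B" using order_trans[OF abs_ge_zero G(2)] .
  have le: "\<bar>G x * a x\<bar> \<le> B * \<bar>a x\<bar>" for x
    unfolding abs_mult by (intro mult_right_mono G(2)) simp
  have i: "integrable M (\<lambda>x. B * \<bar>a x\<bar>)" using a by simp
  show i2: "integrable M (\<lambda>x. G x * a x)"
    by (rule Bochner_Integration.integrable_bound[OF i])
      (use borel_measurable_times[OF G(1) borel_measurable_integrable[OF a]] le B in \<open>simp_all add: abs_mult\<close>)
  have "\<bar>\<integral>x. G x * a x \<partial>M\<bar> \<le> (\<integral>x. \<bar>G x * a x\<bar> \<partial>M)" by (rule integral_abs_bound)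
  also have "\<dots> \<le> (\<integral>x. B * \<bar>a x\<bar> \<partial>M)" using i i2 by (intro integral_mono le) auto
  finally show "\<bar>\<integral>x. G x * a x \<partial>M\<bar> \<le> B * (\<integral>x. \<bar>a x\<bar> \<partial>M)" by simp
qed

text \<open>Bounded functions are uniform limits of functions with finitely many values, and the total integrals
  of the sequence are bounded.\<close>

lemma set_integrals_imp_bounded_test:
  fixes a :: "nat \<Rightarrow> 'a \<Rightarrow> real" and b G :: "'a \<Rightarrow> real"
  assumes a: "\<And>j. integrable M (a j)" "\<And>j x. 0 \<le> a j x" and b: "integrable M b" "\<And>x. 0 \<le> b x"
    and lim: "\<And>A. A \<in> sets M \<Longrightarrow>
      (\<lambda>j. \<integral>x. indicator A x * a j x \<partial>M) \<longlonglongrightarrow> (\<integral>x. indicator A x * b x \<partial>M)"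
    and G[measurable]: "G \<in> borel_measurable M" and GB: "\<And>x. \<bar>G x\<bar> \<le> B"
  shows "(\<lambda>j. \<integral>x. G x * a j x \<partial>M) \<longlonglongrightarrow> (\<integral>x. G x * b x \<partial>M)"
proof (rule LIMSEQ_I)
  fix e :: real assume e: "0 < e"
  have "(\<lambda>j. \<integral>x. indicator (space M) x * a j x \<partial>M) \<longlonglongrightarrow> (\<integral>x. indicator (space M) x * b x \<partial>M)"
    by (rule lim) simp
  moreover have "(\<integral>x. indicator (space M) x * f x \<partial>M) = (\<integral>x. f x \<partial>M)" for f :: "'a \<Rightarrow> real"
    by (rule Bochner_Integration.integral_cong) auto
  ultimately have total: "(\<lambda>j. \<integral>x. a j x \<partial>M) \<longlonglongrightarrow> (\<integral>x. b x \<partial>M)" by simp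
  then have "Bseq (\<lambda>j. \<integral>x. a j x \<partial>M)" by (rule convergentI[THEN convergent_imp_Bseq])
  then obtain D0 where D0: "\<And>j. \<bar>\<integral>x. a j x \<partial>M\<bar> \<le> D0"
    unfolding Bseq_def real_norm_def by blast
  define D where "D = \<bar>D0\<bar> + (\<integral>x. b x \<partial>M) + 1"
  have bI: "0 \<le> (\<integral>x. b x \<partial>M)" using b(2) by (intro integral_nonneg_AE) simp
  have aD: "(\<integral>x. \<bar>a j x\<bar> \<partial>M) \<le> D" for j using D0[of j] a(2) bI by (simp add: D_def)
  have bD: "(\<integral>x. \<bar>b x\<bar> \<partial>M) \<le> D" using b(2) by (simp add: D_def)
  have D: "0 < D" using bI by (simp add: D_def)
  obtain n :: nat where n: "0 < n" "D / real n < e / 4"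
  proof -
    obtain n where n: "4 * D / e < real n" using reals_Archimedean2 by blast
    have "0 < 4 * D / e" using D e by simp
    with n have n0: "0 < real n" by linarith
    have "4 * D < e * real n" using n e by (simp add: pos_divide_less_eq mult.commute)
    then have "D / real n < e / 4" using n0 by (simp add: pos_divide_less_eq)
    with n0 show thesis using that[of n] by simp
  qed
  \<comment> \<open>rounding the values of \<open>G\<close> down to multiples of \<open>1 / n\<close>\<close>
  define S where "S x = real_of_int \<lfloor>real n * G x\<rfloor> / real n" for x
  define Z where "Z = {\<lfloor>- (real n * B)\<rfloor>..\<lfloor>real n * B\<rfloor>}"
  define A where "A z = {x \<in> space M. \<lfloor>real n * G x\<rfloor> = z}" for z
  have [measurable]: "A z \<in> sets M" for z unfolding A_def by measurable
  have S_meas[measurable]: "S \<in> borel_measurable M" unfolding S_def by measurable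
  have S_close: "\<bar>G x - S x\<bar> \<le> 1 / real n" for x
  proof -
    have "real n * (G x - S x) = real n * G x - real_of_int \<lfloor>real n * G x\<rfloor>"
      using n(1) by (simp add: S_def right_diff_distrib)
    moreover have "real n * G x - real_of_int \<lfloor>real n * G x\<rfloor> \<le> 1" "0 \<le> real n * G x - real_of_int \<lfloor>real n * G x\<rfloor>"
      using floor_correct[of "real n * G x"] by linarith+
    ultimately have "\<bar>real n * (G x - S x)\<bar> \<le> 1" by linarith
    then have "real n * \<bar>G x - S x\<bar> \<le> 1" by (simp add: abs_mult)
    then show ?thesis using n(1) by (simp add: pos_le_divide_eq mult.commute)
  qed
  have S_sum: "S x = (\<Sum>z\<in>Z. real_of_int z / real n * indicator (A z) x)" if x: "x \<in> space M" for x
  proof -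
    have "- (real n * B) \<le> real n * G x" "real n * G x \<le> real n * B"
    proof -
      have "- B \<le> G x" "G x \<le> B" using GB[of x] by linarith+
      from mult_left_mono[OF this(1), of "real n"] mult_left_mono[OF this(2), of "real n"]
      show "- (real n * B) \<le> real n * G x" "real n * G x \<le> real n * B" by simp_all
    qed
    then have zZ: "\<lfloor>real n * G x\<rfloor> \<in> Z" unfolding Z_def by (simp add: floor_mono)
    have "(\<Sum>z\<in>Z. real_of_int z / real n * indicator (A z) x)
        = (\<Sum>z\<in>{\<lfloor>real n * G x\<rfloor>}. real_of_int z / real n * indicator (A z) x)"
    proof (rule sum.mono_neutral_right)
      show "finite Z" by (simp add: Z_def)
      show "{\<lfloor>real n * G x\<rfloor>} \<subseteq> Z" using zZ by blast
      show "\<forall>z\<in>Z - {\<lfloor>real n * G x\<rfloor>}. real_of_int z / real n * indicator (A z) x = 0"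
      proof
        fix z assume "z \<in> Z - {\<lfloor>real n * G x\<rfloor>}"
        then have "x \<notin> A z" by (simp add: A_def)
        then show "real_of_int z / real n * indicator (A z) x = 0" by simp
      qed
    qed
    also have "\<dots> = S x"
    proof -
      have "x \<in> A \<lfloor>real n * G x\<rfloor>" using x by (simp add: A_def)
      then show ?thesis by (simp add: S_def)
    qed
    finally show ?thesis by simp
  qed
  have S_int: "(\<integral>x. S x * f x \<partial>M) = (\<Sum>z\<in>Z. real_of_int z / real n * (\<integral>x. indicator (A z) x * f x \<partial>M))"
    if f: "integrable M f" for f
  proof -
    have "(\<integral>x. S x * f x \<partial>M) = (\<integral>x. (\<Sum>z\<in>Z. real_of_int z / real n * (indicator (A z) x * f x)) \<partial>M)"
      by (intro Bochner_Integration.integral_cong refl) (simp only: S_sum sum_distrib_right mult.assoc)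
    also have "\<dots> = (\<Sum>z\<in>Z. \<integral>x. real_of_int z / real n * (indicator (A z) x * f x) \<partial>M)"
      by (intro Bochner_Integration.integral_sum integrable_mult_right integrable_indicator_mult f) simp
    finally show ?thesis by simp
  qed
  have "(\<lambda>j. \<integral>x. S x * a j x \<partial>M) \<longlonglongrightarrow> (\<integral>x. S x * b x \<partial>M)"
    unfolding S_int[OF a(1)] S_int[OF b(1)] by (intro tendsto_sum tendsto_mult_left lim) simp
  then obtain j0 where j0: "\<And>j. j0 \<le> j \<Longrightarrow> \<bar>(\<integral>x. S x * a j x \<partial>M) - (\<integral>x. S x * b x \<partial>M)\<bar> < e / 4"
  proof -
    assume l: "(\<lambda>j. \<integral>x. S x * a j x \<partial>M) \<longlonglongrightarrow> (\<integral>x. S x * b x \<partial>M)"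
    have "0 < e / 4" using e by simp
    from LIMSEQ_D[OF l this] show thesis using that unfolding real_norm_def by blast
  qed
  have SB: "\<bar>S x\<bar> \<le> B + 1 / real n" for x using S_close[of x] GB[of x] by linarith
  have diff: "\<bar>(\<integral>x. G x * f x \<partial>M) - (\<integral>x. S x * f x \<partial>M)\<bar> \<le> e / 4"
    if f: "integrable M f" and fD: "(\<integral>x. \<bar>f x\<bar> \<partial>M) \<le> D" for f
  proof -
    have "(\<integral>x. G x * f x \<partial>M) - (\<integral>x. S x * f x \<partial>M) = (\<integral>x. G x * f x - S x * f x \<partial>M)"
      by (intro Bochner_Integration.integral_diff[symmetric] integral_bounded_mult(1)[OF f G GB]
          integral_bounded_mult(1)[OF f S_meas SB])
    also have "\<dots> = (\<integral>x. (G x - S x) * f x \<partial>M)" by (simp add: left_diff_distrib)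
    also have "\<bar>\<dots>\<bar> \<le> 1 / real n * (\<integral>x. \<bar>f x\<bar> \<partial>M)"
      by (intro integral_bounded_mult(2)[OF f] S_close) simp
    also have "\<dots> \<le> 1 / real n * D" by (intro mult_left_mono fD) simp
    also have "1 / real n * D = D / real n" by simp
    finally show ?thesis using n(2) by linarith
  qed
  show "\<exists>j0. \<forall>j\<ge>j0. norm ((\<integral>x. G x * a j x \<partial>M) - (\<integral>x. G x * b x \<partial>M)) < e"
  proof (intro exI allI impI)
    fix j assume "j0 \<le> j"
    from j0[OF this] diff[OF a(1) aD, of j] diff[OF b(1) bD] e
    show "norm ((\<integral>x. G x * a j x \<partial>M) - (\<integral>x. G x * b x \<partial>M)) < e"
      unfolding real_norm_def by linarith
  qed
qed

lemma set_integrals_imp_bounded_test_complex: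
  fixes a :: "nat \<Rightarrow> 'a \<Rightarrow> real" and b :: "'a \<Rightarrow> real" and G :: "'a \<Rightarrow> complex"
  assumes a: "\<And>j. integrable M (a j)" "\<And>j x. 0 \<le> a j x" and b: "integrable M b" "\<And>x. 0 \<le> b x"
    and lim: "\<And>A. A \<in> sets M \<Longrightarrow>
      (\<lambda>j. \<integral>x. indicator A x * a j x \<partial>M) \<longlonglongrightarrow> (\<integral>x. indicator A x * b x \<partial>M)"
    and G[measurable]: "G \<in> borel_measurable M" and GB: "\<And>x. cmod (G x) \<le> B"
  shows "(\<lambda>j. \<integral>x. G x * of_real (a j x) \<partial>M) \<longlonglongrightarrow> (\<integral>x. G x * of_real (b x) \<partial>M)"
proof -
  have ReB: "\<bar>Re (G x)\<bar> \<le> B" and ImB: "\<bar>Im (G x)\<bar> \<le> B" for x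
    using abs_Re_le_cmod[of "G x"] abs_Im_le_cmod[of "G x"] GB[of x] by linarith+
  have [measurable]: "(\<lambda>x. Re (G x)) \<in> borel_measurable M" "(\<lambda>x. Im (G x)) \<in> borel_measurable M" by measurable
  have split: "(\<integral>x. G x * of_real (f x) \<partial>M)
      = of_real (\<integral>x. Re (G x) * f x \<partial>M) + \<i> * of_real (\<integral>x. Im (G x) * f x \<partial>M)"
    if f: "integrable M f" for f
  proof -
    have "(\<lambda>x. G x * of_real (f x)) = (\<lambda>x. complex_of_real (Re (G x) * f x) + \<i> * complex_of_real (Im (G x) * f x))"
      by (rule ext) (simp add: complex_eq_iff)
    moreover have "integrable M (\<lambda>x. complex_of_real (Re (G x) * f x))"
      by (intro integrable_of_real integral_bounded_mult(1)[OF f _ ReB]) simp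
    moreover have "integrable M (\<lambda>x. \<i> * complex_of_real (Im (G x) * f x))"
      by (intro integrable_mult_right integrable_of_real integral_bounded_mult(1)[OF f _ ImB]) simp
    ultimately show ?thesis by (simp only: Bochner_Integration.integral_add integral_mult_right_zero integral_complex_of_real)
  qed
  show ?thesis unfolding split[OF a(1)] split[OF b(1)]
    by (intro tendsto_add tendsto_mult_left tendsto_of_real set_integrals_imp_bounded_test[OF a b lim _ ReB]
        set_integrals_imp_bounded_test[OF a b lim _ ImB]) simp_all
qed

text \<open>A positive weight that lies in every Lebesgue space. Multiplied by it, a bounded sequence in \<open>L\<^sub>p\<close>
  becomes uniformly absolutely continuous with respect to a finite measure.\<close>

definition decay_weight :: "real^'n::finite \<Rightarrow> real" where
  "decay_weight x = exp (- norm x)"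

lemma decay_weight_pos: "0 < decay_weight x" by (simp add: decay_weight_def)

lemma decay_weight_measurable[measurable]: "decay_weight \<in> borel_measurable lebesgue"
proof -
  have "decay_weight \<in> borel_measurable (borel :: (real^'a) measure)" unfolding decay_weight_def by measurable
  then show ?thesis by (intro measurable_completion) simp
qed

lemma decay_weight_powr_integrable: "0 < q \<Longrightarrow> integrable lebesgue (\<lambda>x. decay_weight x powr q)"
  using Lp_exp_norm[of 1 q 1] by (simp add: decay_weight_def)

lemma decay_weight_powr_le_1: "0 < q \<Longrightarrow> decay_weight x powr q \<le> 1"
  by (intro powr_le1) (auto simp: decay_weight_def)

lemma decay_weight_mult_Lp:
  fixes G :: "real^'n::finite \<Rightarrow> complex"
  assumes q: "0 < q" and G: "G \<in> borel_measurable lebesgue" "\<And>x. cmod (G x) \<le> B"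
  shows "(\<lambda>x. G x * of_real (decay_weight x)) \<in> Lp q"
proof -
  have 1: "(\<lambda>x. complex_of_real (decay_weight x)) \<in> Lp q"
    using decay_weight_powr_integrable[OF q] by (simp add: Lp_def abs_of_pos[OF decay_weight_pos])
  have m: "(\<lambda>x. G x * of_real (decay_weight x)) \<in> borel_measurable lebesgue" using G(1) by measurable
  show ?thesis
  proof (rule Lp_mono(1)[OF q Lp_scale(1)[OF q 1, of "of_real B"] m])
    have B: "0 \<le> B" using order_trans[OF norm_ge_zero G(2)] .
    show "AE x in lebesgue. cmod (G x * of_real (decay_weight x)) \<le> cmod (of_real B * of_real (decay_weight x))"
      using G(2) B by (intro always_eventually allI) (simp add: norm_mult mult_right_mono)
  qed
qed

text \<open>For \<open>\<zeta> = 1, -1, -\<i>, \<i>\<close> these are the four nonnegative parts of a complex number.\<close>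

definition rotated_part :: "complex \<Rightarrow> complex \<Rightarrow> real" where
  "rotated_part \<zeta> z = max 0 (Re (\<zeta> * z))"

lemma rotated_part_bounds:
  assumes "cmod \<zeta> = 1" shows "0 \<le> rotated_part \<zeta> z" "rotated_part \<zeta> z \<le> cmod z"
  using complex_Re_le_cmod[of "\<zeta> * z"] assms by (auto simp: rotated_part_def norm_mult)

lemma rotated_part_measurable[measurable]: "rotated_part \<zeta> \<in> borel_measurable borel"
  unfolding rotated_part_def by measurable

lemma rotated_part_decomposition:
  "of_real (rotated_part 1 z) - of_real (rotated_part (-1) z)
    + \<i> * (of_real (rotated_part (-\<i>) z) - of_real (rotated_part \<i> z)) = z"
  by (simp add: rotated_part_def complex_eq_iff max_def)

text \<open>Weak limits persist under passing to subsequences, so the parts can be treated one after the other.\<close>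

lemma rotated_parts_weak_limit:
  fixes u :: "nat \<Rightarrow> real^'n::finite \<Rightarrow> complex"
  assumes p: "1 < p" "1 < q" "1/p + 1/q = 1" and u: "\<And>j. u j \<in> Lp p" "\<And>j. Lp_norm p (u j) \<le> C"
    and Z: "finite Z" "\<forall>\<zeta>\<in>Z. cmod \<zeta> = 1"
  shows "\<exists>s. strict_mono (s :: nat \<Rightarrow> nat) \<and> (\<forall>\<zeta>\<in>Z. \<exists>b. integrable lebesgue b \<and> (\<forall>x. 0 \<le> b x) \<and>
      (\<forall>A\<in>sets lebesgue. (\<lambda>j. \<integral>x. indicator A x * (rotated_part \<zeta> (u (s j) x) * decay_weight x) \<partial>lebesgue)
        \<longlonglongrightarrow> (\<integral>x. indicator A x * b x \<partial>lebesgue)))"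
  using Z
proof (induction Z rule: finite_induct)
  case empty
  show ?case by (intro exI[of _ "\<lambda>x. x"]) (auto simp: strict_mono_def)
next
  case (insert \<zeta> Z)
  have "\<forall>\<eta>\<in>Z. cmod \<eta> = 1" using insert.prems by simp
  from insert.IH[OF this] obtain s where s: "strict_mono (s :: nat \<Rightarrow> nat)"
    "\<forall>\<eta>\<in>Z. \<exists>b. integrable lebesgue b \<and> (\<forall>x. 0 \<le> b x) \<and>
      (\<forall>A\<in>sets lebesgue. (\<lambda>j. \<integral>x. indicator A x * (rotated_part \<eta> (u (s j) x) * decay_weight x) \<partial>lebesgue)
        \<longlonglongrightarrow> (\<integral>x. indicator A x * b x \<partial>lebesgue))" by (elim exE conjE) (rule that, assumption+)
  have \<zeta>: "cmod \<zeta> = 1" using insert.prems by simp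
  have q0: "0 < q" using p by simp
  have C: "0 \<le> C" using order_trans[OF Lp_norm_nonneg u(2)] .
  define a where "a j x = rotated_part \<zeta> (u (s j) x) * decay_weight x" for j x
  have [measurable]: "u j \<in> borel_measurable lebesgue" for j by (rule LpD(1)[OF u(1)])
  have am[measurable]: "a j \<in> borel_measurable lebesgue" for j unfolding a_def by measurable
  have a0: "0 \<le> a j x" for j x
    unfolding a_def using rotated_part_bounds(1)[OF \<zeta>] decay_weight_pos[of x] by simp
  let ?w = "\<lambda>A x. indicator A x * complex_of_real (decay_weight x)"
  have wL: "?w A \<in> Lp q" if "A \<in> sets lebesgue" for A
    using that by (intro decay_weight_mult_Lp[where B = 1] q0 borel_measurable_indicator) (simp_all add: indicator_def)
  have wn: "Lp_norm q (?w A) = (\<integral>x. indicator A x * decay_weight x powr q \<partial>lebesgue) powr (1 / q)" for A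
  proof -
    have "(\<lambda>x. cmod (?w A x) powr q) = (\<lambda>x. indicator A x * decay_weight x powr q)"
    proof
      fix x show "cmod (?w A x) powr q = indicator A x * decay_weight x powr q"
        using decay_weight_pos[of x] by (cases "x \<in> A") (simp_all add: norm_mult)
    qed
    then show ?thesis by (simp add: Lp_norm_def)
  qed
  have le: "indicator A x * a j x \<le> cmod (u (s j) x * ?w A x)" for A j x
    using rotated_part_bounds[OF \<zeta>, of "u (s j) x"] decay_weight_pos[of x]
    by (cases "x \<in> A") (simp_all add: a_def norm_mult mult_right_mono)
  have H: "integrable lebesgue (\<lambda>x. u (s j) x * ?w A x)"
    "(\<integral>x. cmod (u (s j) x * ?w A x) \<partial>lebesgue) \<le> Lp_norm p (u (s j)) * Lp_norm q (?w A)"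
    if "A \<in> sets lebesgue" for A j
    using Lp_Hoelder(1,2)[OF p u(1)[of "s j"] wL[OF that]] by auto
  have ai: "integrable lebesgue (a j)" for j
  proof (rule Bochner_Integration.integrable_bound[OF integrable_norm[OF H(1)[of UNIV j]] am])
    show "AE x in lebesgue. norm (a j x) \<le> norm (cmod (u (s j) x * ?w UNIV x))"
      using le[of UNIV _ j] a0 by (intro always_eventually allI) simp
  qed simp
  have bnd: "(\<integral>x. indicator A x * a j x \<partial>lebesgue)
        \<le> C * (\<integral>x. indicator A x * decay_weight x powr q \<partial>lebesgue) powr (1 / q)"
    if A: "A \<in> sets lebesgue" for j A
  proof -
    have "(\<integral>x. indicator A x * a j x \<partial>lebesgue) \<le> (\<integral>x. cmod (u (s j) x * ?w A x) \<partial>lebesgue)"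
      by (intro integral_mono integrable_indicator_mult ai A integrable_norm H(1) le)
    also have "\<dots> \<le> Lp_norm p (u (s j)) * Lp_norm q (?w A)" by (rule H(2)[OF A])
    also have "\<dots> \<le> C * Lp_norm q (?w A)" by (intro mult_right_mono u(2)) simp
    finally show ?thesis unfolding wn .
  qed
  have t: "0 < 1 / q" using q0 by simp
  obtain s' b where s': "strict_mono s'" "integrable lebesgue b" "\<And>x. 0 \<le> b x"
    "\<And>A. A \<in> sets lebesgue \<Longrightarrow>
      (\<lambda>j. \<integral>x. indicator A x * a (s' j) x \<partial>lebesgue) \<longlonglongrightarrow> (\<integral>x. indicator A x * b x \<partial>lebesgue)"
    by (rule weak_limit_nonneg[where a = a, OF decay_weight_powr_integrable[OF q0] powr_ge_zero
          decay_weight_powr_le_1[OF q0] ai a0 C t bnd]) (assumption, rule that)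
  show ?case
  proof (intro exI[of _ "s \<circ> s'"] conjI ballI)
    show "strict_mono (s \<circ> s')" using s(1) s'(1) by (rule strict_mono_o)
    fix \<eta> assume "\<eta> \<in> insert \<zeta> Z"
    then consider "\<eta> = \<zeta>" | "\<eta> \<in> Z" by blast
    then show "\<exists>b. integrable lebesgue b \<and> (\<forall>x. 0 \<le> b x) \<and>
      (\<forall>A\<in>sets lebesgue. (\<lambda>j. \<integral>x. indicator A x * (rotated_part \<eta> (u ((s \<circ> s') j) x) * decay_weight x) \<partial>lebesgue)
        \<longlonglongrightarrow> (\<integral>x. indicator A x * b x \<partial>lebesgue))"
    proof cases
      case 1
      show ?thesis unfolding 1 comp_def
        using s'(4)[unfolded a_def] by (intro exI[of _ b] conjI allI ballI s'(2,3))
    next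
      case 2
      from bspec[OF s(2) 2] obtain c where c: "integrable lebesgue c" "\<forall>x. 0 \<le> c x"
        "\<And>A. A \<in> sets lebesgue \<Longrightarrow> (\<lambda>j. \<integral>x. indicator A x * (rotated_part \<eta> (u (s j) x) * decay_weight x) \<partial>lebesgue)
        \<longlonglongrightarrow> (\<integral>x. indicator A x * c x \<partial>lebesgue)"
        by (elim exE conjE) (rule that, assumption, assumption, erule (1) bspec)
      have "(\<lambda>j. \<integral>x. indicator A x * (rotated_part \<eta> (u ((s \<circ> s') j) x) * decay_weight x) \<partial>lebesgue)
        \<longlonglongrightarrow> (\<integral>x. indicator A x * c x \<partial>lebesgue)" if "A \<in> sets lebesgue" for A
        using LIMSEQ_subseq_LIMSEQ[OF c(3)[OF that] s'(1)] by (simp add: o_def)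
      then show ?thesis using c(1,2) by (intro exI[of _ c] conjI ballI)
    qed
  qed
qed

lemma weak_limit_weighted:
  fixes u :: "nat \<Rightarrow> real^'n::finite \<Rightarrow> complex"
  assumes p: "1 < p" "1 < q" "1/p + 1/q = 1" and u: "\<And>j. u j \<in> Lp p" "\<And>j. Lp_norm p (u j) \<le> C"
  obtains s F where "strict_mono (s :: nat \<Rightarrow> nat)" "integrable lebesgue F"
    "\<And>G B. G \<in> borel_measurable lebesgue \<Longrightarrow> (\<And>x. cmod (G x) \<le> B) \<Longrightarrow>
      (\<lambda>j. \<integral>x. u (s j) x * (G x * of_real (decay_weight x)) \<partial>lebesgue) \<longlonglongrightarrow> (\<integral>x. G x * F x \<partial>lebesgue)"
proof -
  define Z where "Z = {1, -1, \<i>, -\<i>}"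
  have Z0: "finite Z" "\<forall>\<zeta>\<in>Z. cmod \<zeta> = 1" unfolding Z_def by auto
  have Z: "finite Z" "\<And>\<zeta>. \<zeta> \<in> Z \<Longrightarrow> cmod \<zeta> = 1" using Z0 by blast+
  from rotated_parts_weak_limit[where u = u, OF p u Z0] obtain s where s: "strict_mono (s :: nat \<Rightarrow> nat)" and
    "\<forall>\<zeta>\<in>Z. \<exists>b. integrable lebesgue b \<and> (\<forall>x. 0 \<le> b x) \<and>
      (\<forall>A\<in>sets lebesgue. (\<lambda>j. \<integral>x. indicator A x * (rotated_part \<zeta> (u (s j) x) * decay_weight x) \<partial>lebesgue)
        \<longlonglongrightarrow> (\<integral>x. indicator A x * b x \<partial>lebesgue))" by (elim exE conjE) (rule that, assumption+)
  from bchoice[OF this(2)] obtain b where b: "\<forall>\<zeta>\<in>Z. integrable lebesgue (b \<zeta>) \<and> (\<forall>x. 0 \<le> b \<zeta> x) \<and>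
      (\<forall>A\<in>sets lebesgue. (\<lambda>j. \<integral>x. indicator A x * (rotated_part \<zeta> (u (s j) x) * decay_weight x) \<partial>lebesgue)
        \<longlonglongrightarrow> (\<integral>x. indicator A x * b \<zeta> x \<partial>lebesgue))" by (elim exE) (rule that)
  have bi: "integrable lebesgue (b \<zeta>)" and b0: "0 \<le> b \<zeta> x" and
    bl: "\<And>A. A \<in> sets lebesgue \<Longrightarrow> (\<lambda>j. \<integral>x. indicator A x * (rotated_part \<zeta> (u (s j) x) * decay_weight x) \<partial>lebesgue)
        \<longlonglongrightarrow> (\<integral>x. indicator A x * b \<zeta> x \<partial>lebesgue)" if "\<zeta> \<in> Z" for \<zeta> x
    using bspec[OF b that] by simp_all
  define a where "a \<zeta> j x = rotated_part \<zeta> (u (s j) x) * decay_weight x" for \<zeta> j x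
  have [measurable]: "u j \<in> borel_measurable lebesgue" for j by (rule LpD(1)[OF u(1)])
  have q0: "0 < q" using p by simp
  have ai: "integrable lebesgue (a \<zeta> j)" if \<zeta>: "\<zeta> \<in> Z" for \<zeta> j
  proof (rule Bochner_Integration.integrable_bound)
    have "(\<lambda>x. 1 * complex_of_real (decay_weight x)) \<in> Lp q"
      by (rule decay_weight_mult_Lp[OF q0, where B = 1]) simp_all
    then have "(\<lambda>x. complex_of_real (decay_weight x)) \<in> Lp q" by simp
    from Lp_Hoelder(1)[OF p u(1)[of "s j"] this]
    show "integrable lebesgue (\<lambda>x. u (s j) x * complex_of_real (decay_weight x))" .
    show "a \<zeta> j \<in> borel_measurable lebesgue" unfolding a_def by measurable
    show "AE x in lebesgue. norm (a \<zeta> j x) \<le> norm (u (s j) x * complex_of_real (decay_weight x))"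
    proof (intro always_eventually allI)
      fix x
      show "norm (a \<zeta> j x) \<le> norm (u (s j) x * complex_of_real (decay_weight x))"
        using rotated_part_bounds[OF Z(2)[OF \<zeta>], of "u (s j) x"] decay_weight_pos[of x]
        by (simp add: a_def norm_mult abs_mult mult_right_mono)
    qed
  qed
  have a0: "0 \<le> a \<zeta> j x" if \<zeta>: "\<zeta> \<in> Z" for \<zeta> j x
    using rotated_part_bounds(1)[OF Z(2)[OF \<zeta>], of "u (s j) x"] decay_weight_pos[of x] by (simp add: a_def)
  define F where "F x = of_real (b 1 x) - of_real (b (-1) x)
      + \<i> * (of_real (b (-\<i>) x) - of_real (b \<i> x))" for x
  have Zm: "1 \<in> Z" "-1 \<in> Z" "\<i> \<in> Z" "-\<i> \<in> Z" by (simp_all add: Z_def)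
  have Fi: "integrable lebesgue F" unfolding F_def
    by (intro Bochner_Integration.integrable_add Bochner_Integration.integrable_diff integrable_mult_right
        integrable_of_real bi Zm)
  show thesis
  proof (rule that[OF s Fi])
    fix G :: "real^'n \<Rightarrow> complex" and B
    assume G: "G \<in> borel_measurable lebesgue" and GB: "\<And>x. cmod (G x) \<le> B"
    have Gi: "integrable lebesgue (\<lambda>x. G x * of_real (c x))" if c: "integrable lebesgue c" for c
    proof (rule Bochner_Integration.integrable_bound[where f = "\<lambda>x. B * c x"])
      show "integrable lebesgue (\<lambda>x. B * c x)" using c by simp
      show "(\<lambda>x. G x * of_real (c x)) \<in> borel_measurable lebesgue"
        using G borel_measurable_integrable[OF c] by measurable
      have B: "0 \<le> B" using order_trans[OF norm_ge_zero GB] .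
      show "AE x in lebesgue. norm (G x * of_real (c x)) \<le> norm (B * c x)"
        using GB B by (intro always_eventually allI) (simp add: norm_mult abs_mult mult_right_mono)
    qed
    have comb: "(\<integral>x. G x * (of_real (c1 x) - of_real (c2 x) + \<i> * (of_real (c3 x) - of_real (c4 x))) \<partial>lebesgue)
       = (\<integral>x. G x * of_real (c1 x) \<partial>lebesgue) - (\<integral>x. G x * of_real (c2 x) \<partial>lebesgue)
        + \<i> * ((\<integral>x. G x * of_real (c3 x) \<partial>lebesgue) - (\<integral>x. G x * of_real (c4 x) \<partial>lebesgue))"
      if c: "integrable lebesgue c1" "integrable lebesgue c2" "integrable lebesgue c3" "integrable lebesgue c4"
      for c1 c2 c3 c4
    proof -
      have "(\<lambda>x. G x * (of_real (c1 x) - of_real (c2 x) + \<i> * (of_real (c3 x) - of_real (c4 x))))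
        = (\<lambda>x. (G x * of_real (c1 x) - G x * of_real (c2 x)) + \<i> * (G x * of_real (c3 x) - G x * of_real (c4 x)))"
        by (simp add: algebra_simps)
      then show ?thesis
        by (simp only: Bochner_Integration.integral_add Bochner_Integration.integral_diff integral_mult_right_zero
            Bochner_Integration.integrable_diff integrable_mult_right Gi c)
    qed
    have eq: "u (s j) x * (G x * of_real (decay_weight x)) = G x * (of_real (a 1 j x) - of_real (a (-1) j x)
        + \<i> * (of_real (a (-\<i>) j x) - of_real (a \<i> j x)))" for j x
    proof -
      have "of_real (a 1 j x) - of_real (a (-1) j x) + \<i> * (of_real (a (-\<i>) j x) - of_real (a \<i> j x))
          = u (s j) x * of_real (decay_weight x)"
        using arg_cong[OF rotated_part_decomposition[of "u (s j) x"], of "\<lambda>z. z * of_real (decay_weight x)"]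
        unfolding a_def by (simp add: algebra_simps)
      then show ?thesis by (simp add: mult_ac)
    qed
    have lim: "(\<lambda>j. \<integral>x. G x * of_real (a \<zeta> j x) \<partial>lebesgue) \<longlonglongrightarrow> (\<integral>x. G x * of_real (b \<zeta> x) \<partial>lebesgue)"
      if "\<zeta> \<in> Z" for \<zeta>
      by (rule set_integrals_imp_bounded_test_complex[OF ai[OF that] a0[OF that] bi[OF that] b0[OF that] _ G GB])
        (unfold a_def, rule bl[OF that])
    show "(\<lambda>j. \<integral>x. u (s j) x * (G x * of_real (decay_weight x)) \<partial>lebesgue) \<longlonglongrightarrow> (\<integral>x. G x * F x \<partial>lebesgue)"
      unfolding eq F_def comb[OF ai[OF Zm(1)] ai[OF Zm(2)] ai[OF Zm(4)] ai[OF Zm(3)]]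
        comb[OF bi[OF Zm(1)] bi[OF Zm(2)] bi[OF Zm(4)] bi[OF Zm(3)]]
      by (intro tendsto_intros lim Zm)
  qed
qed

text \<open>The weak limit \<open>f\<close> is known at first only through bounded multiples of the weight. Testing with the dual
  function of \<open>f\<close>, cut off so as to be such a multiple, bounds the norm of the cut-off of \<open>f\<close> by \<open>C\<close>, and
  Fatou's lemma removes the cut-off. The multiples of the weight are dense in \<open>L\<^sub>q\<close>, which gives
  convergence for all test functions.\<close>

theorem Lp_weakly_sequentially_compact:
  fixes u :: "nat \<Rightarrow> real^'n::finite \<Rightarrow> complex"
  assumes p: "1 < p" "1 < q" "1/p + 1/q = 1" and u: "\<And>j. u j \<in> Lp p" "\<And>j. Lp_norm p (u j) \<le> C"
  obtains s f where "strict_mono (s :: nat \<Rightarrow> nat)" "f \<in> Lp p" "Lp_norm p f \<le> C"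
    "\<And>g. g \<in> Lp q \<Longrightarrow>
      (\<lambda>j. \<integral>x. u (s j) x * g x \<partial>lebesgue) \<longlonglongrightarrow> (\<integral>x. f x * g x \<partial>lebesgue)"
proof -
  obtain s F where s: "strict_mono (s :: nat \<Rightarrow> nat)" and F: "integrable lebesgue F" and
    lim: "\<And>G B. G \<in> borel_measurable lebesgue \<Longrightarrow> (\<And>x. cmod (G x) \<le> B) \<Longrightarrow>
      (\<lambda>j. \<integral>x. u (s j) x * (G x * of_real (decay_weight x)) \<partial>lebesgue) \<longlonglongrightarrow> (\<integral>x. G x * F x \<partial>lebesgue)"
  proof (rule weak_limit_weighted[where u = u, OF p u])
    fix s F
    assume 1: "strict_mono (s :: nat \<Rightarrow> nat)" and 2: "integrable lebesgue F"
      and 3: "\<And>G B. G \<in> borel_measurable lebesgue \<Longrightarrow> (\<And>x. cmod (G x) \<le> B) \<Longrightarrow>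
        (\<lambda>j. \<integral>x. u (s j) x * (G x * of_real (decay_weight x)) \<partial>lebesgue) \<longlonglongrightarrow> (\<integral>x. G x * F x \<partial>lebesgue)"
    show thesis by (rule that[OF 1 2 3])
  qed
  let ?w = "\<lambda>x. complex_of_real (decay_weight x)"
  have w0: "?w x \<noteq> 0" for x using decay_weight_pos[of x] by simp
  have C: "0 \<le> C" using order_trans[OF Lp_norm_nonneg u(2)] .
  have p0: "0 < p" and q0: "0 < q" using p by auto
  have Fm[measurable]: "F \<in> borel_measurable lebesgue" using F by simp
  define f where "f x = F x / ?w x" for x
  have fm[measurable]: "f \<in> borel_measurable lebesgue" unfolding f_def by measurable
  have Ff: "F x = f x * ?w x" for x using w0[of x] by (simp add: f_def)
  define E where "E m = {x. cmod (f x) \<le> real m \<and> norm x \<le> real m}" for m :: nat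
  have Em[measurable]: "E m \<in> sets lebesgue" for m
  proof -
    have "{x \<in> space lebesgue. cmod (f x) \<le> real m} \<in> sets lebesgue" by measurable
    moreover have "cball 0 (real m) \<in> sets (lebesgue :: (real^'n) measure)" by (intro sets_completionI_sets) simp
    ultimately have "{x \<in> space lebesgue. cmod (f x) \<le> real m} \<inter> cball 0 (real m) \<in> sets lebesgue" by (rule sets.Int)
    also have "{x \<in> space lebesgue. cmod (f x) \<le> real m} \<inter> cball 0 (real m) = E m" by (auto simp: E_def)
    finally show ?thesis .
  qed
  define v where "v m x = indicator (E m) x * f x" for m x
  have vm[measurable]: "v m \<in> borel_measurable lebesgue" for m unfolding v_def by measurable
  have v_Lp: "v m \<in> Lp p" for m
  proof (rule Lp_mono(1)[OF p0 Lp_scale(1)[OF p0 Lp_indicator_lmeasurable(1)[OF lmeasurable_cball]] vm])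
    show "AE x in lebesgue. cmod (v m x) \<le> cmod (complex_of_real (real m) * indicator (cball 0 (real m)) x)"
      by (intro always_eventually allI) (simp add: v_def E_def norm_mult indicator_def)
  qed
  have v_norm: "Lp_norm p (v m) \<le> C" for m
  proof -
    \<comment> \<open>the dual function \<open>cnj (sgn f) * \<bar>f\<bar> powr (p - 1)\<close>, restricted to a set on which \<open>f\<close> and the reciprocal weight are bounded\<close>
    define G where "G x = indicator (E m) x * (cnj (sgn (f x)) * of_real (cmod (f x) powr (p - 1)) / ?w x)" for x
    have "cnj \<in> borel_measurable borel" by (intro borel_measurable_continuous_onI continuous_intros)
    from measurable_compose[OF fm this] have [measurable]: "(\<lambda>x. cnj (f x)) \<in> borel_measurable lebesgue" .
    have Gm[measurable]: "G \<in> borel_measurable lebesgue"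
      unfolding G_def sgn_eq complex_cnj_divide complex_cnj_complex_of_real by measurable
    have GB: "cmod (G x) \<le> real m powr (p - 1) * exp (real m)" for x
    proof (cases "x \<in> E m")
      case True
      then have x: "cmod (f x) \<le> real m" "norm x \<le> real m" by (auto simp: E_def)
      have "cmod (G x) = cmod (sgn (f x)) * (cmod (f x) powr (p - 1) / decay_weight x)"
        using True decay_weight_pos[of x] by (simp add: G_def norm_mult norm_divide)
      also have "\<dots> \<le> 1 * (real m powr (p - 1) * exp (real m))"
      proof (rule mult_mono)
        show "cmod (sgn (f x)) \<le> 1" by (simp add: norm_sgn)
        have "cmod (f x) powr (p - 1) * exp (norm x) \<le> real m powr (p - 1) * exp (real m)"
          using x p by (intro mult_mono powr_mono2) auto
        then show "cmod (f x) powr (p - 1) / decay_weight x \<le> real m powr (p - 1) * exp (real m)"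
          by (simp add: decay_weight_def exp_minus divide_inverse)
      qed (use decay_weight_pos[of x] in simp_all)
      finally show ?thesis by simp
    qed (simp add: G_def)
    have pq: "(p - 1) * q = p" using p by (simp add: field_simps)
    have GF: "G x * F x = of_real (cmod (v m x) powr p)" for x
    proof (cases "x \<in> E m \<and> f x \<noteq> 0")
      case True
      then have "G x * F x = (cnj (sgn (f x)) * f x) * of_real (cmod (f x) powr (p - 1))"
        using w0[of x] by (simp add: G_def Ff)
      also have "cnj (sgn (f x)) * f x = of_real (cmod (f x))"
      proof -
        have "cnj (sgn (f x)) * f x = (f x * cnj (f x)) / of_real (cmod (f x))"
          by (simp add: sgn_eq mult.commute)
        also have "f x * cnj (f x) = of_real ((cmod (f x))\<^sup>2)" by (rule complex_norm_square[symmetric])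
        also have "of_real ((cmod (f x))\<^sup>2) / of_real (cmod (f x)) = complex_of_real (cmod (f x))"
          using True by (simp add: power2_eq_square)
        finally show ?thesis .
      qed
      also have "of_real (cmod (f x)) * of_real (cmod (f x) powr (p - 1)) = complex_of_real (cmod (f x) powr p)"
        using True powr_mult_base[of "cmod (f x)" "p - 1"] by (simp flip: of_real_mult)
      finally show ?thesis using True by (simp add: v_def)
    next
      case False
      then show ?thesis using p0 by (auto simp: G_def v_def Ff)
    qed
    have Gw: "cmod (G x * ?w x) = cmod (v m x) powr (p - 1)" for x
    proof (cases "x \<in> E m \<and> f x \<noteq> 0")
      case True
      then show ?thesis using w0[of x] by (simp add: G_def v_def norm_mult norm_sgn)
    next
      case False
      then show ?thesis using p by (auto simp: G_def v_def)
    qed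
    define I where "I = Lp_norm p (v m)"
    have I0: "0 \<le> I" by (simp add: I_def)
    have Gq: "Lp_norm q (\<lambda>x. G x * ?w x) = I powr (p - 1)"
    proof -
      have "p / q = p - 1" using p by (simp add: field_simps)
      then show ?thesis unfolding Lp_norm_def[of q] Gw powr_powr pq
        using Lp_norm_powr[OF p0, of "v m", symmetric] by (simp add: powr_powr I_def)
    qed
    have GL: "(\<lambda>x. G x * ?w x) \<in> Lp q" by (rule decay_weight_mult_Lp[OF q0 Gm GB])
    have bd: "cmod (\<integral>x. u (s j) x * (G x * ?w x) \<partial>lebesgue) \<le> C * I powr (p - 1)" for j
    proof -
      have "cmod (\<integral>x. u (s j) x * (G x * ?w x) \<partial>lebesgue) \<le> Lp_norm p (u (s j)) * Lp_norm q (\<lambda>x. G x * ?w x)"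
        by (rule Lp_Hoelder(3)[OF p u(1) GL])
      also have "\<dots> \<le> C * I powr (p - 1)" unfolding Gq by (intro mult_right_mono u(2)) simp
      finally show ?thesis .
    qed
    have "cmod (\<integral>x. G x * F x \<partial>lebesgue) \<le> C * I powr (p - 1)"
      by (rule LIMSEQ_le_const2[OF tendsto_norm[OF lim[OF Gm GB]]]) (use bd in blast)
    also have "(\<integral>x. G x * F x \<partial>lebesgue) = of_real (I powr p)"
      unfolding GF I_def Lp_norm_powr[OF p0] by simp
    finally have le: "I powr p \<le> C * I powr (p - 1)" by simp
    show ?thesis
    proof (cases "I = 0")
      case False
      then have I: "0 < I" using I0 by simp
      have "I powr p = I * I powr (p - 1)" using powr_mult_base[OF I0, of "p - 1"] by simp
      with le have "I * I powr (p - 1) \<le> C * I powr (p - 1)" by simp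
      then show ?thesis using I by (simp add: I_def)
    qed (use C in \<open>simp add: I_def\<close>)
  qed
  have v_lim: "(\<lambda>m. v m x) \<longlonglongrightarrow> f x" for x
  proof (rule tendsto_eventually)
    obtain m0 :: nat where "max (cmod (f x)) (norm x) \<le> real m0" using real_arch_simple by blast
    then have "x \<in> E m" if "m0 \<le> m" for m using that by (simp add: E_def)
    then show "\<forall>\<^sub>F m in sequentially. v m x = f x"
      unfolding eventually_sequentially by (intro exI[of _ m0]) (simp add: v_def)
  qed
  have ev: "\<forall>\<^sub>F m in sequentially. Lp_norm p (v m) \<le> C" using v_norm by simp
  have AE: "AE x in lebesgue. (\<lambda>m. v m x) \<longlonglongrightarrow> f x" using v_lim by simp
  note f = Lp_fatou[OF p0 C v_Lp ev fm AE]
  show thesis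
  proof (rule that[OF s f])
    fix g :: "real^'n \<Rightarrow> complex" assume g: "g \<in> Lp q"
    have gm[measurable]: "g \<in> borel_measurable lebesgue" by (rule LpD(1)[OF g])
    \<comment> \<open>truncations of \<open>g\<close> that are bounded multiples of the weight\<close>
    define g' where "g' m x = (if cmod (g x) \<le> real m * decay_weight x then g x else 0)" for m :: nat and x
    have g'm[measurable]: "g' m \<in> borel_measurable lebesgue" for m unfolding g'_def by measurable
    have g'L: "g' m \<in> Lp q" for m
    proof (rule Lp_mono(1)[OF q0 g g'm])
      show "AE x in lebesgue. cmod (g' m x) \<le> cmod (g x)"
        by (intro always_eventually allI) (simp add: g'_def)
    qed
    have g'lim: "(\<lambda>m. Lp_norm q (\<lambda>x. g' m x - g x)) \<longlonglongrightarrow> 0"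
    proof (rule Lp_dominated_convergence[OF q0 gm g'm LpD(2)[OF g]])
      show "AE x in lebesgue. (\<lambda>m. g' m x) \<longlonglongrightarrow> g x"
      proof (intro always_eventually allI)
        fix x
        obtain m0 :: nat where "cmod (g x) / decay_weight x \<le> real m0" using real_arch_simple by blast
        then have m0: "cmod (g x) \<le> real m0 * decay_weight x"
          using decay_weight_pos[of x] by (simp add: pos_divide_le_eq)
        have "cmod (g x) \<le> real m * decay_weight x" if "m0 \<le> m" for m
          using order_trans[OF m0 mult_right_mono[of "real m0" "real m"]] that decay_weight_pos[of x] by simp
        then have "\<forall>\<^sub>F m in sequentially. g' m x = g x"
          unfolding eventually_sequentially by (intro exI[of _ m0]) (simp add: g'_def)
        then show "(\<lambda>m. g' m x) \<longlonglongrightarrow> g x" by (rule tendsto_eventually)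
      qed
      show "AE x in lebesgue. cmod (g' m x - g x) \<le> cmod (g x)" for m
        by (intro always_eventually allI) (simp add: g'_def)
    qed
    have lim': "(\<lambda>j. \<integral>x. u (s j) x * g' m x \<partial>lebesgue) \<longlonglongrightarrow> (\<integral>x. f x * g' m x \<partial>lebesgue)" for m
    proof -
      have m: "(\<lambda>x. g' m x / ?w x) \<in> borel_measurable lebesgue" by measurable
      have bd: "cmod (g' m x / ?w x) \<le> real m" for x
        using decay_weight_pos[of x] by (simp add: g'_def norm_divide pos_divide_le_eq)
      have e1: "g' m x / ?w x * ?w x = g' m x" for x using w0[of x] by simp
      have e2: "g' m x / ?w x * F x = f x * g' m x" for x using w0[of x] by (simp add: Ff)
      show ?thesis using lim[OF m bd] unfolding e1 e2 .
    qed
    have split: "cmod ((\<integral>x. y x * g x \<partial>lebesgue) - (\<integral>x. y x * g' m x \<partial>lebesgue)) \<le> C * Lp_norm q (\<lambda>x. g' m x - g x)"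
      if y: "y \<in> Lp p" "Lp_norm p y \<le> C" for y m
    proof -
      have d: "(\<lambda>x. g x - g' m x) \<in> Lp q" using p by (intro Lp_diff g g'L) simp
      have "(\<integral>x. y x * g x \<partial>lebesgue) - (\<integral>x. y x * g' m x \<partial>lebesgue) = (\<integral>x. y x * g x - y x * g' m x \<partial>lebesgue)"
        by (intro Bochner_Integration.integral_diff[symmetric] Lp_Hoelder(1)[OF p y(1)] g g'L)
      also have "\<dots> = (\<integral>x. y x * (g x - g' m x) \<partial>lebesgue)" by (simp add: right_diff_distrib)
      also have "cmod \<dots> \<le> Lp_norm p y * Lp_norm q (\<lambda>x. g x - g' m x)" by (rule Lp_Hoelder(3)[OF p y(1) d])
      also have "\<dots> \<le> C * Lp_norm q (\<lambda>x. g x - g' m x)" by (intro mult_right_mono y(2)) simp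
      finally show ?thesis by (simp add: Lp_norm_minus_commute[of q g])
    qed
    show "(\<lambda>j. \<integral>x. u (s j) x * g x \<partial>lebesgue) \<longlonglongrightarrow> (\<integral>x. f x * g x \<partial>lebesgue)"
    proof (rule LIMSEQ_I)
      fix e :: real assume e: "0 < e"
      have "(\<lambda>m. C * Lp_norm q (\<lambda>x. g' m x - g x)) \<longlonglongrightarrow> 0" using tendsto_mult_left[OF g'lim, of C] by simp
      then have "\<forall>\<^sub>F m in sequentially. C * Lp_norm q (\<lambda>x. g' m x - g x) < e / 3"
        using e by (intro order_tendstoD(2)) auto
      then obtain m where m: "C * Lp_norm q (\<lambda>x. g' m x - g x) < e / 3"
        unfolding eventually_sequentially by blast
      have "0 < e / 3" using e by simp
      from LIMSEQ_D[OF lim' this] obtain j0 where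
        j0: "\<And>j. j0 \<le> j \<Longrightarrow> cmod ((\<integral>x. u (s j) x * g' m x \<partial>lebesgue) - (\<integral>x. f x * g' m x \<partial>lebesgue)) < e / 3" by blast
      show "\<exists>j0. \<forall>j\<ge>j0. cmod ((\<integral>x. u (s j) x * g x \<partial>lebesgue) - (\<integral>x. f x * g x \<partial>lebesgue)) < e"
      proof (intro exI allI impI)
        fix j assume "j0 \<le> j"
        from j0[OF this] split[OF u(1)[of "s j"] u(2)[of "s j"], of m] split[OF f, of m] m
        show "cmod ((\<integral>x. u (s j) x * g x \<partial>lebesgue) - (\<integral>x. f x * g x \<partial>lebesgue)) < e"
          using norm_triangle_ineq[of "(\<integral>x. u (s j) x * g x \<partial>lebesgue) - (\<integral>x. u (s j) x * g' m x \<partial>lebesgue)"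
              "(\<integral>x. u (s j) x * g' m x \<partial>lebesgue) - (\<integral>x. f x * g x \<partial>lebesgue)"]
            norm_triangle_ineq4[of "(\<integral>x. u (s j) x * g' m x \<partial>lebesgue) - (\<integral>x. f x * g' m x \<partial>lebesgue)"
              "(\<integral>x. f x * g x \<partial>lebesgue) - (\<integral>x. f x * g' m x \<partial>lebesgue)"]
          by simp
      qed
    qed
  qed
qed

section \<open>Mass distributions\<close>

definition cut :: "(real^'n::finite) set \<Rightarrow> (real^'n \<Rightarrow> complex) \<Rightarrow> real^'n \<Rightarrow> complex" where
  "cut A f x = indicator A x * f x"

definition mass :: "real \<Rightarrow> (real^'n::finite \<Rightarrow> complex) \<Rightarrow> (real^'n) set \<Rightarrow> real" where
  "mass p f A = Lp_norm p (cut A f) powr p"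

definition mass_measure :: "real \<Rightarrow> (real^'n::finite \<Rightarrow> complex) \<Rightarrow> (real^'n) measure" where
  "mass_measure p f = density lebesgue (\<lambda>x. ennreal (cmod (f x) powr p))"

lemma cut_Lp:
  fixes f :: "real^'n::finite \<Rightarrow> complex"
  assumes "0 < p" "f \<in> Lp p" "A \<in> sets lebesgue"
  shows "cut A f \<in> Lp p" "Lp_norm p (cut A f) \<le> Lp_norm p f"
  using Lp_indicator[OF assms] unfolding cut_def[abs_def] by auto

lemma Lp_norm_cut:
  assumes "0 < p" shows "Lp_norm p (cut A f) = mass p f A powr (1 / p)"
  using assms by (simp add: mass_def powr_powr)

lemma mass_nonneg: "0 \<le> mass p f A" by (simp add: mass_def)

lemma measure_mass_measure:
  fixes f :: "real^'n::finite \<Rightarrow> complex"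
  assumes p: "0 < p" and f: "f \<in> Lp p" and A: "A \<in> sets lebesgue"
  shows "emeasure (mass_measure p f) A = ennreal (mass p f A)" "measure (mass_measure p f) A = mass p f A"
proof -
  have [measurable]: "f \<in> borel_measurable lebesgue" by (rule LpD(1)[OF f])
  have eq: "ennreal (cmod (f x) powr p) * indicator A x = ennreal (cmod (cut A f x) powr p)" for x
    using p by (cases "x \<in> A") (simp_all add: cut_def)
  have "emeasure (mass_measure p f) A = (\<integral>\<^sup>+x. ennreal (cmod (f x) powr p) * indicator A x \<partial>lebesgue)"
    unfolding mass_measure_def using A by (intro emeasure_density) measurable
  also have "\<dots> = ennreal (\<integral>x. cmod (cut A f x) powr p \<partial>lebesgue)"
    unfolding eq using LpD(2)[OF cut_Lp(1)[OF p f A]] by (intro nn_integral_eq_integral) auto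
  also have "(\<integral>x. cmod (cut A f x) powr p \<partial>lebesgue) = mass p f A"
    unfolding mass_def by (rule Lp_norm_powr[OF p, symmetric])
  finally show *: "emeasure (mass_measure p f) A = ennreal (mass p f A)" .
  show "measure (mass_measure p f) A = mass p f A"
    unfolding measure_def * by (rule enn2real_ennreal[OF mass_nonneg])
qed

lemma sets_mass_measure [simp]: "sets (mass_measure p f) = sets lebesgue" "space (mass_measure p f) = UNIV"
  by (simp_all add: mass_measure_def)

lemma mass_UNIV: "mass p f UNIV = Lp_norm p f powr p"
  by (simp add: mass_def cut_def[abs_def])

lemma prob_space_mass_measure:
  fixes f :: "real^'n::finite \<Rightarrow> complex"
  assumes p: "0 < p" and f: "f \<in> Lp p" "Lp_norm p f = 1"
  shows "prob_space (mass_measure p f)"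
proof
  show "emeasure (mass_measure p f) (space (mass_measure p f)) = 1"
    using measure_mass_measure(1)[OF p f(1), of UNIV] f(2) by (simp add: mass_UNIV)
qed

lemma mass_mono:
  fixes f :: "real^'n::finite \<Rightarrow> complex"
  assumes p: "0 < p" and f: "f \<in> Lp p" "Lp_norm p f = 1"
    and "A \<subseteq> B" "A \<in> sets lebesgue" "B \<in> sets lebesgue"
  shows "mass p f A \<le> mass p f B"
proof -
  interpret prob_space "mass_measure p f" by (rule prob_space_mass_measure[OF p f])
  show ?thesis using finite_measure_mono[of A B] assms
    by (simp add: measure_mass_measure(2)[OF p f(1)])
qed

lemma mass_Un_le:
  fixes f :: "real^'n::finite \<Rightarrow> complex"
  assumes p: "0 < p" and f: "f \<in> Lp p" "Lp_norm p f = 1"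
    and "A \<in> sets lebesgue" "B \<in> sets lebesgue"
  shows "mass p f (A \<union> B) \<le> mass p f A + mass p f B"
proof -
  show ?thesis using measure_Un_le[of A "mass_measure p f" B] assms
    by (simp add: measure_mass_measure(2)[OF p f(1)])
qed

lemma mass_disjoint_le_1:
  fixes f :: "real^'n::finite \<Rightarrow> complex"
  assumes p: "0 < p" and f: "f \<in> Lp p" "Lp_norm p f = 1"
    and "finite I" "\<And>i. i \<in> I \<Longrightarrow> A i \<in> sets lebesgue" "disjoint_family_on A I"
  shows "(\<Sum>i\<in>I. mass p f (A i)) \<le> 1"
proof -
  interpret prob_space "mass_measure p f" by (rule prob_space_mass_measure[OF p f])
  have "(\<Sum>i\<in>I. mass p f (A i)) = (\<Sum>i\<in>I. measure (mass_measure p f) (A i))"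
    using assms by (intro sum.cong refl) (simp add: measure_mass_measure(2)[OF p f(1)])
  also have "\<dots> = measure (mass_measure p f) (\<Union>i\<in>I. A i)"
    using assms by (intro finite_measure_finite_Union[symmetric]) auto
  also have "\<dots> \<le> 1" by (rule prob_le_1)
  finally show ?thesis .
qed

text \<open>Pigeonhole: \<open>n\<close> disjoint slabs share a total mass of at most one.\<close>

lemma exists_light_slab:
  fixes f :: "real^'n::finite \<Rightarrow> complex" and \<xi> :: "real^'n \<Rightarrow> real"
  assumes p: "0 < p" and f: "f \<in> Lp p" "Lp_norm p f = 1"
    and \<xi>: "\<xi> \<in> borel_measurable lebesgue" and n: "0 < n" and W: "0 < W"
  shows "\<exists>m<n. mass p f {x. t + real m * W < \<xi> x \<and> \<xi> x \<le> t + real (Suc m) * W} \<le> 1 / real n"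
proof (rule ccontr)
  let ?S = "\<lambda>m. {x. t + real m * W < \<xi> x \<and> \<xi> x \<le> t + real (Suc m) * W}"
  assume "\<not> (\<exists>m<n. mass p f (?S m) \<le> 1 / real n)"
  then have big: "1 / real n < mass p f (?S m)" if "m < n" for m using that by force
  have Sm: "?S m \<in> sets lebesgue" for m
  proof -
    note [measurable] = \<xi>
    have "{x \<in> space lebesgue. t + real m * W < \<xi> x \<and> \<xi> x \<le> t + real (Suc m) * W} \<in> sets lebesgue" by measurable
    then show ?thesis by simp
  qed
  have disj: "disjoint_family_on ?S {..<n}" unfolding disjoint_family_on_def
  proof (intro ballI impI)
    have *: "?S i \<inter> ?S j = {}" if "i < j" for i j
    proof -
      have "real (Suc i) * W \<le> real j * W" using that W by (intro mult_right_mono) auto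
      then show ?thesis by auto
    qed
    fix i j :: nat assume "i \<noteq> j"
    then show "?S i \<inter> ?S j = {}" using *[of i j] *[of j i] by (cases "i < j") auto
  qed
  have "(\<Sum>m<n. 1 / real n) < (\<Sum>m<n. mass p f (?S m))"
    using n big by (intro sum_strict_mono) auto
  also have "\<dots> \<le> 1" by (rule mass_disjoint_le_1[OF p f _ Sm disj]) simp
  finally show False using n by simp
qed

text \<open>The infimum of the points at which the distribution function is at least \<open>1 / 2\<close>; the function is
  right continuous, and its left limits are the measures of open half-lines.\<close>

lemma real_distribution_median:
  assumes "real_distribution M"
  shows "\<exists>t. measure M {t<..} \<le> 1 / 2 \<and> measure M {..<t} \<le> 1 / 2"
proof -
  interpret real_distribution M by fact
  define S where "S = {s. 1 / 2 \<le> cdf M s}"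
  have "\<forall>\<^sub>F s in at_top. 1 / 2 < cdf M s" using cdf_lim_at_top_prob by (intro order_tendstoD(1)) auto
  then obtain s1 where "1 / 2 < cdf M s1" unfolding eventually_at_top_linorder by blast
  then have ne: "S \<noteq> {}" by (auto simp: S_def intro: less_imp_le)
  have "\<forall>\<^sub>F s in at_bot. cdf M s < 1 / 2" using cdf_lim_at_bot by (intro order_tendstoD(2)) auto
  then obtain s0 where s0: "\<And>s. s \<le> s0 \<Longrightarrow> cdf M s < 1 / 2" unfolding eventually_at_bot_linorder by blast
  have lb: "s0 \<le> s" if "s \<in> S" for s
    using that s0[of s] by (force simp: S_def)
  define t where "t = Inf S"
  have "1 / 2 \<le> cdf M t"
  proof (rule tendsto_lowerbound)
    show "(cdf M \<longlongrightarrow> cdf M t) (at_right t)"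
      using cdf_is_right_cont[of t] by (simp add: continuous_within)
    show "\<forall>\<^sub>F s in at_right t. 1 / 2 \<le> cdf M s"
    proof (rule eventually_at_rightI[of t "t + 1"])
      fix s assume "s \<in> {t<..<t + 1}"
      then have "t < s" by simp
      then obtain s' where "s' \<in> S" "s' < s" unfolding t_def using cInf_lessD[OF ne] by blast
      then show "1 / 2 \<le> cdf M s" using cdf_nondecreasing[of s' s] by (simp add: S_def)
    qed simp
  qed simp
  moreover have "measure M {t<..} = 1 - cdf M t"
  proof -
    have "space M - {..t} = {t<..}" by (auto simp: space_eq_univ)
    then show ?thesis using prob_compl[of "{..t}"] by (simp add: cdf_def)
  qed
  moreover have "measure M {..<t} \<le> 1 / 2"
  proof (rule tendsto_upperbound)
    show "(cdf M \<longlongrightarrow> measure M {..<t}) (at_left t)" by (rule cdf_at_left)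
    show "\<forall>\<^sub>F s in at_left t. cdf M s \<le> 1 / 2"
    proof (rule eventually_at_leftI[of "t - 1"])
      fix s assume "s \<in> {t - 1<..<t}"
      then have "s \<notin> S" unfolding t_def using cInf_lower[of s S] lb by (force simp: bdd_below_def)
      then show "cdf M s \<le> 1 / 2" by (simp add: S_def)
    qed simp
  qed simp
  ultimately show ?thesis by (intro exI[of _ t]) simp
qed

lemma coordinate_measurable [measurable]:
  "(\<lambda>x::real^'n::finite. x $ i) \<in> borel_measurable lebesgue"
proof -
  have "(\<lambda>x::real^'n. x $ i) \<in> borel_measurable borel" by (intro borel_measurable_continuous_onI continuous_intros)
  then show ?thesis by (intro measurable_completion) simp
qed

lemma coordinate_halfspaces [measurable]:
  "{x::real^'n::finite. t < x $ i} \<in> sets lebesgue" "{x::real^'n::finite. x $ i < t} \<in> sets lebesgue"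
proof -
  have "{x \<in> space lebesgue. t < (x::real^'n) $ i} \<in> sets lebesgue" by measurable
  then show "{x::real^'n. t < x $ i} \<in> sets lebesgue" by simp
  have "{x \<in> space lebesgue. (x::real^'n) $ i < t} \<in> sets lebesgue" by measurable
  then show "{x::real^'n. x $ i < t} \<in> sets lebesgue" by simp
qed

lemma mass_median:
  fixes f :: "real^'n::finite \<Rightarrow> complex"
  assumes p: "0 < p" and f: "f \<in> Lp p" "Lp_norm p f = 1"
  shows "\<exists>t. mass p f {x. t < x $ i} \<le> 1 / 2 \<and> mass p f {x. x $ i < t} \<le> 1 / 2"
proof -
  interpret prob_space "mass_measure p f" by (rule prob_space_mass_measure[OF p f])
  have m: "(\<lambda>x. x $ i) \<in> borel_measurable (mass_measure p f)"
    unfolding mass_measure_def by measurable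
  have "real_distribution (distr (mass_measure p f) borel (\<lambda>x. x $ i))"
    by (intro real_distribution_distr m)
  from real_distribution_median[OF this] obtain t where
    t: "measure (distr (mass_measure p f) borel (\<lambda>x. x $ i)) {t<..} \<le> 1 / 2"
      "measure (distr (mass_measure p f) borel (\<lambda>x. x $ i)) {..<t} \<le> 1 / 2" by blast
  have "measure (distr (mass_measure p f) borel (\<lambda>x. x $ i)) {t<..} = mass p f {x. t < x $ i}"
    by (subst measure_distr[OF m]) (simp_all add: vimage_def measure_mass_measure(2)[OF p f(1)] coordinate_halfspaces)
  moreover have "measure (distr (mass_measure p f) borel (\<lambda>x. x $ i)) {..<t} = mass p f {x. x $ i < t}"
    by (subst measure_distr[OF m]) (simp_all add: vimage_def measure_mass_measure(2)[OF p f(1)] coordinate_halfspaces)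
  ultimately show ?thesis using t by metis
qed

text \<open>Medians give a centre that does not depend on the tolerance with which the mass is to be
  localized, so one translation serves for all tolerances.\<close>

lemma exists_centering:
  fixes f :: "real^'n::finite \<Rightarrow> complex"
  assumes p: "0 < p" and f: "f \<in> Lp p" "Lp_norm p f = 1"
  shows "\<exists>a. \<forall>i. mass p (\<lambda>x. f (x - a)) {x. 0 < x $ i} \<le> 1 / 2 \<and> mass p (\<lambda>x. f (x - a)) {x. x $ i < 0} \<le> 1 / 2"
proof -
  obtain t where t: "\<And>i. mass p f {x. t i < x $ i} \<le> 1 / 2" "\<And>i. mass p f {x. x $ i < t i} \<le> 1 / 2"
    using mass_median[OF p f] by metis
  define a where "a = - (\<chi> i. t i)"
  have tr: "mass p (\<lambda>x. f (x - a)) A = mass p f B" if B: "B \<in> sets lebesgue" and AB: "\<And>x. x \<in> A \<longleftrightarrow> x - a \<in> B" for A B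
  proof -
    have "cut A (\<lambda>x. f (x - a)) = (\<lambda>x. cut B f (x - a))"
      by (rule ext) (simp add: cut_def indicator_def AB)
    then show ?thesis unfolding mass_def using Lp_translate(2)[OF cut_Lp(1)[OF p f(1) B], of a] by simp
  qed
  have "mass p (\<lambda>x. f (x - a)) {x. 0 < x $ i} = mass p f {x. t i < x $ i}" for i
    by (rule tr[OF coordinate_halfspaces(1)]) (simp add: a_def)
  moreover have "mass p (\<lambda>x. f (x - a)) {x. x $ i < 0} = mass p f {x. x $ i < t i}" for i
    by (rule tr[OF coordinate_halfspaces(2)]) (simp add: a_def)
  ultimately show ?thesis using t by metis
qed

section \<open>Operators approximable by kernels of bounded support\<close>

locale kernel_approximable =
  fixes K :: "(real^'n::finite \<Rightarrow> complex) \<Rightarrow> real^'n \<Rightarrow> complex" and p r N :: real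
  assumes p: "1 < p" and pr: "p < r" and N_nonneg: "0 \<le> N"
    and K_Lp: "\<And>f. f \<in> Lp p \<Longrightarrow> K f \<in> Lp r"
    and K_bound: "\<And>f. f \<in> Lp p \<Longrightarrow> Lp_norm r (K f) \<le> N * Lp_norm p f"
    and approx: "\<And>\<epsilon>. 0 < \<epsilon> \<Longrightarrow> \<exists>h R M. bounded_kernel h R M \<and>
      (\<forall>f\<in>Lp p. Lp_norm r (\<lambda>x. K f x - kernel_conv h f x) \<le> \<epsilon> * Lp_norm p f)"
begin

lemma exponents: "0 < p" "1 \<le> p" "0 < r" "1 \<le> r" "p \<le> r" using p pr by auto

lemma kernel_conv_norm_le:
  assumes h: "bounded_kernel h R M"
    and hK: "\<forall>f\<in>Lp p. Lp_norm r (\<lambda>x. K f x - kernel_conv h f x) \<le> \<epsilon> * Lp_norm p f"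
    and f: "f \<in> Lp p"
  shows "kernel_conv h f \<in> Lp r"
    "Lp_norm r (kernel_conv h f) \<le> (N + \<epsilon>) * Lp_norm p f"
    "Lp_norm r (K f) \<le> \<epsilon> * Lp_norm p f + Lp_norm r (kernel_conv h f)"
    "Lp_norm r (kernel_conv h f) \<le> Lp_norm r (K f) + \<epsilon> * Lp_norm p f"
proof -
  interpret bounded_kernel h R M by (rule h)
  show L: "kernel_conv h f \<in> Lp r" by (rule continuous_LpD(1)[OF continuous_Lp_kernel_conv[OF p exponents(5)] f])
  have d: "Lp_norm r (\<lambda>x. K f x - kernel_conv h f x) \<le> \<epsilon> * Lp_norm p f" by (rule bspec[OF hK f])
  show 1: "Lp_norm r (K f) \<le> \<epsilon> * Lp_norm p f + Lp_norm r (kernel_conv h f)"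
    using Lp_norm_le_add_diff[OF exponents(4) K_Lp[OF f] L] d by linarith
  show 2: "Lp_norm r (kernel_conv h f) \<le> Lp_norm r (K f) + \<epsilon> * Lp_norm p f"
    using Lp_norm_le_add_diff[OF exponents(4) L K_Lp[OF f]] d
      Lp_norm_minus_commute[of r "kernel_conv h f" "K f"] by linarith
  show "Lp_norm r (kernel_conv h f) \<le> (N + \<epsilon>) * Lp_norm p f"
    using 2 K_bound[OF f] by (simp add: distrib_right)
qed

text \<open>Two pieces of a function whose supports are more than twice the range of the kernel apart
  have images with disjoint supports, so the \<open>r\<close>-th powers of the norms of the images add up. Since
  \<open>r > p\<close>, splitting the mass substantially between such pieces costs a definite part of the norm.\<close>

lemma separated_pieces:
  fixes \<xi> :: "real^'n \<Rightarrow> real"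
  assumes h: "bounded_kernel h R M" and \<epsilon>: "0 \<le> \<epsilon>"
    and hK: "\<forall>f\<in>Lp p. Lp_norm r (\<lambda>x. K f x - kernel_conv h f x) \<le> \<epsilon> * Lp_norm p f"
    and f: "f \<in> Lp p" "Lp_norm p f = 1"
    and \<xi>: "\<xi> \<in> borel_measurable lebesgue" "\<And>x y. \<bar>\<xi> x - \<xi> y\<bar> \<le> dist x y"
    and \<delta>: "0 < \<delta>" "\<delta> \<le> mass p f {x. s + 2 * R < \<xi> x}" "mass p f {x. s + 2 * R < \<xi> x} \<le> 1 / 2"
  shows "Lp_norm r (K f) \<le> \<epsilon> + (N + \<epsilon>) * ((1 - \<delta>) powr ((r / p - 1) / r)
      + mass p f {x. s < \<xi> x \<and> \<xi> x \<le> s + 2 * R} powr (1 / p))"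
proof -
  interpret bounded_kernel h R M by (rule h)
  note p0 = exponents(1) and p1 = exponents(2) and r0 = exponents(3) and r1 = exponents(4)
  define A where "A = {x. \<xi> x \<le> s}"
  define B where "B = {x. s + 2 * R < \<xi> x}"
  define S where "S = {x. s < \<xi> x \<and> \<xi> x \<le> s + 2 * R}"
  have meas: "A \<in> sets lebesgue" "B \<in> sets lebesgue" "S \<in> sets lebesgue"
  proof -
    note [measurable] = \<xi>(1)
    have "{x \<in> space lebesgue. \<xi> x \<le> s} \<in> sets lebesgue" by measurable
    then show "A \<in> sets lebesgue" by (simp add: A_def)
    have "{x \<in> space lebesgue. s + 2 * R < \<xi> x} \<in> sets lebesgue" by measurable
    then show "B \<in> sets lebesgue" by (simp add: B_def)
    have "{x \<in> space lebesgue. s < \<xi> x \<and> \<xi> x \<le> s + 2 * R} \<in> sets lebesgue" by measurable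
    then show "S \<in> sets lebesgue" by (simp add: S_def)
  qed
  let ?fA = "cut A f" and ?fB = "cut B f" and ?fS = "cut S f"
  note L = cut_Lp(1)[OF p0 f(1) meas(1)] cut_Lp(1)[OF p0 f(1) meas(2)] cut_Lp(1)[OF p0 f(1) meas(3)]
  define a where "a = mass p f A"
  define b where "b = mass p f B"
  have a0: "0 \<le> a" and b0: "0 \<le> b" by (simp_all add: a_def b_def mass_nonneg)
  have disj: "disjoint_family_on (\<lambda>i. if i then A else B) UNIV"
    using R_pos by (auto simp: disjoint_family_on_def A_def B_def)
  have ab: "a + b \<le> 1"
  proof -
    have "(\<Sum>i\<in>UNIV. mass p f (if i then A else B)) \<le> 1"
      by (rule mass_disjoint_le_1[OF p0 f _ _ disj]) (use meas in auto)
    then show ?thesis by (simp add: UNIV_bool a_def b_def)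
  qed
  define \<sigma> where "\<sigma> = r / p"
  have \<sigma>: "1 < \<sigma>" using p pr by (simp add: \<sigma>_def)
  have b_bounds: "\<delta> \<le> b" "b \<le> 1 / 2" using \<delta>(2,3) by (simp_all add: b_def B_def)
  have \<delta>1: "0 < 1 - \<delta>" using b_bounds by linarith
  \<comment> \<open>both masses are at most \<open>1 - \<delta>\<close>, since \<open>\<delta> \<le> b \<le> 1 / 2\<close>\<close>
  have pw: "a powr \<sigma> + b powr \<sigma> \<le> (1 - \<delta>) powr (\<sigma> - 1)"
  proof -
    have *: "c powr \<sigma> \<le> c * (1 - \<delta>) powr (\<sigma> - 1)" if "0 \<le> c" "c \<le> 1 - \<delta>" for c
    proof -
      have "c powr \<sigma> = c * c powr (\<sigma> - 1)" using powr_mult_base[OF that(1), of "\<sigma> - 1"] by simp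
      also have "\<dots> \<le> c * (1 - \<delta>) powr (\<sigma> - 1)" using that \<sigma> by (intro mult_left_mono powr_mono2) auto
      finally show ?thesis .
    qed
    have "a powr \<sigma> + b powr \<sigma> \<le> a * (1 - \<delta>) powr (\<sigma> - 1) + b * (1 - \<delta>) powr (\<sigma> - 1)"
      using ab b_bounds a0 b0 by (intro add_mono *) linarith+
    also have "\<dots> = (a + b) * (1 - \<delta>) powr (\<sigma> - 1)" by (simp add: distrib_right)
    also have "\<dots> \<le> 1 * (1 - \<delta>) powr (\<sigma> - 1)" by (intro mult_right_mono ab) simp
    finally show ?thesis by simp
  qed
  let ?KA = "kernel_conv h ?fA" and ?KB = "kernel_conv h ?fB" and ?KS = "kernel_conv h ?fS"
  have KL: "?KA \<in> Lp r" "?KB \<in> Lp r" "?KS \<in> Lp r"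
    by (rule kernel_conv_norm_le(1)[OF h hK L(1)] kernel_conv_norm_le(1)[OF h hK L(2)] kernel_conv_norm_le(1)[OF h hK L(3)])+
  have f_split: "f = (\<lambda>x. (?fA x + ?fB x) + ?fS x)"
  proof
    fix x show "f x = (?fA x + ?fB x) + ?fS x"
      using R_pos by (auto simp: cut_def A_def B_def S_def indicator_def)
  qed
  have Kf: "kernel_conv h f = (\<lambda>x. (?KA x + ?KB x) + ?KS x)"
  proof
    fix x
    have "kernel_conv h f x = kernel_conv h (\<lambda>x. (?fA x + ?fB x) + ?fS x) x" by (subst f_split) (rule refl)
    also have "\<dots> = kernel_conv h (\<lambda>x. ?fA x + ?fB x) x + ?KS x"
      by (rule kernel_conv_add[OF p Lp_add(1)[OF p1 L(1,2)] L(3)])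
    also have "kernel_conv h (\<lambda>x. ?fA x + ?fB x) x = ?KA x + ?KB x" by (rule kernel_conv_add[OF p L(1,2)])
    finally show "kernel_conv h f x = (?KA x + ?KB x) + ?KS x" .
  qed
  have sep: "?KA x = 0 \<or> ?KB x = 0" for x
  proof (cases "\<xi> x \<le> s + R")
    case True
    have "?KB x = 0"
    proof (rule kernel_conv_eq_0)
      fix y assume "y \<in> cball x R"
      then have "\<xi> y \<le> s + 2 * R" using \<xi>(2)[of x y] True by auto
      then show "cut B f y = 0" by (simp add: cut_def B_def)
    qed
    then show ?thesis by simp
  next
    case False
    have "?KA x = 0"
    proof (rule kernel_conv_eq_0)
      fix y assume "y \<in> cball x R"
      then have "s < \<xi> y" using \<xi>(2)[of x y] False by auto
      then show "cut A f y = 0" by (simp add: cut_def A_def)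
    qed
    then show ?thesis by simp
  qed
  have piece: "Lp_norm r (kernel_conv h (cut D f)) powr r \<le> (N + \<epsilon>) powr r * mass p f D powr \<sigma>"
    if D: "D \<in> sets lebesgue" for D
  proof -
    have "Lp_norm r (kernel_conv h (cut D f)) \<le> (N + \<epsilon>) * mass p f D powr (1 / p)"
      using kernel_conv_norm_le(2)[OF h hK cut_Lp(1)[OF p0 f(1) D]] unfolding Lp_norm_cut[OF p0] .
    then have "Lp_norm r (kernel_conv h (cut D f)) powr r \<le> ((N + \<epsilon>) * mass p f D powr (1 / p)) powr r"
      using r0 by (intro powr_mono2) auto
    also have "\<dots> = (N + \<epsilon>) powr r * mass p f D powr \<sigma>"
      by (simp add: powr_mult powr_powr \<sigma>_def)
    finally show ?thesis .
  qed
  have AB: "Lp_norm r (\<lambda>x. ?KA x + ?KB x) \<le> (N + \<epsilon>) * (1 - \<delta>) powr ((\<sigma> - 1) / r)"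
  proof -
    have "(\<integral>x. cmod (?KA x + ?KB x) powr r \<partial>lebesgue) = (\<integral>x. cmod (?KA x) powr r + cmod (?KB x) powr r \<partial>lebesgue)"
    proof (rule Bochner_Integration.integral_cong[OF refl])
      fix x show "cmod (?KA x + ?KB x) powr r = cmod (?KA x) powr r + cmod (?KB x) powr r"
        using sep[of x] by auto
    qed
    also have "\<dots> = Lp_norm r ?KA powr r + Lp_norm r ?KB powr r"
      unfolding Lp_norm_powr[OF r0] by (rule Bochner_Integration.integral_add[OF LpD(2)[OF KL(1)] LpD(2)[OF KL(2)]])
    also have "\<dots> \<le> (N + \<epsilon>) powr r * a powr \<sigma> + (N + \<epsilon>) powr r * b powr \<sigma>"
      unfolding a_def b_def by (intro add_mono piece meas)
    also have "\<dots> = (N + \<epsilon>) powr r * (a powr \<sigma> + b powr \<sigma>)" by (simp add: distrib_left)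
    also have "\<dots> \<le> (N + \<epsilon>) powr r * (1 - \<delta>) powr (\<sigma> - 1)" by (intro mult_left_mono pw) simp
    also have "\<dots> = ((N + \<epsilon>) * (1 - \<delta>) powr ((\<sigma> - 1) / r)) powr r"
      using r0 by (simp add: powr_mult powr_powr)
    finally show ?thesis using N_nonneg \<epsilon> by (subst Lp_norm_le_iff[OF r0]) auto
  qed
  have "Lp_norm r (kernel_conv h f) \<le> Lp_norm r (\<lambda>x. ?KA x + ?KB x) + Lp_norm r ?KS"
    unfolding Kf by (rule Lp_add(2)[OF r1 Lp_add(1)[OF r1 KL(1,2)] KL(3)])
  moreover have "Lp_norm r ?KS \<le> (N + \<epsilon>) * mass p f S powr (1 / p)"
    using kernel_conv_norm_le(2)[OF h hK L(3)] unfolding Lp_norm_cut[OF p0] .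
  ultimately have "Lp_norm r (K f) \<le> \<epsilon> + ((N + \<epsilon>) * (1 - \<delta>) powr ((\<sigma> - 1) / r) + (N + \<epsilon>) * mass p f S powr (1 / p))"
    using AB kernel_conv_norm_le(3)[OF h hK f(1)] f(2) by simp
  then show ?thesis by (simp add: distrib_left \<sigma>_def S_def)
qed

text \<open>Among \<open>n\<close> consecutive slabs of width \<open>2 R\<close> beyond the median, one has mass at most \<open>1 / n\<close>. If more than
  \<open>\<delta>\<close> of the mass lay beyond all of them, that slab would separate two substantial pieces, and the
  norm of the image would stay below \<open>N\<close> by an amount independent of \<open>f\<close>.\<close>

lemma near_maximizers_tight:
  assumes N: "0 < N" and \<delta>: "0 < \<delta>" "\<delta> < 1"
  shows "\<exists>\<kappa>>0. \<exists>L\<ge>0. \<forall>f \<xi>. f \<in> Lp p \<longrightarrow> Lp_norm p f = 1 \<longrightarrow> N - \<kappa> \<le> Lp_norm r (K f) \<longrightarrow>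
      \<xi> \<in> borel_measurable lebesgue \<longrightarrow> (\<forall>x y. \<bar>\<xi> x - \<xi> y\<bar> \<le> dist x y) \<longrightarrow>
      mass p f {x. 0 < \<xi> x} \<le> 1 / 2 \<longrightarrow> mass p f {x. L < \<xi> x} \<le> \<delta>"
proof -
  note p0 = exponents(1) and r0 = exponents(3)
  define \<theta> where "\<theta> = (1 - \<delta>) powr ((r / p - 1) / r)"
  have ex: "0 < (r / p - 1) / r" using p pr by simp
  have \<theta>: "\<theta> < 1"
  proof -
    have "\<theta> < 1 powr ((r / p - 1) / r)" unfolding \<theta>_def using \<delta> ex by (intro powr_less_mono2) auto
    then show ?thesis by simp
  qed
  \<comment> \<open>the bound of \<open>separated_pieces\<close> with approximation error \<open>e\<close> and a slab whose mass has \<open>p\<close>-th root at most \<open>e\<close>\<close>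
  define \<phi> where "\<phi> e = e + (N + e) * (\<theta> + e)" for e
  have "(\<phi> \<longlongrightarrow> 0 + (N + 0) * (\<theta> + 0)) (at_right 0)" unfolding \<phi>_def by (intro tendsto_intros)
  moreover have "0 + (N + 0) * (\<theta> + 0) < N" using N \<theta> by simp
  ultimately have "\<forall>\<^sub>F e in at_right 0. \<phi> e < N" by (rule order_tendstoD(2))
  then obtain e0 where e0: "0 < e0" "\<And>e. 0 < e \<Longrightarrow> e < e0 \<Longrightarrow> \<phi> e < N"
    unfolding eventually_at_right_field by blast
  define e where "e = e0 / 2"
  have e: "0 < e" "\<phi> e < N" using e0 by (auto simp: e_def)
  obtain h R M where h: "bounded_kernel h R M"
    and hK: "\<forall>f\<in>Lp p. Lp_norm r (\<lambda>x. K f x - kernel_conv h f x) \<le> e * Lp_norm p f"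
    using approx[OF e(1)] by blast
  interpret bounded_kernel h R M by (rule h)
  obtain n :: nat where n: "1 / e powr p < real n" using reals_Archimedean2 by blast
  have "0 < 1 / e powr p" using e by simp
  with n have n0: "0 < n" by (cases n) auto
  have "1 / real n \<le> e powr p" using n n0 e by (simp add: field_simps less_imp_le)
  then have "(1 / real n) powr (1 / p) \<le> (e powr p) powr (1 / p)" using p0 by (intro powr_mono2) auto
  then have n_e: "(1 / real n) powr (1 / p) \<le> e" using p0 e by (simp add: powr_powr)
  define L where "L = real n * (2 * R)"
  define \<kappa> where "\<kappa> = (N - \<phi> e) / 2"
  have L0: "0 \<le> L" using R_pos by (simp add: L_def)
  have \<kappa>: "0 < \<kappa>" "\<phi> e < N - \<kappa>" using e by (auto simp: \<kappa>_def field_simps)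
  have "mass p f {x. L < \<xi> x} \<le> \<delta>"
    if f: "f \<in> Lp p" "Lp_norm p f = 1" and Kf: "N - \<kappa> \<le> Lp_norm r (K f)"
      and \<xi>: "\<xi> \<in> borel_measurable lebesgue" "\<forall>x y. \<bar>\<xi> x - \<xi> y\<bar> \<le> dist x y"
      and half: "mass p f {x. 0 < \<xi> x} \<le> 1 / 2" for f \<xi>
  proof (rule ccontr)
    assume "\<not> mass p f {x. L < \<xi> x} \<le> \<delta>"
    then have big: "\<delta> \<le> mass p f {x. L < \<xi> x}" by simp
    have up: "{x. c < \<xi> x} \<in> sets lebesgue" for c
    proof -
      note [measurable] = \<xi>(1)
      have "{x \<in> space lebesgue. c < \<xi> x} \<in> sets lebesgue" by measurable
      then show ?thesis by simp
    qed
    have "0 < 2 * R" using R_pos by simp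
    from exists_light_slab[OF p0 f \<xi>(1) n0 this, of 0] obtain m where m: "m < n"
      "mass p f {x. 0 + real m * (2 * R) < \<xi> x \<and> \<xi> x \<le> 0 + real (Suc m) * (2 * R)} \<le> 1 / real n" by blast
    define s where "s = real m * (2 * R)"
    have s0: "0 \<le> s" using R_pos by (simp add: s_def)
    have sS: "s + 2 * R = real (Suc m) * (2 * R)" by (simp add: s_def distrib_right)
    have sL: "s + 2 * R \<le> L" unfolding sS L_def using m(1) R_pos by (intro mult_right_mono) auto
    have slab: "mass p f {x. s < \<xi> x \<and> \<xi> x \<le> s + 2 * R} \<le> 1 / real n"
      using m(2) unfolding sS by (simp add: s_def)
    have "\<delta> \<le> mass p f {x. s + 2 * R < \<xi> x}"
      using big mass_mono[OF p0 f _ up up, of L "s + 2 * R"] sL by force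
    moreover have "mass p f {x. s + 2 * R < \<xi> x} \<le> 1 / 2"
      using half mass_mono[OF p0 f _ up up, of "s + 2 * R" 0] s0 R_pos by force
    ultimately have "Lp_norm r (K f) \<le> e + (N + e) * ((1 - \<delta>) powr ((r / p - 1) / r)
      + mass p f {x. s < \<xi> x \<and> \<xi> x \<le> s + 2 * R} powr (1 / p))"
      using e \<xi> by (intro separated_pieces[OF h _ hK f \<xi>(1) _ \<delta>(1)]) auto
    also have "\<dots> \<le> e + (N + e) * (\<theta> + e)"
    proof -
      have "mass p f {x. s < \<xi> x \<and> \<xi> x \<le> s + 2 * R} powr (1 / p) \<le> (1 / real n) powr (1 / p)"
        using slab p0 by (intro powr_mono2 mass_nonneg) auto
      with n_e have "mass p f {x. s < \<xi> x \<and> \<xi> x \<le> s + 2 * R} powr (1 / p) \<le> e" by linarith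
      then show ?thesis unfolding \<theta>_def using N e by (intro add_left_mono mult_left_mono) auto
    qed
    also have "\<dots> < N - \<kappa>" using \<kappa>(2) by (simp add: \<phi>_def)
    finally show False using Kf by simp
  qed
  with \<kappa>(1) L0 show ?thesis by blast
qed

definition cube :: "real \<Rightarrow> (real^'n) set" where
  "cube L = {x. \<forall>i. \<bar>x $ i\<bar> \<le> L}"

lemma cube_eq_cbox: "cube L = cbox (\<chi> i. - L) (\<chi> i. L)"
  by (auto simp: cube_def mem_box_cart abs_le_iff minus_le_iff)

lemma cube_measurable: "cube L \<in> sets lebesgue" "- cube L \<in> sets lebesgue"
proof -
  show 1: "cube L \<in> sets lebesgue" unfolding cube_eq_cbox by (intro sets_completionI_sets) simp
  show "- cube L \<in> sets lebesgue" using sets.compl_sets[OF 1] by (simp add: Compl_eq_Diff_UNIV)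
qed

text \<open>The complement of a cube is covered by one pair of half-spaces for each coordinate, and tightness
  applies to each coordinate function and to its negative.\<close>

lemma centered_near_maximizers_tight:
  assumes N: "0 < N" and \<eta>: "0 < \<eta>"
  shows "\<exists>\<kappa>>0. \<exists>L\<ge>0. \<forall>f. f \<in> Lp p \<longrightarrow> Lp_norm p f = 1 \<longrightarrow> N - \<kappa> \<le> Lp_norm r (K f) \<longrightarrow>
      (\<forall>i. mass p f {x. 0 < x $ i} \<le> 1 / 2 \<and> mass p f {x. x $ i < 0} \<le> 1 / 2) \<longrightarrow>
      (\<forall>L'\<ge>L. Lp_norm p (cut (- cube L') f) \<le> \<eta>)"
proof -
  note p0 = exponents(1)
  define d where "d = real CARD('n)"
  have d: "0 < d" by (simp add: d_def)
  define \<delta> where "\<delta> = min (1/2) (\<eta> powr p / (2 * d))"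
  have \<delta>: "0 < \<delta>" "\<delta> < 1" using \<eta> d by (auto simp: \<delta>_def)
  have \<delta>\<eta>: "2 * d * \<delta> \<le> \<eta> powr p"
  proof -
    have "2 * d * \<delta> \<le> 2 * d * (\<eta> powr p / (2 * d))" using d by (intro mult_left_mono) (auto simp: \<delta>_def)
    then show ?thesis using d by simp
  qed
  obtain \<kappa> L where \<kappa>: "0 < \<kappa>" and L: "0 \<le> L" and tight: "\<And>f \<xi>. f \<in> Lp p \<Longrightarrow> Lp_norm p f = 1 \<Longrightarrow>
      N - \<kappa> \<le> Lp_norm r (K f) \<Longrightarrow> \<xi> \<in> borel_measurable lebesgue \<Longrightarrow> (\<forall>x y. \<bar>\<xi> x - \<xi> y\<bar> \<le> dist x y) \<Longrightarrow>
      mass p f {x. 0 < \<xi> x} \<le> 1 / 2 \<Longrightarrow> mass p f {x. L < \<xi> x} \<le> \<delta>"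
    using near_maximizers_tight[OF N \<delta>] by blast
  have "Lp_norm p (cut (- cube L') f) \<le> \<eta>"
    if f: "f \<in> Lp p" "Lp_norm p f = 1" and Kf: "N - \<kappa> \<le> Lp_norm r (K f)"
      and c: "\<forall>i. mass p f {x. 0 < x $ i} \<le> 1 / 2 \<and> mass p f {x. x $ i < 0} \<le> 1 / 2"
      and L': "L \<le> L'" for f L'
  proof -
    interpret prob_space "mass_measure p f" by (rule prob_space_mass_measure[OF p0 f])
    define A where "A i = {x::real^'n. L < x $ i} \<union> {x. x $ i < - L}" for i
    have Am: "A i \<in> sets lebesgue" for i unfolding A_def by (intro sets.Un coordinate_halfspaces)
    have A: "mass p f (A i) \<le> 2 * \<delta>" for i
    proof -
      have lip: "\<bar>x $ i - y $ i\<bar> \<le> dist x y" for x y :: "real^'n"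
        using component_le_norm_cart[of "x - y" i] by (simp add: dist_norm)
      have "mass p f {x. L < x $ i} \<le> \<delta>"
        using c lip by (intro tight[OF f Kf]) auto
      moreover have "mass p f {x. L < - x $ i} \<le> \<delta>"
      proof (rule tight[OF f Kf])
        show "\<forall>x y. \<bar>- x $ i - - y $ i\<bar> \<le> dist x (y :: real^'n)" using lip by (simp add: abs_minus_commute)
        show "mass p f {x. 0 < - x $ i} \<le> 1 / 2" using c by simp
      qed measurable
      moreover have "{x. L < - x $ i} = {x::real^'n. x $ i < - L}" by auto
      ultimately show ?thesis
        using mass_Un_le[OF p0 f coordinate_halfspaces(1)[of L i] coordinate_halfspaces(2)[of i "- L"]]
        by (simp add: A_def)
    qed
    have "- cube L' \<subseteq> (\<Union>i. A i)"
    proof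
      fix x assume "x \<in> - cube L'"
      then obtain i where "L' < \<bar>x $ i\<bar>" by (auto simp: cube_def not_le)
      then have "x \<in> A i" using L' by (auto simp: A_def)
      then show "x \<in> (\<Union>i. A i)" by blast
    qed
    then have "mass p f (- cube L') \<le> mass p f (\<Union>i. A i)"
      using Am by (intro mass_mono[OF p0 f] cube_measurable sets.finite_UN) auto
    also have "\<dots> = measure (mass_measure p f) (\<Union>i. A i)"
      using Am by (intro measure_mass_measure(2)[OF p0 f(1), symmetric] sets.finite_UN) auto
    also have "\<dots> \<le> (\<Sum>i\<in>UNIV. measure (mass_measure p f) (A i))"
      using Am by (intro finite_measure_subadditive_finite) auto
    also have "\<dots> \<le> (\<Sum>i\<in>(UNIV::'n set). 2 * \<delta>)"
      using A Am by (intro sum_mono) (simp add: measure_mass_measure(2)[OF p0 f(1)])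
    also have "\<dots> \<le> \<eta> powr p" using \<delta>\<eta> by (simp add: d_def mult_ac)
    finally have "mass p f (- cube L') powr (1 / p) \<le> (\<eta> powr p) powr (1 / p)"
      using p0 by (intro powr_mono2 mass_nonneg) auto
    then show ?thesis using p0 \<eta> by (simp add: Lp_norm_cut[OF p0] powr_powr)
  qed
  with \<kappa> L show ?thesis by blast
qed

text \<open>On functions supported in a fixed cube, convolution with a bounded kernel of bounded support
  turns weak convergence into convergence at every point under a common bound with bounded support,
  hence into norm convergence.\<close>

lemma kernel_conv_compact:
  assumes h: "bounded_kernel h R M" and q: "1 < q" "1 / p + 1 / q = 1"
    and u: "\<And>j. u j \<in> Lp p" "\<And>j. Lp_norm p (u j) \<le> 1" and f: "f \<in> Lp p" "Lp_norm p f \<le> 1"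
    and weak: "\<And>g. g \<in> Lp q \<Longrightarrow> (\<lambda>j. \<integral>x. u j x * g x \<partial>lebesgue) \<longlonglongrightarrow> (\<integral>x. f x * g x \<partial>lebesgue)"
  shows "(\<lambda>j. Lp_norm r (\<lambda>x. kernel_conv h (cut (cube L) (u j)) x - kernel_conv h (cut (cube L) f) x)) \<longlonglongrightarrow> 0"
proof -
  interpret bounded_kernel h R M by (rule h)
  note p0 = exponents(1) and r0 = exponents(3)
  have q0: "0 < q" and qp: "1 / q + 1 / p = 1" using q by auto
  have cutL: "cut (cube L) g \<in> Lp p" "Lp_norm p (cut (cube L) g) \<le> 1" if "g \<in> Lp p" "Lp_norm p g \<le> 1" for g
  proof -
    show "cut (cube L) g \<in> Lp p" by (rule cut_Lp(1)[OF p0 that(1) cube_measurable(1)])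
    show "Lp_norm p (cut (cube L) g) \<le> 1"
      by (rule order_trans[OF cut_Lp(2)[OF p0 that(1) cube_measurable(1)] that(2)])
  qed
  define A where "A = Lp_norm q h"
  have A0: "0 \<le> A" by (simp add: A_def)
  have "bounded (cube L)" unfolding cube_eq_cbox by (rule bounded_cbox)
  then obtain \<rho> where \<rho>: "\<And>x. x \<in> cube L \<Longrightarrow> norm x \<le> \<rho>" unfolding bounded_iff by blast
  have bd: "cmod (kernel_conv h (cut (cube L) g) x) \<le> A * indicator (cball 0 (\<rho> + R)) x"
    if g: "g \<in> Lp p" "Lp_norm p g \<le> 1" for g x
  proof (cases "x \<in> cball 0 (\<rho> + R)")
    case True
    have "cmod (kernel_conv h (cut (cube L) g) x) \<le> A * Lp_norm p (\<lambda>y. indicator (cball x R) y * cut (cube L) g y)"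
      unfolding A_def by (rule kernel_conv_pointwise[OF p qp cutL(1)[OF g]])
    also have "\<dots> \<le> A * 1"
    proof (intro mult_left_mono A0)
      have "cball x R \<in> sets lebesgue" by (intro sets_completionI_sets) simp
      from Lp_indicator(2)[OF p0 cutL(1)[OF g] this] cutL(2)[OF g]
      show "Lp_norm p (\<lambda>y. indicator (cball x R) y * cut (cube L) g y) \<le> 1" by linarith
    qed
    finally show ?thesis using True by simp
  next
    case False
    have "kernel_conv h (cut (cube L) g) x = 0"
    proof (rule kernel_conv_eq_0)
      fix y assume "y \<in> cball x R"
      then have "norm x \<le> norm y + R" using norm_triangle_sub[of x y] by (simp add: dist_norm)
      then have "\<rho> < norm y" using False by simp
      then have "y \<notin> cube L" using \<rho>[of y] by auto
      then show "cut (cube L) g y = 0" by (simp add: cut_def)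
    qed
    then show ?thesis using False by simp
  qed
  show ?thesis
  proof (rule Lp_dominated_convergence[OF r0, where g = "\<lambda>x. 2 * A * indicator (cball 0 (\<rho> + R)) x"])
    show "kernel_conv h (cut (cube L) f) \<in> borel_measurable lebesgue"
      by (rule kernel_conv_measurable[OF LpD(1)[OF cutL(1)[OF f]]])
    show "kernel_conv h (cut (cube L) (u j)) \<in> borel_measurable lebesgue" for j
      by (rule kernel_conv_measurable[OF LpD(1)[OF cutL(1)[OF u]]])
    have "integrable lebesgue (\<lambda>x::real^'n. (2 * A) powr r * indicator (cball 0 (\<rho> + R)) x)"
      by (intro integrable_mult_right) (simp add: lmeasurable_iff_integrable[symmetric])
    moreover have "(2 * A * indicator (cball 0 (\<rho> + R)) x) powr r = (2 * A) powr r * indicator (cball 0 (\<rho> + R)) x"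
      for x :: "real^'n" using r0 by (cases "x \<in> cball 0 (\<rho> + R)") simp_all
    ultimately show "integrable lebesgue (\<lambda>x::real^'n. (2 * A * indicator (cball 0 (\<rho> + R)) x) powr r)" by simp
    show "AE x in lebesgue. (\<lambda>j. kernel_conv h (cut (cube L) (u j)) x) \<longlonglongrightarrow> kernel_conv h (cut (cube L) f) x"
    proof (intro always_eventually allI)
      fix x
      have g: "(\<lambda>y. indicator (cube L) y * h (x - y)) \<in> Lp q"
        by (rule Lp_indicator(1)[OF q0 reflected_kernel(1)[OF q0] cube_measurable(1)])
      have eq: "kernel_conv h (cut (cube L) v) x = (\<integral>y. v y * (indicator (cube L) y * h (x - y)) \<partial>lebesgue)" for v
        unfolding kernel_conv_def cut_def by (simp add: mult_ac)
      show "(\<lambda>j. kernel_conv h (cut (cube L) (u j)) x) \<longlonglongrightarrow> kernel_conv h (cut (cube L) f) x"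
        unfolding eq by (rule weak[OF g])
    qed
    show "AE x in lebesgue. cmod (kernel_conv h (cut (cube L) (u j)) x - kernel_conv h (cut (cube L) f) x)
        \<le> 2 * A * indicator (cball 0 (\<rho> + R)) x" for j
    proof (intro always_eventually allI)
      fix x
      show "cmod (kernel_conv h (cut (cube L) (u j)) x - kernel_conv h (cut (cube L) f) x)
        \<le> 2 * A * indicator (cball 0 (\<rho> + R)) x"
        using norm_triangle_ineq4[of "kernel_conv h (cut (cube L) (u j)) x" "kernel_conv h (cut (cube L) f) x"]
          bd[OF u, of j x] bd[OF f, of x] by simp
    qed
  qed
qed

end

context kernel_approximable
begin

text \<open>Cutting a function of small tail to the cube changes the norm of its image only slightly.\<close>

lemma kernel_conv_cut_le:
  assumes h: "bounded_kernel h R M"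
    and hK: "\<forall>f\<in>Lp p. Lp_norm r (\<lambda>x. K f x - kernel_conv h f x) \<le> e * Lp_norm p f"
    and e: "0 \<le> e" and f: "f \<in> Lp p" and tail: "Lp_norm p (cut (- cube L) f) \<le> \<eta>"
  shows "Lp_norm r (kernel_conv h f) \<le> Lp_norm r (kernel_conv h (cut (cube L) f)) + (N + e) * \<eta>"
    "Lp_norm r (kernel_conv h (cut (cube L) f)) \<le> Lp_norm r (kernel_conv h f) + (N + e) * \<eta>"
proof -
  interpret bounded_kernel h R M by (rule h)
  note p0 = exponents(1)
  note L = cut_Lp(1)[OF p0 f cube_measurable(1)[of L]] cut_Lp(1)[OF p0 f cube_measurable(2)[of L]]
  note KL = kernel_conv_norm_le(1)[OF h hK L(1)] kernel_conv_norm_le(1)[OF h hK L(2)]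
    kernel_conv_norm_le(1)[OF h hK f]
  have f_split: "f = (\<lambda>x. cut (cube L) f x + cut (- cube L) f x)"
    by (rule ext) (simp add: cut_def indicator_def)
  have eq: "kernel_conv h f = (\<lambda>x. kernel_conv h (cut (cube L) f) x + kernel_conv h (cut (- cube L) f) x)"
  proof
    fix x
    have "kernel_conv h f x = kernel_conv h (\<lambda>x. cut (cube L) f x + cut (- cube L) f x) x"
      by (subst f_split) (rule refl)
    also have "\<dots> = kernel_conv h (cut (cube L) f) x + kernel_conv h (cut (- cube L) f) x"
      by (rule kernel_conv_add[OF p L])
    finally show "kernel_conv h f x = kernel_conv h (cut (cube L) f) x + kernel_conv h (cut (- cube L) f) x" .
  qed
  have "Lp_norm r (kernel_conv h (cut (- cube L) f)) \<le> (N + e) * Lp_norm p (cut (- cube L) f)"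
    by (rule kernel_conv_norm_le(2)[OF h hK L(2)])
  also have "\<dots> \<le> (N + e) * \<eta>" using N_nonneg e by (intro mult_left_mono tail) auto
  finally have t: "Lp_norm r (kernel_conv h (cut (- cube L) f)) \<le> (N + e) * \<eta>" .
  show "Lp_norm r (kernel_conv h f) \<le> Lp_norm r (kernel_conv h (cut (cube L) f)) + (N + e) * \<eta>"
    using Lp_add(2)[OF exponents(4) KL(1,2)] t unfolding eq[symmetric] by linarith
  have "(\<lambda>x. kernel_conv h f x - kernel_conv h (cut (- cube L) f) x) = kernel_conv h (cut (cube L) f)"
    by (rule ext) (simp add: eq)
  with Lp_diff(2)[OF exponents(4) KL(3,2)] t
  show "Lp_norm r (kernel_conv h (cut (cube L) f)) \<le> Lp_norm r (kernel_conv h f) + (N + e) * \<eta>" by simp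
qed

lemma cube_tail_tendsto_0:
  assumes f: "f \<in> Lp p"
  shows "(\<lambda>m. Lp_norm p (cut (- cube (real m)) f)) \<longlonglongrightarrow> 0"
proof -
  note p0 = exponents(1)
  have lim: "(\<lambda>m. Lp_norm p (\<lambda>x. cut (cube (real m)) f x - f x)) \<longlonglongrightarrow> 0"
  proof (rule Lp_dominated_convergence[OF p0 LpD(1)[OF f] _ LpD(2)[OF f]])
    show "cut (cube (real m)) f \<in> borel_measurable lebesgue" for m
      by (rule LpD(1)[OF cut_Lp(1)[OF p0 f cube_measurable(1)]])
    show "AE x in lebesgue. (\<lambda>m. cut (cube (real m)) f x) \<longlonglongrightarrow> f x"
    proof (intro always_eventually allI)
      fix x :: "real^'n"
      obtain m0 :: nat where m0: "norm x \<le> real m0" using real_arch_simple by blast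
      have "x \<in> cube (real m)" if "m0 \<le> m" for m
        unfolding cube_def
      proof (intro CollectI allI)
        fix i show "\<bar>x $ i\<bar> \<le> real m" using component_le_norm_cart[of x i] m0 that by linarith
      qed
      then have "\<forall>\<^sub>F m in sequentially. cut (cube (real m)) f x = f x"
        unfolding eventually_sequentially by (intro exI[of _ m0]) (simp add: cut_def)
      then show "(\<lambda>m. cut (cube (real m)) f x) \<longlonglongrightarrow> f x" by (rule tendsto_eventually)
    qed
    show "AE x in lebesgue. cmod (cut (cube (real m)) f x - f x) \<le> cmod (f x)" for m
      by (intro always_eventually allI) (simp add: cut_def indicator_def)
  qed
  have "(\<lambda>x. f x - cut (cube (real m)) f x) = cut (- cube (real m)) f" for m
    by (rule ext) (simp add: cut_def indicator_def)
  then have "Lp_norm p (cut (- cube (real m)) f) = Lp_norm p (\<lambda>x. cut (cube (real m)) f x - f x)" for m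
    using Lp_norm_minus_commute[of p f "cut (cube (real m)) f"] by simp
  with lim show ?thesis by simp
qed

text \<open>A centred maximizing sequence is tight, so up to small errors its images are those of its restrictions
  to one cube under convolution with one kernel; these converge in norm along a weakly convergent
  subsequence. Hence the image of the weak limit has norm at least \<open>N\<close>, while the norm of the weak limit is
  at most one.\<close>

theorem maximizer_exists:
  assumes N: "0 < N"
    and trans: "\<And>f a. f \<in> Lp p \<Longrightarrow> Lp_norm r (K (\<lambda>x. f (x - a))) = Lp_norm r (K f)"
    and sup: "\<And>\<kappa>. 0 < \<kappa> \<Longrightarrow> \<exists>f\<in>Lp p. Lp_norm p f = 1 \<and> N - \<kappa> \<le> Lp_norm r (K f)"
  shows "\<exists>f\<in>Lp p. Lp_norm p f = 1 \<and> Lp_norm r (K f) = N"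
proof -
  note p0 = exponents(1) and p1 = exponents(2) and r1 = exponents(4)
  have "\<forall>j. \<exists>g. g \<in> Lp p \<and> Lp_norm p g = 1 \<and> N - inverse (real (Suc j)) \<le> Lp_norm r (K g)
      \<and> (\<forall>i. mass p g {x. 0 < x $ i} \<le> 1 / 2 \<and> mass p g {x. x $ i < 0} \<le> 1 / 2)"
  proof
    fix j
    have "0 < inverse (real (Suc j))" by simp
    from sup[OF this] obtain f where f: "f \<in> Lp p" "Lp_norm p f = 1"
      "N - inverse (real (Suc j)) \<le> Lp_norm r (K f)" by blast
    obtain a where a: "\<forall>i. mass p (\<lambda>x. f (x - a)) {x. 0 < x $ i} \<le> 1 / 2 \<and> mass p (\<lambda>x. f (x - a)) {x. x $ i < 0} \<le> 1 / 2"
      using exists_centering[OF p0 f(1,2)] by blast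
    show "\<exists>g. g \<in> Lp p \<and> Lp_norm p g = 1 \<and> N - inverse (real (Suc j)) \<le> Lp_norm r (K g)
      \<and> (\<forall>i. mass p g {x. 0 < x $ i} \<le> 1 / 2 \<and> mass p g {x. x $ i < 0} \<le> 1 / 2)"
      by (rule exI[of _ "\<lambda>x. f (x - a)"], intro conjI a)
        (use f Lp_translate[OF f(1)] trans[OF f(1)] in simp_all)
  qed
  from choice[OF this] obtain u where U: "\<forall>j. u j \<in> Lp p \<and> Lp_norm p (u j) = 1
      \<and> N - inverse (real (Suc j)) \<le> Lp_norm r (K (u j))
      \<and> (\<forall>i. mass p (u j) {x. 0 < x $ i} \<le> 1 / 2 \<and> mass p (u j) {x. x $ i < 0} \<le> 1 / 2)" by (elim exE) (rule that)
  have u: "u j \<in> Lp p" "Lp_norm p (u j) = 1" "N - inverse (real (Suc j)) \<le> Lp_norm r (K (u j))"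
    "\<forall>i. mass p (u j) {x. 0 < x $ i} \<le> 1 / 2 \<and> mass p (u j) {x. x $ i < 0} \<le> 1 / 2" for j
    using spec[OF U, of j] by blast+
  define q where "q = p / (p - 1)"
  have q: "1 < q" "1 / p + 1 / q = 1" using p by (auto simp: q_def field_simps)
  have u_le: "Lp_norm p (u j) \<le> 1" for j using u(2) by simp
  obtain s v where s: "strict_mono (s :: nat \<Rightarrow> nat)" and v: "v \<in> Lp p" "Lp_norm p v \<le> 1"
    and weak: "\<And>g. g \<in> Lp q \<Longrightarrow> (\<lambda>j. \<integral>x. u (s j) x * g x \<partial>lebesgue) \<longlonglongrightarrow> (\<integral>x. v x * g x \<partial>lebesgue)"
  proof (rule Lp_weakly_sequentially_compact[where u = u, OF p q u(1) u_le])
    fix s v assume 1: "strict_mono (s :: nat \<Rightarrow> nat)" "v \<in> Lp p" "Lp_norm p v \<le> 1"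
      and 2: "\<And>g. g \<in> Lp q \<Longrightarrow> (\<lambda>j. \<integral>x. u (s j) x * g x \<partial>lebesgue) \<longlonglongrightarrow> (\<integral>x. v x * g x \<partial>lebesgue)"
    show thesis by (rule that[OF 1 2])
  qed
  have main: "N \<le> Lp_norm r (K v) + (2 * e + 2 * ((N + e) * e))" if e: "0 < e" for e
  proof -
    obtain \<kappa> L where \<kappa>: "0 < \<kappa>" and tight: "\<And>f L'. f \<in> Lp p \<Longrightarrow> Lp_norm p f = 1 \<Longrightarrow> N - \<kappa> \<le> Lp_norm r (K f) \<Longrightarrow>
        (\<forall>i. mass p f {x. 0 < x $ i} \<le> 1 / 2 \<and> mass p f {x. x $ i < 0} \<le> 1 / 2) \<Longrightarrow>
        L \<le> L' \<Longrightarrow> Lp_norm p (cut (- cube L') f) \<le> e"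
      using centered_near_maximizers_tight[OF N e] by blast
    have "\<forall>\<^sub>F m in sequentially. Lp_norm p (cut (- cube (real m)) v) < e"
      by (rule order_tendstoD(2)[OF cube_tail_tendsto_0[OF v(1)] e])
    then obtain m0 where m0: "\<And>m. m0 \<le> m \<Longrightarrow> Lp_norm p (cut (- cube (real m)) v) < e"
      unfolding eventually_sequentially by blast
    obtain m1 :: nat where m1: "L \<le> real m1" using real_arch_simple by blast
    define Q where "Q = real (max m0 m1)"
    have LQ: "L \<le> Q" using m1 by (simp add: Q_def)
    have vQ: "Lp_norm p (cut (- cube Q) v) \<le> e" using m0[of "max m0 m1"] by (simp add: Q_def)
    obtain h R M where h: "bounded_kernel h R M"
      and hK: "\<forall>f\<in>Lp p. Lp_norm r (\<lambda>x. K f x - kernel_conv h f x) \<le> e * Lp_norm p f"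
      using approx[OF e] by blast
    have e0: "0 \<le> e" using e by simp
    let ?k = "\<lambda>f. kernel_conv h (cut (cube Q) f)"
    have cutL: "cut (cube Q) f \<in> Lp p" if "f \<in> Lp p" for f by (rule cut_Lp(1)[OF p0 that cube_measurable(1)])
    have "(\<lambda>j. Lp_norm r (\<lambda>x. ?k (u (s j)) x - ?k v x)) \<longlonglongrightarrow> 0"
      by (rule kernel_conv_compact[OF h q u(1) u_le v weak])
    from Lp_norm_tendsto[OF r1 kernel_conv_norm_le(1)[OF h hK cutL[OF v(1)]]
        kernel_conv_norm_le(1)[OF h hK cutL[OF u(1)]] this]
    have lim: "(\<lambda>j. Lp_norm r (?k (u (s j)))) \<longlonglongrightarrow> Lp_norm r (?k v)" .
    have inv0: "(\<lambda>j. inverse (real (Suc (s j)))) \<longlonglongrightarrow> 0"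
      using LIMSEQ_subseq_LIMSEQ[OF LIMSEQ_inverse_real_of_nat s] by (simp add: o_def)
    have ev: "\<forall>\<^sub>F j in sequentially. N - inverse (real (Suc (s j))) \<le> Lp_norm r (?k (u (s j))) + (e + (N + e) * e)"
      using order_tendstoD(2)[OF inv0 \<kappa>]
    proof eventually_elim
      case (elim j)
      have "N - \<kappa> \<le> Lp_norm r (K (u (s j)))" using elim u(3)[of "s j"] by linarith
      from tight[OF u(1,2) this u(4) LQ] have tail: "Lp_norm p (cut (- cube Q) (u (s j))) \<le> e" .
      show ?case
        using u(3)[of "s j"] kernel_conv_norm_le(3)[OF h hK u(1)[of "s j"]]
          kernel_conv_cut_le(1)[OF h hK e0 u(1) tail] unfolding u(2) by linarith
    qed
    have "N - 0 \<le> Lp_norm r (?k v) + (e + (N + e) * e)"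
      by (rule tendsto_le[OF _ tendsto_add[OF lim tendsto_const] tendsto_diff[OF tendsto_const inv0] ev]) simp
    moreover have "Lp_norm r (?k v) \<le> Lp_norm r (kernel_conv h v) + (N + e) * e"
      by (rule kernel_conv_cut_le(2)[OF h hK e0 v(1) vQ])
    moreover have "Lp_norm r (kernel_conv h v) \<le> Lp_norm r (K v) + e"
      using kernel_conv_norm_le(4)[OF h hK v(1)] mult_left_mono[OF v(2) e0] by linarith
    ultimately show ?thesis by linarith
  qed
  have "N \<le> Lp_norm r (K v)"
  proof (rule tendsto_lowerbound)
    have "((\<lambda>e. Lp_norm r (K v) + (2 * e + 2 * ((N + e) * e))) \<longlongrightarrow> Lp_norm r (K v) + (2 * 0 + 2 * ((N + 0) * 0))) (at_right 0)"
      by (intro tendsto_intros)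
    then show "((\<lambda>e. Lp_norm r (K v) + (2 * e + 2 * ((N + e) * e))) \<longlongrightarrow> Lp_norm r (K v)) (at_right 0)" by simp
    show "\<forall>\<^sub>F e in at_right 0. N \<le> Lp_norm r (K v) + (2 * e + 2 * ((N + e) * e))"
      by (rule eventually_at_rightI[of 0 1]) (auto intro: main)
  qed simp
  moreover have "Lp_norm r (K v) \<le> N * Lp_norm p v" by (rule K_bound[OF v(1)])
  moreover have "N * Lp_norm p v \<le> N * 1" by (intro mult_left_mono v(2) N_nonneg)
  ultimately have eq: "Lp_norm r (K v) = N" "N * Lp_norm p v = N * 1" by linarith+
  from eq(2) have "Lp_norm p v = 1" using N by simp
  with eq(1) v(1) show ?thesis by blast
qed

end

section \<open>Existence of maximizers\<close>

theorem theorem1: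
  fixes p q r :: real
    and k :: "(real^'n::finite \<Rightarrow> complex) \<Rightarrow> complex"
  assumes "1 < p" and "p < r"
    and "1 / p + 1 / q = 1 + 1 / r"
    and "k \<in> Cnv p r"
    and "\<And>\<epsilon>::real. 0 < \<epsilon> \<Longrightarrow>
      \<exists>h :: real^'n \<Rightarrow> complex. h \<in> borel_measurable lebesgue \<and>
        (\<exists>R>0. \<forall>x. norm x > R \<longrightarrow> h x = 0) \<and>
        h \<in> Linf \<and>
        op_norm p r (conv_op p r (\<lambda>\<phi>. k \<phi> - dist_of_fun h \<phi>)) \<le> ennreal \<epsilon>"
  shows "\<exists>f. maximizer p r (conv_op p r k) f"
proof -
  note p = assms(1) and pr = assms(2) and k = assms(4)
  have p0: "0 < p" and p1: "1 \<le> p" and r0: "0 < r" and r1: "1 \<le> r" and pr': "p \<le> r" using p pr by auto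
  define K where "K = conv_op p r k"
  note ex = Cnv_extension_exists[OF p1 r1 k]
  have Kc: "continuous_Lp p r K" unfolding K_def by (rule conv_op(1)[OF ex])
  have Ks: "AE x in lebesgue. K f x = dist_conv k f x" if "f \<in> schwartz" for f :: "real^'n \<Rightarrow> complex"
    unfolding K_def by (rule conv_op(2)[OF ex that])
  have td: "tempered_distribution k" using k by (simp add: Cnv_def)
  note KL = continuous_LpD(1)[OF Kc]
  have hom: "AE x in lebesgue. K (\<lambda>x. c * f x) x = c * K f x" if "f \<in> Lp p" for c and f :: "real^'n \<Rightarrow> complex"
    by (rule continuous_Lp_homogeneous[OF p1 r1 Kc td Ks that])
  obtain C where C: "0 \<le> C" "\<And>f. f \<in> Lp p \<Longrightarrow> Lp_norm r (K f) \<le> C * Lp_norm p f"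
    using continuous_Lp_bounded[OF p1 r1 Kc k Ks] by blast
  have "op_norm p r K \<le> ennreal C" unfolding op_norm_def
  proof (rule SUP_least)
    fix f :: "real^'n \<Rightarrow> complex" assume f: "f \<in> {f \<in> Lp p. Lp_norm p f \<le> 1}"
    then have "Lp_norm r (K f) \<le> C * 1" using C(2)[of f] mult_left_mono[of "Lp_norm p f" 1 C] C(1) by auto
    then show "ennreal (Lp_norm r (K f)) \<le> ennreal C" by (simp add: ennreal_leI)
  qed
  then have fin: "op_norm p r K < \<infinity>" by (rule le_less_trans) simp
  define N where "N = enn2real (op_norm p r K)"
  have N: "op_norm p r K = ennreal N" using fin by (simp add: N_def)
  have N0: "0 \<le> N" by (simp add: N_def)
  have K_bound: "Lp_norm r (K f) \<le> N * Lp_norm p f" if "f \<in> Lp p" for f :: "real^'n \<Rightarrow> complex"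
    by (rule op_norm_bound[where K = K, OF p1 r1 KL hom N0 _ that]) (simp_all add: N)
  have approx: "\<exists>h R M. bounded_kernel h R M \<and>
      (\<forall>f\<in>Lp p. Lp_norm r (\<lambda>x. K f x - kernel_conv h f x) \<le> \<epsilon> * Lp_norm p f)" if \<epsilon>: "0 < \<epsilon>" for \<epsilon>
  proof -
    obtain h R where h: "h \<in> borel_measurable lebesgue" "0 < R" "\<forall>x. norm x > R \<longrightarrow> h x = 0" "h \<in> Linf"
      "op_norm p r (conv_op p r (\<lambda>\<phi>. k \<phi> - dist_of_fun h \<phi>)) \<le> ennreal \<epsilon>"
      using assms(5)[OF \<epsilon>] by blast
    obtain M where M: "AE x in lebesgue. cmod (h x) \<le> M" using h(4) by (auto simp: Linf_def)
    have bk: "bounded_kernel h R (max M 0)"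
    proof
      show "AE x in lebesgue. cmod (h x) \<le> max M 0" using M by eventually_elim simp
    qed (use h in auto)
    define T where "T = conv_op p r (\<lambda>\<phi>. k \<phi> - dist_of_fun h \<phi>)"
    interpret bounded_kernel h R "max M 0" by (rule bk)
    have Tc: "continuous_Lp p r T" unfolding T_def by (rule conv_op_diff_kernel(1)[OF p pr' k bk])
    have TK: "AE x in lebesgue. T f x = K f x - kernel_conv h f x" if "f \<in> Lp p" for f :: "real^'n \<Rightarrow> complex"
      unfolding T_def K_def by (rule conv_op_diff_kernel(2)[OF p pr' k bk that])
    note TL = continuous_LpD(1)[OF Tc]
    have Thom: "AE x in lebesgue. T (\<lambda>x. c * f x) x = c * T f x" if f: "f \<in> Lp p" for c and f :: "real^'n \<Rightarrow> complex"
      using TK[OF f] TK[OF Lp_scale(1)[OF p0 f, of c]] hom[OF f, of c]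
      by eventually_elim (simp add: kernel_conv_cmult right_diff_distrib)
    have Tb: "Lp_norm r (T f) \<le> \<epsilon> * Lp_norm p f" if "f \<in> Lp p" for f :: "real^'n \<Rightarrow> complex"
      using op_norm_bound[where K = T, OF p1 r1 TL Thom less_imp_le[OF \<epsilon>] _ that] h(5) by (simp add: T_def)
    have "Lp_norm r (\<lambda>x. K f x - kernel_conv h f x) \<le> \<epsilon> * Lp_norm p f" if f: "f \<in> Lp p" for f :: "real^'n \<Rightarrow> complex"
    proof -
      have "(\<lambda>x. K f x - kernel_conv h f x) \<in> borel_measurable lebesgue"
        by (rule LpD(1)[OF Lp_diff(1)[OF r1 KL[OF f] continuous_LpD(1)[OF continuous_Lp_kernel_conv[OF p pr'] f]]])
      from Lp_norm_cong_AE[OF LpD(1)[OF TL[OF f]] this TK[OF f]] Tb[OF f] show ?thesis by metis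
    qed
    with bk show ?thesis by blast
  qed
  interpret kernel_approximable K p r N
    by standard (use p pr N0 KL K_bound approx in auto)
  have "\<exists>f\<in>Lp p. Lp_norm p f = 1 \<and> Lp_norm r (K f) = N"
  proof (cases "N = 0")
    case True
    define f where "f = (\<lambda>x::real^'n. indicator (cbox 0 One) x :: complex)"
    have f: "f \<in> Lp p" "Lp_norm p f = 1"
      using Lp_indicator_lmeasurable[OF lmeasurable_cbox[of "0 :: real^'n" One], where p = p] by (simp_all add: f_def)
    have "Lp_norm r (K f) = 0" using K_bound[OF f(1)] True Lp_norm_nonneg[of r "K f"] by simp
    with f True show ?thesis by blast
  next
    case False
    with N0 have N_pos: "0 < N" by simp
    show ?thesis
    proof (rule maximizer_exists[OF N_pos])
      fix f :: "real^'n \<Rightarrow> complex" and a assume f: "f \<in> Lp p"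
      have "Lp_norm r (K (\<lambda>x. f (x - a))) = Lp_norm r (\<lambda>x. K f (x - a))"
        by (rule Lp_norm_cong_AE[OF LpD(1)[OF KL[OF Lp_translate(1)[OF f]]]
              LpD(1)[OF Lp_translate(1)[OF KL[OF f]]] continuous_Lp_translation_invariant[OF p1 r1 Kc Ks f]])
      then show "Lp_norm r (K (\<lambda>x. f (x - a))) = Lp_norm r (K f)"
        using Lp_translate(2)[OF KL[OF f]] by simp
    next
      fix \<kappa> :: real assume \<kappa>: "0 < \<kappa>"
      \<comment> \<open>keeps the lower bound positive, so that \<open>f\<close> can be normalized\<close>
      define \<mu> where "\<mu> = min \<kappa> (N / 2)"
      have \<mu>: "0 < \<mu>" "\<mu> \<le> \<kappa>" "\<mu> < N" using \<kappa> N_pos by (auto simp: \<mu>_def)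
      have "ennreal (N - \<mu>) < op_norm p r K" unfolding N using \<mu> by (simp add: ennreal_less_iff)
      then obtain f where f: "f \<in> Lp p" "Lp_norm p f \<le> 1" "ennreal (N - \<mu>) < ennreal (Lp_norm r (K f))"
        unfolding op_norm_def less_SUP_iff by blast
      from f(3) have Kf: "N - \<mu> < Lp_norm r (K f)" using \<mu> by (simp add: ennreal_less_iff)
      define t where "t = Lp_norm p f"
      have t: "0 < t"
      proof (rule ccontr)
        assume "\<not> 0 < t"
        then have "Lp_norm p f = 0" using Lp_norm_nonneg[of p f] by (simp add: t_def)
        then show False using K_bound[OF f(1)] Kf \<mu> by simp
      qed
      define g where "g = (\<lambda>x. complex_of_real (1 / t) * f x)"
      have g: "g \<in> Lp p" "Lp_norm p g = 1"
        using Lp_scale[OF p0 f(1), of "complex_of_real (1 / t)"] t by (simp_all add: g_def norm_divide t_def[symmetric])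
      have "Lp_norm r (K g) = Lp_norm r (\<lambda>x. complex_of_real (1 / t) * K f x)"
        unfolding g_def
        by (rule Lp_norm_cong_AE[OF LpD(1)[OF KL[OF g(1)[unfolded g_def]]] LpD(1)[OF Lp_scale(1)[OF r0 KL[OF f(1)]]] hom[OF f(1)]])
      also have "\<dots> = (1 / t) * Lp_norm r (K f)"
        unfolding Lp_norm_scale[OF r0] using t by (simp add: norm_divide)
      also have "\<dots> \<ge> 1 * Lp_norm r (K f)" using t f(2) by (intro mult_right_mono) (auto simp: t_def)
      finally have "N - \<kappa> \<le> Lp_norm r (K g)" using Kf \<mu> by linarith
      with g show "\<exists>f\<in>Lp p. Lp_norm p f = 1 \<and> N - \<kappa> \<le> Lp_norm r (K f)" by blast
    qed
  qed
  then obtain f where "f \<in> Lp p" "Lp_norm p f = 1" "Lp_norm r (K f) = N" by blast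
  then have "maximizer p r K f" by (simp add: maximizer_def N)
  then show ?thesis unfolding K_def by blast
qed

end
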